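(* Consider the equation $$\ddot x+g(x)+\gamma\dot x=\varepsilon f(x,t),\qquad \gamma=\varepsilon C,$$ and assume that $\omega'(A_0)\neq 0$ for the invariant torus of the unperturbed system with energy $A_0$ such that $\omega(A_0)=p/q$. Let $\varepsilon\mapsto\gamma_1(\varepsilon)$ and $\varepsilon\mapsto\gamma_2(\varepsilon)$ be the two bifurcation curves of the subharmonic solutions of order $q/p$ (defined in the context). Then, for $\varepsilon_0>0$ small enough, $\gamma_1(\varepsilon)\ge0\ge\gamma_2(\varepsilon)$ for $\varepsilon\in(0,\varepsilon_0)$ and $\gamma_1(\varepsilon)\le0\le\gamma_2(\varepsilon)$ for $\varepsilon\in(-\varepsilon_0,0)$.
   Context: $g$ and $f$ are real-valued and analytic in their arguments, $f$ is $2\pi$-periodic in $t$, and $\varepsilon,C$ are real parameters. The unperturbed equation $\ddot x+g(x)=0$ is assumed to be Liouville-integrable and anisochronous: in the region of the $(x,y)=(x,\dot x)$ plane considered, filled by periodic orbits, there are analytic action-angle coordinates $(\alpha,A)\in\mathbb{T}\times W$ ($\mathbb{T}=\mathbb{R}/2\pi\mathbb{Z}$, $W\subset\mathbb{R}$ open) in which the unperturbed system reads $\dot\alpha=\omega(A)$, $\dot A=0$ with $\omega$ analytic. $p,q$ are relatively prime positive integers and $T=2\pi q$. In these coordinates the full equation takes the form $$\dot\alpha=\omega(A)+\varepsilon F(\alpha,A,C,t),\qquad \dot A=\varepsilon G(\alpha,A,C,t),$$ where $F=\frac{\partial\alpha}{\partial y}\,(f(x,t)-Cy)$ and $G=\frac{\partial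 A}{\partial y}\,(f(x,t)-Cy)$ are expressed in terms of $(\alpha,A)$. Let $(x_0(t),y_0(t))$, $y_0=\dot x_0$, be the unperturbed solution with $\alpha=\omega(A_0)t$, $A=A_0$, and put $$C_0(t_0)=\frac{\langle y_0\,f(x_0(\cdot),\cdot+t_0)\rangle}{\langle y_0^2\rangle},\qquad \langle H\rangle=\frac1T\int_0^T H(t)\,dt .$$ The function $C(\varepsilon,t_0)$: for each $t_0$ there are unique power series $\alpha(t)=\omega(A_0)t+\sum_{k\ge1}\varepsilon^k\alpha^{(k)}(t)$, $A(t)=A_0+\sum_{k\ge1}\varepsilon^kA^{(k)}(t)$, $C(\varepsilon,t_0)=C_0(t_0)+\sum_{k\ge1}\varepsilon^kC_k(t_0)$ such that all $\alpha^{(k)},A^{(k)}$ are $T$-periodic, each $\alpha^{(k)}$ has zero mean over $[0,T]$, and $\dot\alpha=\omega(A)+\varepsilon F(\alpha,A,C,t+t_0)$, $\dot A=\varepsilon G(\alpha,A,C,t+t_0)$ hold to all orders in $\varepsilon$. These series converge for $|\varepsilon|$ small enough, uniformly in $t_0$. Bifurcation curves: $$\gamma_1(\varepsilon)=\varepsilon\sup_{t_0\in[0,2\pi)}C(\varepsilon,t_0),\qquad \gamma_2(\varepsilon)=\varepsilon\inf_{t_0\in[0,2\pi)}C(\varepsilon,t_0).$$ *)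

theory Defs
  imports "HOL-Analysis.Analysis" "HOL-Library.Landau_Symbols"
begin

definition real_analytic_on :: "(real \<Rightarrow> real) \<Rightarrow> real set \<Rightarrow> bool" where
  "real_analytic_on h S \<longleftrightarrow>
     (\<forall>x\<in>S. \<exists>c. \<exists>r>0. \<forall>u. \<bar>u\<bar> < r \<longrightarrow> (\<lambda>n. c n * u ^ n) sums h (x + u))"

definition real_analytic2_on :: "(real \<Rightarrow> real \<Rightarrow> real) \<Rightarrow> (real \<times> real) set \<Rightarrow> bool" where
  "real_analytic2_on h S \<longleftrightarrow>
     (\<forall>(x, y)\<in>S. \<exists>c. \<exists>r>0. \<forall>u v. \<bar>u\<bar> < r \<longrightarrow> \<bar>v\<bar> < r \<longrightarrow>
        ((\<lambda>(i::nat, j::nat). c i j * u ^ i * v ^ j) has_sum h (x + u) (y + v)) UNIV)"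

text \<open>
  The coordinate change is given by the map \<open>(\<alpha>, A) \<mapsto> (X \<alpha> A, Y \<alpha> A)\<close>, with the angle lifted
  to the real line. The inverse coordinates \<open>(\<alpha>, A)\<close>, as functions of \<open>(x, y)\<close>, are then only
  locally single-valued; \<open>inverse_branch\<close> says that the functions \<open>ang\<close>, \<open>act\<close> are the branch
  taking the value \<open>(a, A)\<close> at the point \<open>(X a A, Y a A)\<close>.
\<close>

definition inverse_branch ::
  "real set \<Rightarrow> (real \<Rightarrow> real \<Rightarrow> real) \<Rightarrow> (real \<Rightarrow> real \<Rightarrow> real) \<Rightarrow> real \<Rightarrow> real \<Rightarrow>
   (real \<Rightarrow> real \<Rightarrow> real) \<Rightarrow> (real \<Rightarrow> real \<Rightarrow> real) \<Rightarrow> bool" where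
  "inverse_branch W X Y a A ang act \<longleftrightarrow>
     ang (X a A) (Y a A) = a \<and> act (X a A) (Y a A) = A \<and>
     (\<exists>U. open U \<and> (X a A, Y a A) \<in> U \<and> real_analytic2_on ang U \<and> real_analytic2_on act U \<and>
        (\<forall>(x, y)\<in>U. act x y \<in> W \<and> X (ang x y) (act x y) = x \<and> Y (ang x y) (act x y) = y))"

definition action_angle_coords ::
  "(real \<Rightarrow> real) \<Rightarrow> real set \<Rightarrow> (real \<Rightarrow> real) \<Rightarrow>
   (real \<Rightarrow> real \<Rightarrow> real) \<Rightarrow> (real \<Rightarrow> real \<Rightarrow> real) \<Rightarrow> bool" where
  "action_angle_coords g W \<omega> X Y \<longleftrightarrow>
     open W \<and> real_analytic_on \<omega> W \<and>
     real_analytic2_on X (UNIV \<times> W) \<and> real_analytic2_on Y (UNIV \<times> W) \<and>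
     (\<forall>a. \<forall>A\<in>W. X (a + 2 * pi) A = X a A \<and> Y (a + 2 * pi) A = Y a A) \<and>
     (\<forall>a a'. \<forall>A\<in>W. \<forall>A'\<in>W. X a A = X a' A' \<and> Y a A = Y a' A' \<longrightarrow>
        A = A' \<and> (\<exists>k::int. a' = a + 2 * pi * of_int k)) \<and>
     (\<forall>a. \<forall>A\<in>W. \<exists>ang act. inverse_branch W X Y a A ang act) \<and>
     (\<forall>a. \<forall>A\<in>W. \<forall>t.
        ((\<lambda>s. X (a + \<omega> A * s) A) has_real_derivative Y (a + \<omega> A * t) A) (at t) \<and>
        ((\<lambda>s. Y (a + \<omega> A * s) A) has_real_derivative - g (X (a + \<omega> A * t) A)) (at t))"

text \<open>
  The partial derivatives \<open>\<partial>\<alpha>/\<partial>y\<close> and \<open>\<partial>A/\<partial>y\<close>, expressed in terms of \<open>(\<alpha>, A)\<close>. All branches of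
  the inverse at a given point agree near it, so the descriptions are unique.
\<close>

definition dangle_dy where
  "dangle_dy W X Y a A =
     (THE d. \<exists>ang act. inverse_branch W X Y a A ang act \<and> d = deriv (ang (X a A)) (Y a A))"

definition daction_dy where
  "daction_dy W X Y a A =
     (THE d. \<exists>ang act. inverse_branch W X Y a A ang act \<and> d = deriv (act (X a A)) (Y a A))"

definition F_pert where
  "F_pert W X Y f a A C t = dangle_dy W X Y a A * (f (X a A) t - C * Y a A)"

definition G_pert where
  "G_pert W X Y f a A C t = daction_dy W X Y a A * (f (X a A) t - C * Y a A)"

definition mean :: "real \<Rightarrow> (real \<Rightarrow> real) \<Rightarrow> real" where
  "mean T H = (1 / T) * integral {0..T} H"

definition C_zero ::
  "(real \<Rightarrow> real) \<Rightarrow> (real \<Rightarrow> real \<Rightarrow> real) \<Rightarrow> (real \<Rightarrow> real \<Rightarrow> real) \<Rightarrow> (real \<Rightarrow> real \<Rightarrow> real) \<Rightarrow>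
   real \<Rightarrow> real \<Rightarrow> real \<Rightarrow> real" where
  "C_zero \<omega> X Y f A0 T t0 =
     (let x0 = (\<lambda>t. X (\<omega> A0 * t) A0); y0 = (\<lambda>t. Y (\<omega> A0 * t) A0)
      in mean T (\<lambda>t. y0 t * f (x0 t) (t + t0)) / mean T (\<lambda>t. (y0 t)\<^sup>2))"

definition trunc :: "nat \<Rightarrow> (nat \<Rightarrow> real) \<Rightarrow> real \<Rightarrow> real" where
  "trunc n c \<epsilon> = (\<Sum>k\<le>n. c k * \<epsilon> ^ k)"

text \<open>
  The functions \<open>al k\<close>, \<open>Ac k\<close> and the numbers \<open>c k\<close> are the coefficients of \<open>\<epsilon>^k\<close> in the power
  series for \<open>\<alpha>\<close>, \<open>A\<close> and \<open>C\<close> at a fixed \<open>t0\<close>. That the equations hold to all orders means that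
  for every \<open>n\<close> the series truncated at order \<open>n\<close> solve them up to an error \<open>O(\<epsilon>^(n+1))\<close>.
\<close>

definition subharmonic_series ::
  "real set \<Rightarrow> (real \<Rightarrow> real) \<Rightarrow> (real \<Rightarrow> real \<Rightarrow> real) \<Rightarrow> (real \<Rightarrow> real \<Rightarrow> real) \<Rightarrow>
   (real \<Rightarrow> real \<Rightarrow> real) \<Rightarrow> real \<Rightarrow> real \<Rightarrow> real \<Rightarrow>
   (nat \<Rightarrow> real \<Rightarrow> real) \<Rightarrow> (nat \<Rightarrow> real \<Rightarrow> real) \<Rightarrow> (nat \<Rightarrow> real) \<Rightarrow> bool" where
  "subharmonic_series W \<omega> X Y f A0 T t0 al Ac c \<longleftrightarrow>
     (\<forall>t. al 0 t = \<omega> A0 * t) \<and> (\<forall>t. Ac 0 t = A0) \<and> c 0 = C_zero \<omega> X Y f A0 T t0 \<and>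
     (\<forall>k t. al k field_differentiable at t \<and> Ac k field_differentiable at t) \<and>
     (\<forall>k\<ge>1. (\<forall>t. al k (t + T) = al k t \<and> Ac k (t + T) = Ac k t) \<and> mean T (al k) = 0) \<and>
     (\<forall>n t.
        (\<lambda>\<epsilon>. deriv (\<lambda>s. trunc n (\<lambda>k. al k s) \<epsilon>) t
             - (\<omega> (trunc n (\<lambda>k. Ac k t) \<epsilon>)
                + \<epsilon> * F_pert W X Y f (trunc n (\<lambda>k. al k t) \<epsilon>) (trunc n (\<lambda>k. Ac k t) \<epsilon>)
                      (trunc n c \<epsilon>) (t + t0)))
          \<in> O[at 0](\<lambda>\<epsilon>. \<epsilon> ^ (n + 1)) \<and>
        (\<lambda>\<epsilon>. deriv (\<lambda>s. trunc n (\<lambda>k. Ac k s) \<epsilon>) t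
             - \<epsilon> * G_pert W X Y f (trunc n (\<lambda>k. al k t) \<epsilon>) (trunc n (\<lambda>k. Ac k t) \<epsilon>)
                   (trunc n c \<epsilon>) (t + t0))
          \<in> O[at 0](\<lambda>\<epsilon>. \<epsilon> ^ (n + 1)))"

definition C_sum :: "(nat \<Rightarrow> real \<Rightarrow> real) \<Rightarrow> real \<Rightarrow> real \<Rightarrow> real" where
  "C_sum c \<epsilon> t0 = (\<Sum>k. c k t0 * \<epsilon> ^ k)"

definition gamma1 :: "(nat \<Rightarrow> real \<Rightarrow> real) \<Rightarrow> real \<Rightarrow> real" where
  "gamma1 c \<epsilon> = \<epsilon> * (SUP t0\<in>{0..<2 * pi}. C_sum c \<epsilon> t0)"

definition gamma2 :: "(nat \<Rightarrow> real \<Rightarrow> real) \<Rightarrow> real \<Rightarrow> real" where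
  "gamma2 c \<epsilon> = \<epsilon> * (INF t0\<in>{0..<2 * pi}. C_sum c \<epsilon> t0)"

end

theory Submission
  imports Defs
begin

text \<open>
  For fixed \<open>\<epsilon>\<close>, the subharmonic solutions form a family \<open>(t, t0) \<mapsto> (x, y)\<close> that is periodic in both
  variables, that is, a torus mapped to the phase plane. The integral of the pull-back of \<open>dx \<and> dy\<close> over
  a torus vanishes. Insert the equations \<open>x' = y\<close>, \<open>y' = - g x + \<epsilon> f - \<epsilon> C y\<close> into this integral. The
  terms with \<open>g\<close> and \<open>f\<close> are derivatives of potentials and integrate to zero as well, so only the
  dissipation is left:
  \<open>\<integral>\<integral> \<epsilon> C(\<epsilon>, t0) y (\<partial>x/\<partial>t0 - y) dt dt0 = 0\<close>.
  At \<open>\<epsilon> = 0\<close> the orbit does not depend on \<open>t0\<close>, so the weight \<open>y (\<partial>x/\<partial>t0 - y)\<close> is \<open>- y0\<^sup>2\<close> up to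
  \<open>O(\<epsilon>)\<close>. If \<open>c k\<close> is the first coefficient of \<open>C(\<epsilon>, t0)\<close> that is not identically zero, comparison of
  the terms of order \<open>\<epsilon>^(k+1)\<close> gives \<open>\<integral> c k dt0 \<cdot> \<integral> y0\<^sup>2 dt = 0\<close>. Hence \<open>c k\<close> has mean zero, and being
  continuous it takes a positive value at some \<open>t1\<close> and a negative value at some \<open>t2\<close>. Since
  \<open>C(\<epsilon>, t0) = \<epsilon>^k (c k t0 + O(\<epsilon>))\<close>, the numbers \<open>C(\<epsilon>, t1)\<close> and \<open>C(\<epsilon>, t2)\<close> have opposite signs for
  small \<open>\<epsilon>\<close>, and zero lies between the infimum and the supremum. If every coefficient vanishes, then
  \<open>C = 0\<close>.

  The solutions are only formal series in \<open>\<epsilon>\<close>. The argument is therefore carried out for the series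
  truncated at order \<open>k + 1\<close>, whose residual of order \<open>\<epsilon>^(k+2)\<close> does not disturb the comparison
  (\<open>integral_first_coefficient\<close>, based on \<open>torus_area_identity\<close>). This needs coefficients that
  are differentiable and \<open>2\<pi>\<close>-periodic in \<open>t0\<close>, which must be extracted from the equations: at order
  \<open>k\<close>, periodicity of the action determines \<open>c (k - 1)\<close>, because the dissipation has nonzero mean
  along the unperturbed orbit; periodicity of the angle determines the mean of the action, because
  \<open>\<omega>' \<noteq> 0\<close>; the zero-mean condition determines the mean of the angle. Each of these quantities comes
  from those of lower order by composition with smooth functions, Taylor expansion in \<open>\<epsilon>\<close>,
  integration and division, and these operations preserve smoothness in \<open>(t, t0)\<close>
  (\<open>order_coefficient\<close>, \<open>formal_series_smooth_periodic\<close>).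
\<close>

section \<open>Smooth functions of several variables\<close>

text \<open>
  \<open>C\<^sup>n\<close> functions on an open set. Recursion through directional derivatives keeps all the functions
  involved real-valued, so that closure properties are plain inductions on \<open>n\<close>.
\<close>

primrec Cdiff_on :: "nat \<Rightarrow> ('a::euclidean_space \<Rightarrow> real) \<Rightarrow> 'a set \<Rightarrow> bool" where
  "Cdiff_on 0 h U \<longleftrightarrow> continuous_on U h"
| "Cdiff_on (Suc n) h U \<longleftrightarrow>
     (\<exists>D. (\<forall>x\<in>U. (h has_derivative D x) (at x)) \<and> (\<forall>v. Cdiff_on n (\<lambda>x. D x v) U))"

definition smooth_on :: "('a::euclidean_space \<Rightarrow> real) \<Rightarrow> 'a set \<Rightarrow> bool" where
  "smooth_on h U \<longleftrightarrow> (\<forall>n. Cdiff_on n h U)"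

lemma Cdiff_on_SucE:
  assumes "Cdiff_on (Suc n) h U"
  obtains D where "\<And>x. x \<in> U \<Longrightarrow> (h has_derivative D x) (at x)" "\<And>v. Cdiff_on n (\<lambda>x. D x v) U"
  using assms unfolding Cdiff_on.simps(2) by blast

lemma Cdiff_on_imp_continuous_on: "Cdiff_on n h U \<Longrightarrow> continuous_on U h"
  by (cases n) (auto intro!: continuous_at_imp_continuous_on dest: has_derivative_continuous)

lemma Cdiff_on_SucD: "Cdiff_on (Suc n) h U \<Longrightarrow> Cdiff_on n h U"
proof (induction n arbitrary: h)
  case 0
  then show ?case using Cdiff_on_imp_continuous_on[of "Suc 0" h U] by simp
next
  case (Suc n)
  from Suc.prems obtain D where D: "\<forall>x\<in>U. (h has_derivative D x) (at x)"
    "\<forall>v. Cdiff_on (Suc n) (\<lambda>x. D x v) U"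
    unfolding Cdiff_on.simps(2)[of "Suc n"] by blast
  from D(2) Suc.IH have "\<forall>v. Cdiff_on n (\<lambda>x. D x v) U" by blast
  with D(1) show ?case unfolding Cdiff_on.simps(2)[of n] by blast
qed

lemma Cdiff_on_cong:
  assumes "open U" "\<And>x. x \<in> U \<Longrightarrow> h x = h' x" "Cdiff_on n h U"
  shows "Cdiff_on n h' U"
proof (cases n)
  case 0
  then show ?thesis using assms by (auto cong: continuous_on_cong)
next
  case (Suc m)
  have "(h' has_derivative D) (at x)" if "(h has_derivative D) (at x)" "x \<in> U" for D x
    using has_derivative_transform_within_open[OF that(1) assms(1) that(2)] assms(2) by auto
  with Suc assms(3) show ?thesis by simp blast
qed

lemma Cdiff_on_subset: "Cdiff_on n h U \<Longrightarrow> V \<subseteq> U \<Longrightarrow> Cdiff_on n h V"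
proof (induction n arbitrary: h)
  case 0
  then show ?case by (auto intro: continuous_on_subset)
next
  case (Suc n)
  then show ?case by simp blast
qed

lemma Cdiff_on_const: "Cdiff_on n (\<lambda>x. c) U"
proof (induction n arbitrary: c)
  case (Suc n)
  then show ?case unfolding Cdiff_on.simps(2)
    by (intro exI[of _ "\<lambda>x v. 0"]) auto
qed auto

lemma Cdiff_on_linear:
  assumes "bounded_linear h"
  shows "Cdiff_on n h U"
proof (cases n)
  case 0
  then show ?thesis using assms by (auto simp: linear_continuous_on)
next
  case (Suc m)
  have "(h has_derivative h) (at x)" for x
    using assms by (rule bounded_linear_imp_has_derivative)
  then show ?thesis unfolding Suc Cdiff_on.simps(2)
    by (intro exI[of _ "\<lambda>x. h"]) (auto intro: Cdiff_on_const)
qed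

lemma Cdiff_on_add: "Cdiff_on n f U \<Longrightarrow> Cdiff_on n g U \<Longrightarrow> Cdiff_on n (\<lambda>x. f x + g x) U"
proof (induction n arbitrary: f g)
  case 0
  then show ?case by (auto intro: continuous_intros)
next
  case (Suc n)
  from Suc.prems obtain D E where
    D: "\<And>x. x \<in> U \<Longrightarrow> (f has_derivative D x) (at x)" "\<And>v. Cdiff_on n (\<lambda>x. D x v) U" and
    E: "\<And>x. x \<in> U \<Longrightarrow> (g has_derivative E x) (at x)" "\<And>v. Cdiff_on n (\<lambda>x. E x v) U"
    by (elim Cdiff_on_SucE) blast
  show ?case unfolding Cdiff_on.simps(2)
    by (intro exI[of _ "\<lambda>x v. D x v + E x v"] conjI ballI allI Suc.IH D E has_derivative_add)
qed

lemma Cdiff_on_sum: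
  "(\<And>i. i \<in> I \<Longrightarrow> Cdiff_on n (f i) U) \<Longrightarrow> Cdiff_on n (\<lambda>x. \<Sum>i\<in>I. f i x) U"
  by (induction I rule: infinite_finite_induct) (auto intro: Cdiff_on_add Cdiff_on_const)

lemma Cdiff_on_mult: "Cdiff_on n f U \<Longrightarrow> Cdiff_on n g U \<Longrightarrow> Cdiff_on n (\<lambda>x. f x * g x) U"
proof (induction n arbitrary: f g)
  case 0
  then show ?case by (auto intro: continuous_intros)
next
  case (Suc n)
  from Suc.prems obtain D E where
    D: "\<And>x. x \<in> U \<Longrightarrow> (f has_derivative D x) (at x)" "\<And>v. Cdiff_on n (\<lambda>x. D x v) U" and
    E: "\<And>x. x \<in> U \<Longrightarrow> (g has_derivative E x) (at x)" "\<And>v. Cdiff_on n (\<lambda>x. E x v) U"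
    by (elim Cdiff_on_SucE) blast
  show ?case unfolding Cdiff_on.simps(2)
    by (intro exI[of _ "\<lambda>x v. f x * E x v + D x v * g x"] conjI ballI allI Suc.IH D E
        has_derivative_mult Cdiff_on_add Cdiff_on_SucD[OF Suc.prems(1)] Cdiff_on_SucD[OF Suc.prems(2)])
qed

lemma Cdiff_on_inverse:
  assumes "\<And>x. x \<in> U \<Longrightarrow> g x \<noteq> 0"
  shows "Cdiff_on n g U \<Longrightarrow> Cdiff_on n (\<lambda>x. inverse (g x)) U"
proof (induction n)
  case 0
  then show ?case using assms by (auto intro: continuous_intros)
next
  case (Suc n)
  from Suc.prems obtain E where
    E: "\<And>x. x \<in> U \<Longrightarrow> (g has_derivative E x) (at x)" "\<And>v. Cdiff_on n (\<lambda>x. E x v) U"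
    by (elim Cdiff_on_SucE) blast
  have IH: "Cdiff_on n (\<lambda>x. inverse (g x)) U" by (rule Suc.IH[OF Cdiff_on_SucD[OF Suc.prems]])
  have "((\<lambda>x. inverse (g x)) has_derivative (\<lambda>v. (-1) * (inverse (g x) * E x v * inverse (g x)))) (at x)"
    if "x \<in> U" for x
    using Deriv.has_derivative_inverse[OF assms[OF that] E(1)[OF that]] by simp
  then show ?case unfolding Cdiff_on.simps(2)
    by (intro exI[of _ "\<lambda>x v. (-1) * (inverse (g x) * E x v * inverse (g x))"] conjI ballI allI
        Cdiff_on_mult Cdiff_on_const E IH)
qed

text \<open>
  By the chain rule in coordinates, the derivative of the composition is a sum of products of functions
  to which the induction hypothesis or the assumptions apply.
\<close>

lemma Cdiff_on_compose:
  fixes h :: "'b::euclidean_space \<Rightarrow> real" and \<phi> :: "'a::euclidean_space \<Rightarrow> 'b"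
  assumes V: "\<phi> ` U \<subseteq> V"
  shows "Cdiff_on n h V \<Longrightarrow> (\<And>b. b \<in> Basis \<Longrightarrow> Cdiff_on n (\<lambda>x. \<phi> x \<bullet> b) U) \<Longrightarrow>
         Cdiff_on n (\<lambda>x. h (\<phi> x)) U"
proof (induction n arbitrary: h)
  case 0
  then have "continuous_on U \<phi>" by (auto intro: continuous_on_componentwise[THEN iffD2])
  then show ?case using 0 V by (auto intro!: continuous_on_compose2[of V h U \<phi>])
next
  case (Suc n)
  from Suc.prems(1) obtain D where
    D: "\<And>y. y \<in> V \<Longrightarrow> (h has_derivative D y) (at y)" "\<And>v. Cdiff_on n (\<lambda>x. D x v) V"
    by (elim Cdiff_on_SucE) blast
  from Suc.prems(2) have "\<exists>E. \<forall>b\<in>Basis. (\<forall>x\<in>U. ((\<lambda>x. \<phi> x \<bullet> b) has_derivative E b x) (at x)) \<and>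
      (\<forall>v. Cdiff_on n (\<lambda>x. E b x v) U)"
    by (intro bchoice) auto
  then obtain E where
    E: "\<And>b x. b \<in> Basis \<Longrightarrow> x \<in> U \<Longrightarrow> ((\<lambda>x. \<phi> x \<bullet> b) has_derivative E b x) (at x)"
      "\<And>b v. b \<in> Basis \<Longrightarrow> Cdiff_on n (\<lambda>x. E b x v) U" by blast
  have \<phi>': "(\<phi> has_derivative (\<lambda>v. \<Sum>b\<in>Basis. E b x v *\<^sub>R b)) (at x)" if "x \<in> U" for x
    by (subst has_derivative_componentwise_within) (auto simp: inner_sum_left inner_Basis if_distrib cong: if_cong intro!: E(1) that)
  have comp: "((\<lambda>x. h (\<phi> x)) has_derivative (\<lambda>v. \<Sum>b\<in>Basis. E b x v * D (\<phi> x) b)) (at x)"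
    if "x \<in> U" for x
  proof -
    have hd: "(h has_derivative D (\<phi> x)) (at (\<phi> x))" using D(1) V that by auto
    then have lin: "linear (D (\<phi> x))" by (rule has_derivative_linear)
    have "((\<lambda>x. h (\<phi> x)) has_derivative (\<lambda>v. D (\<phi> x) (\<Sum>b\<in>Basis. E b x v *\<^sub>R b))) (at x)"
      by (rule has_derivative_compose[OF \<phi>'[OF that] hd])
    then show ?thesis by (simp add: linear_sum[OF lin] linear_scale[OF lin])
  qed
  have IH: "Cdiff_on n (\<lambda>x. D (\<phi> x) b) U" for b
    using Suc.IH[OF D(2)] Suc.prems(2) Cdiff_on_SucD by blast
  show ?case unfolding Cdiff_on.simps(2)
    by (intro exI[of _ "\<lambda>x v. \<Sum>b\<in>Basis. E b x v * D (\<phi> x) b"] conjI ballI allI comp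
        Cdiff_on_sum Cdiff_on_mult E IH)
qed

text \<open>
  Membership in each class \<open>C\<^sup>n\<close> supplies its own derivative. On an open set all of them are the
  Frechet derivative, so one derivative serves every order.
\<close>

lemma smooth_on_has_derivativeE:
  assumes "smooth_on h U" "open U"
  obtains D where "\<And>x. x \<in> U \<Longrightarrow> (h has_derivative D x) (at x)" "\<And>v. smooth_on (\<lambda>x. D x v) U"
proof -
  define D where "D x = frechet_derivative h (at x)" for x
  have *: "\<exists>D. (\<forall>x\<in>U. (h has_derivative D x) (at x)) \<and> (\<forall>v. Cdiff_on n (\<lambda>x. D x v) U)" for n
    using assms(1) unfolding smooth_on_def Cdiff_on.simps(2)[symmetric] by blast
  have D: "(h has_derivative D x) (at x)" if "x \<in> U" for x
    using *[of 0] that unfolding D_def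
    by (meson differentiableI frechet_derivative_works)
  have "Cdiff_on n (\<lambda>x. D x v) U" for n v
  proof -
    obtain D' where D': "\<And>x. x \<in> U \<Longrightarrow> (h has_derivative D' x) (at x)"
      "Cdiff_on n (\<lambda>x. D' x v) U" using *[of n] by blast
    have "D' x = D x" if "x \<in> U" for x
      using has_derivative_unique[OF D[OF that] D'(1)[OF that]] by simp
    then show ?thesis by (intro Cdiff_on_cong[OF assms(2) _ D'(2)]) auto
  qed
  then show thesis using that D unfolding smooth_on_def by blast
qed

lemma smooth_on_imp_continuous_on: "smooth_on h U \<Longrightarrow> continuous_on U h"
  unfolding smooth_on_def using Cdiff_on_imp_continuous_on by blast

lemma smooth_on_subset: "smooth_on h U \<Longrightarrow> V \<subseteq> U \<Longrightarrow> smooth_on h V"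
  unfolding smooth_on_def by (blast intro: Cdiff_on_subset)

lemma smooth_on_linear: "bounded_linear h \<Longrightarrow> smooth_on h U"
  unfolding smooth_on_def by (blast intro: Cdiff_on_linear)

lemma smooth_on_const: "smooth_on (\<lambda>x. c) U"
  unfolding smooth_on_def by (blast intro: Cdiff_on_const)

lemma smooth_on_add: "smooth_on f U \<Longrightarrow> smooth_on g U \<Longrightarrow> smooth_on (\<lambda>x. f x + g x) U"
  unfolding smooth_on_def by (blast intro: Cdiff_on_add)

lemma smooth_on_mult: "smooth_on f U \<Longrightarrow> smooth_on g U \<Longrightarrow> smooth_on (\<lambda>x. f x * g x) U"
  unfolding smooth_on_def by (blast intro: Cdiff_on_mult)

lemma smooth_on_minus: "smooth_on f U \<Longrightarrow> smooth_on (\<lambda>x. - f x) U"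
  using smooth_on_mult[OF smooth_on_const[of "-1"], of f U] by simp

lemma smooth_on_diff: "smooth_on f U \<Longrightarrow> smooth_on g U \<Longrightarrow> smooth_on (\<lambda>x. f x - g x) U"
  using smooth_on_add[OF _ smooth_on_minus, of f U g] by simp

lemma smooth_on_divide:
  "smooth_on f U \<Longrightarrow> smooth_on g U \<Longrightarrow> (\<And>x. x \<in> U \<Longrightarrow> g x \<noteq> 0) \<Longrightarrow> smooth_on (\<lambda>x. f x / g x) U"
  unfolding smooth_on_def divide_inverse by (intro allI Cdiff_on_mult Cdiff_on_inverse) auto

lemma smooth_on_sum:
  "(\<And>i. i \<in> I \<Longrightarrow> smooth_on (f i) U) \<Longrightarrow> smooth_on (\<lambda>x. \<Sum>i\<in>I. f i x) U"
  unfolding smooth_on_def by (blast intro: Cdiff_on_sum)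

lemma smooth_on_power: "smooth_on f U \<Longrightarrow> smooth_on (\<lambda>x. f x ^ n) U"
  by (induction n) (auto intro: smooth_on_const smooth_on_mult)

lemma smooth_on_compose:
  fixes h :: "'b::euclidean_space \<Rightarrow> real" and \<phi> :: "'a::euclidean_space \<Rightarrow> 'b"
  assumes "smooth_on h V" "\<And>b. b \<in> Basis \<Longrightarrow> smooth_on (\<lambda>x. \<phi> x \<bullet> b) U" "\<And>x. x \<in> U \<Longrightarrow> \<phi> x \<in> V"
  shows "smooth_on (\<lambda>x. h (\<phi> x)) U"
  using assms Cdiff_on_compose[of \<phi> U V _ h] unfolding smooth_on_def by blast

lemma smooth_on_compose1:
  fixes h :: "real \<Rightarrow> real"
  assumes "smooth_on h V" "smooth_on f U" "\<And>x. x \<in> U \<Longrightarrow> f x \<in> V"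
  shows "smooth_on (\<lambda>x. h (f x)) U"
  by (rule smooth_on_compose[OF assms(1) _ assms(3)]) (use assms(2) in auto)

lemma smooth_on_compose2:
  fixes h :: "real \<times> real \<Rightarrow> real"
  assumes "smooth_on h V" "smooth_on f U" "smooth_on g U" "\<And>x. x \<in> U \<Longrightarrow> (f x, g x) \<in> V"
  shows "smooth_on (\<lambda>x. h (f x, g x)) U"
  by (rule smooth_on_compose[OF assms(1) _ assms(4)]) (use assms(2,3) in \<open>auto simp: Basis_prod_def\<close>)

lemma smooth_on_compose3:
  fixes h :: "real \<times> real \<times> real \<Rightarrow> real"
  assumes "smooth_on h V" "smooth_on f U" "smooth_on g U" "smooth_on k U"
    "\<And>x. x \<in> U \<Longrightarrow> (f x, g x, k x) \<in> V"
  shows "smooth_on (\<lambda>x. h (f x, g x, k x)) U"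
  by (rule smooth_on_compose[OF assms(1) _ assms(5)]) (use assms(2,3,4) in \<open>auto simp: Basis_prod_def\<close>)

lemma smooth_on_compose_linear:
  fixes h :: "'b::euclidean_space \<Rightarrow> real" and \<phi> :: "'a::euclidean_space \<Rightarrow> 'b"
  assumes "smooth_on h V" "bounded_linear \<phi>" "\<And>x. x \<in> U \<Longrightarrow> \<phi> x \<in> V"
  shows "smooth_on (\<lambda>x. h (\<phi> x)) U"
proof (rule smooth_on_compose[OF assms(1) _ assms(3)])
  fix b :: 'b
  have "bounded_linear (\<lambda>x. \<phi> x \<bullet> b)"
    using assms(2) bounded_linear_compose bounded_linear_inner_left by blast
  then show "smooth_on (\<lambda>x. \<phi> x \<bullet> b) U"
    by (rule smooth_on_linear)
qed

section \<open>Real-analytic functions are smooth\<close>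

text \<open>
  The expansion required by \<open>real_analytic2_on\<close>, with its centre moved to the origin and its
  convergence domain made explicit.
\<close>

definition double_series :: "(nat \<Rightarrow> nat \<Rightarrow> real) \<Rightarrow> real \<Rightarrow> (real \<Rightarrow> real \<Rightarrow> real) \<Rightarrow> bool" where
  "double_series c r H \<longleftrightarrow> (\<forall>u v. \<bar>u\<bar> < r \<longrightarrow> \<bar>v\<bar> < r \<longrightarrow>
     ((\<lambda>(i, j). c i j * u ^ i * v ^ j) has_sum H u v) UNIV)"

lemma double_seriesD:
  "double_series c r H \<Longrightarrow> \<bar>u\<bar> < r \<Longrightarrow> \<bar>v\<bar> < r \<Longrightarrow>
     ((\<lambda>(i, j). c i j * u ^ i * v ^ j) has_sum H u v) UNIV"
  unfolding double_series_def by (drule spec, drule spec, drule (1) mp, drule (1) mp, assumption)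

lemma double_seriesI:
  "(\<And>u v. \<bar>u\<bar> < r \<Longrightarrow> \<bar>v\<bar> < r \<Longrightarrow>
     ((\<lambda>(i, j). c i j * u ^ i * v ^ j) has_sum H u v) UNIV) \<Longrightarrow> double_series c r H"
  unfolding double_series_def by (intro allI impI)

lemma real_analytic2_on_iff:
  "real_analytic2_on h S \<longleftrightarrow>
     (\<forall>x y. (x, y) \<in> S \<longrightarrow> (\<exists>c. \<exists>r>0. double_series c r (\<lambda>u v. h (x + u) (y + v))))"
  unfolding real_analytic2_on_def double_series_def
  by (simp only: Ball_def split_paired_All prod.case)

text \<open>
  Summing over \<open>j\<close> first gives a power series in \<open>u\<close>, which may be differentiated termwise. To return to
  a double series, the differentiated terms must be absolutely summable: for \<open>\<bar>u\<bar> < \<rho> < r\<close> they are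
  dominated by the terms at \<open>u = \<rho>\<close>, because \<open>(i + 1) (u / \<rho>)^i\<close> is bounded.
\<close>

lemma double_power_series_partial_derivative:
  fixes c :: "nat \<Rightarrow> nat \<Rightarrow> real" and H :: "real \<Rightarrow> real \<Rightarrow> real"
  assumes S': "double_series c r H"
    and u: "\<bar>u\<bar> < r" and v: "\<bar>v\<bar> < r"
  shows "((\<lambda>(i, j). (real (Suc i) * c (Suc i) j) * u ^ i * v ^ j) has_sum deriv (\<lambda>u. H u v) u) UNIV"
proof -
  note S = double_seriesD[OF S']
  define \<rho> where "\<rho> = (\<bar>u\<bar> + r) / 2"
  have \<rho>: "\<bar>u\<bar> < \<rho>" "\<rho> < r" "0 < \<rho>" using u by (auto simp: \<rho>_def)
  define T where "T = (\<lambda>(i, j). c i j * \<rho> ^ i * v ^ j)"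
  have T: "T summable_on UNIV" unfolding T_def
    using S[of \<rho> v] \<rho> v by (auto simp: summable_on_def)
  \<comment> \<open>The row sums converge because \<open>\<rho> \<noteq> 0\<close> can be divided out of the row of the double series at \<open>(\<rho>, v)\<close>.\<close>
  have row: "(\<lambda>j. c i j * v ^ j) summable_on UNIV" for i
  proof -
    have "T summable_on (Pair i ` UNIV)" by (rule summable_on_subset_banach[OF T]) simp
    then have "(\<lambda>j. T (i, j)) summable_on UNIV"
      by (subst (asm) summable_on_reindex) (auto simp: inj_on_def o_def)
    then have "(\<lambda>j. (1 / \<rho> ^ i) * T (i, j)) summable_on UNIV"
      by (rule summable_on_cmult_right)
    then show ?thesis using \<rho> by (simp add: T_def)
  qed
  define b where "b i = (\<Sum>\<^sub>\<infinity>j. c i j * v ^ j)" for i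
  have row': "((\<lambda>j. c i j * v ^ j) has_sum b i) UNIV" for i
    unfolding b_def using row[of i] by (rule has_sum_infsum)
  have powser: "(\<lambda>i. b i * z ^ i) sums H z v" if "\<bar>z\<bar> < r" for z
  proof (rule has_sum_imp_sums, rule has_sum_SigmaD)
    show "((\<lambda>(i, j). c i j * z ^ i * v ^ j) has_sum H z v) (SIGMA i:UNIV. UNIV)"
      using S[OF that v] by simp
    show "((\<lambda>j. case (i, j) of (i, j) \<Rightarrow> c i j * z ^ i * v ^ j) has_sum b i * z ^ i) UNIV" for i
      using has_sum_cmult_left[OF row'[of i], of "z ^ i"] by (simp add: mult_ac)
  qed
  have a: "((\<lambda>z. \<Sum>n. b n * z ^ n) has_field_derivative (\<Sum>n. diffs b n * u ^ n)) (at u)"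
    by (rule termdiffs_strong'[of r]) (use powser u in \<open>auto simp: sums_iff\<close>)
  have ev: "eventually (\<lambda>z. (\<Sum>n. b n * z ^ n) = H z v) (nhds u)"
  proof -
    have "eventually (\<lambda>z. z \<in> {-r<..<r}) (nhds u)" using u by (intro eventually_nhds_in_open) auto
    then show ?thesis by eventually_elim (use powser in \<open>auto simp: sums_iff abs_less_iff\<close>)
  qed
  have D: "((\<lambda>z. H z v) has_real_derivative (\<Sum>n. diffs b n * u ^ n)) (at u)"
    by (rule iffD1[OF DERIV_cong_ev[OF refl ev refl] a])
  then have deriv: "deriv (\<lambda>z. H z v) u = (\<Sum>n. diffs b n * u ^ n)" by (rule DERIV_imp_deriv)
  have "(\<lambda>n. of_nat n * (u / \<rho>) ^ n) \<longlonglongrightarrow> 0" "(\<lambda>n. (u / \<rho>) ^ n) \<longlonglongrightarrow> 0"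
    using \<rho> by (auto intro!: powser_times_n_limit_0 LIMSEQ_power_zero simp: abs_divide)
  from tendsto_add[OF this] have "Bseq (\<lambda>n. real (Suc n) * (u / \<rho>) ^ n)"
    by (intro convergent_imp_Bseq convergentI[of _ 0]) (simp add: algebra_simps)
  then obtain K where K: "K > 0" "\<And>n. norm (real (Suc n) * (u / \<rho>) ^ n) \<le> K"
    by (auto elim!: BseqE)
  let ?S = "\<lambda>(i, j). (real (Suc i) * c (Suc i) j) * u ^ i * v ^ j"
  have "Infinite_Sum.abs_summable_on ?S UNIV"
  proof (rule Infinite_Sum.abs_summable_on_comparison_test)
    have "T summable_on (map_prod Suc id ` UNIV)" by (rule summable_on_subset_banach[OF T]) simp
    then have "(\<lambda>(i, j). T (Suc i, j)) summable_on UNIV"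
      by (subst (asm) summable_on_reindex) (auto simp: inj_on_def o_def case_prod_unfold map_prod_def)
    then have "(\<lambda>x. (K / \<rho>) * (case x of (i, j) \<Rightarrow> T (Suc i, j))) summable_on UNIV"
      by (rule summable_on_cmult_right)
    then show "Infinite_Sum.abs_summable_on (\<lambda>x. (K / \<rho>) * (case x of (i, j) \<Rightarrow> T (Suc i, j))) UNIV"
      by (rule iffD1[OF summable_on_iff_abs_summable_on_real])
  next
    fix x :: "nat \<times> nat"
    obtain i j where x: "x = (i, j)" by force
    have "\<bar>real (Suc i) * c (Suc i) j * u ^ i * v ^ j\<bar>
        = \<bar>real (Suc i) * (u / \<rho>) ^ i\<bar> * \<bar>c (Suc i) j * \<rho> ^ i * v ^ j\<bar>"
      using \<rho> by (simp add: abs_mult power_divide)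
    also have "\<dots> \<le> K * \<bar>c (Suc i) j * \<rho> ^ i * v ^ j\<bar>"
      using K(2)[of i] by (intro mult_right_mono) auto
    also have "\<dots> = \<bar>(K / \<rho>) * T (Suc i, j)\<bar>"
      using \<rho> K by (simp add: T_def abs_mult)
    finally show "norm (?S x) \<le> norm ((K / \<rho>) * (case x of (i, j) \<Rightarrow> T (Suc i, j)))"
      by (simp add: x)
  qed
  then have "?S summable_on UNIV" by (rule abs_summable_summable)
  then have hs: "(?S has_sum infsum ?S UNIV) (SIGMA i:UNIV. UNIV)" unfolding UNIV_Times_UNIV
    by (rule has_sum_infsum)
  have "((\<lambda>i. diffs b i * u ^ i) has_sum infsum ?S UNIV) UNIV"
  proof (rule has_sum_SigmaD[OF hs])
    show "((\<lambda>j. ?S (i, j)) has_sum diffs b i * u ^ i) UNIV" for i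
      using has_sum_cmult_left[OF row'[of "Suc i"], of "real (Suc i) * u ^ i"]
      by (simp add: mult_ac diffs_def)
  qed
  then have "infsum ?S UNIV = deriv (\<lambda>u. H u v) u"
    unfolding deriv by (intro sums_unique has_sum_imp_sums)
  with hs show "(?S has_sum deriv (\<lambda>u. H u v) u) UNIV" by (simp only: UNIV_Times_UNIV)
qed

text \<open>
  When \<open>norm (u, v) = s \<rho>\<close> with \<open>s \<le> 1\<close>, every term of total degree at least two is at most \<open>s\<^sup>2\<close> times the
  corresponding term at \<open>(\<rho>, \<rho>)\<close>. Hence the remainder after the linear part is quadratic in
  \<open>norm (u, v)\<close>.
\<close>

lemma double_power_series_has_derivative_0:
  fixes c :: "nat \<Rightarrow> nat \<Rightarrow> real" and H :: "real \<Rightarrow> real \<Rightarrow> real"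
  assumes S': "double_series c r H"
    and r: "r > 0"
  shows "((\<lambda>(u, v). H u v) has_derivative (\<lambda>(u, v). c 1 0 * u + c 0 1 * v)) (at (0, 0))"
proof -
  note S = double_seriesD[OF S']
  define \<rho> where "\<rho> = r / 2"
  have \<rho>: "0 < \<rho>" "\<rho> < r" using r by (auto simp: \<rho>_def)
  define F where "F = {(0::nat, 0::nat), (1, 0), (0, 1)}"
  define t where "t u v = (\<lambda>(i, j). c i j * u ^ i * v ^ j)" for u v :: real
  have abs: "Infinite_Sum.abs_summable_on (t \<rho> \<rho>) UNIV"
    by (rule iffD1[OF summable_on_iff_abs_summable_on_real])
      (use S[of \<rho> \<rho>] \<rho> in \<open>auto simp: t_def summable_on_def\<close>)
  define M where "M = (\<Sum>\<^sub>\<infinity>x. norm (t \<rho> \<rho> x))"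
  have Mhs: "((\<lambda>x. norm (t \<rho> \<rho> x)) has_sum M) UNIV" unfolding M_def
    using abs by (rule has_sum_infsum)
  have bound: "\<bar>H u v - (c 0 0 + c 1 0 * u + c 0 1 * v)\<bar> \<le> M / \<rho>\<^sup>2 * (norm (u, v))\<^sup>2"
    if uv: "norm (u, v) \<le> \<rho>" for u v
  proof -
    define s where "s = norm (u, v) / \<rho>"
    have s: "0 \<le> s" "s \<le> 1" using uv \<rho> by (auto simp: s_def)
    have us: "\<bar>u\<bar> \<le> s * \<rho>" "\<bar>v\<bar> \<le> s * \<rho>"
      using norm_fst_le[of u v] norm_snd_le[of v u] \<rho> by (auto simp: s_def)
    have "\<bar>u\<bar> < r" "\<bar>v\<bar> < r"
      using us mult_left_le_one_le[of \<rho> s] s \<rho> by linarith+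
    from S[OF this] have "(t u v has_sum H u v) UNIV" by (simp add: t_def)
    moreover have "(t u v has_sum (c 0 0 + c 1 0 * u + c 0 1 * v)) F"
      using has_sum_finite[of F "t u v"] by (simp add: F_def t_def add_ac)
    ultimately have hs: "(t u v has_sum (H u v - (c 0 0 + c 1 0 * u + c 0 1 * v))) (UNIV - F)"
      by (rule has_sum_Diff) simp
    have le: "norm (t u v x) \<le> s\<^sup>2 * norm (t \<rho> \<rho> x)" if "x \<in> UNIV - F" for x
    proof -
      obtain i j where x: "x = (i, j)" by force
      have ij: "2 \<le> i + j" using that unfolding x F_def by (cases i; cases j) auto
      have "norm (t u v x) = \<bar>c i j\<bar> * (\<bar>u\<bar> ^ i * \<bar>v\<bar> ^ j)"
        by (simp add: t_def x abs_mult power_abs)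
      also have "\<dots> \<le> \<bar>c i j\<bar> * ((s * \<rho>) ^ i * (s * \<rho>) ^ j)"
        using us by (intro mult_left_mono mult_mono power_mono) auto
      also have "\<dots> = s ^ (i + j) * norm (t \<rho> \<rho> x)"
        using \<rho> by (simp add: t_def x abs_mult power_add power_mult_distrib)
      also have "\<dots> \<le> s\<^sup>2 * norm (t \<rho> \<rho> x)"
        using ij s by (intro mult_right_mono power_decreasing) auto
      finally show ?thesis .
    qed
    have "(\<lambda>x. s\<^sup>2 * norm (t \<rho> \<rho> x)) summable_on (UNIV - F)"
      by (rule summable_on_cmult_right, rule summable_on_subset_banach[of _ UNIV]) (use abs in auto)
    have hs2: "((\<lambda>x. s\<^sup>2 * norm (t \<rho> \<rho> x)) has_sum s\<^sup>2 * M) UNIV"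
      using Mhs by (rule has_sum_cmult_right)
    have abs2: "Infinite_Sum.abs_summable_on (t u v) (UNIV - F)"
      by (rule iffD1[OF summable_on_iff_abs_summable_on_real]) (use hs in \<open>auto simp: summable_on_def\<close>)
    have "norm (H u v - (c 0 0 + c 1 0 * u + c 0 1 * v)) \<le> (\<Sum>\<^sub>\<infinity>x\<in>UNIV - F. norm (t u v x))"
      by (rule norm_has_sum_bound[OF has_sum_infsum[OF abs2] hs])
    also have "\<dots> \<le> s\<^sup>2 * M"
      by (rule has_sum_mono_neutral[OF has_sum_infsum[OF abs2] hs2]) (use le in auto)
    also have "\<dots> = M / \<rho>\<^sup>2 * (norm (u, v))\<^sup>2" by (simp add: s_def power_divide)
    finally show ?thesis by simp
  qed
  have H00: "H 0 0 = c 0 0"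
    using bound[of 0 0] \<rho> by (simp add: norm_Pair)
  show ?thesis unfolding has_derivative_at_alt
  proof (intro conjI allI impI)
    show "bounded_linear (\<lambda>(u, v). c 1 0 * u + c 0 1 * v)"
      unfolding case_prod_unfold by (intro bounded_linear_intros)
    fix e :: real assume e: "e > 0"
    define d where "d = min \<rho> (e * \<rho>\<^sup>2 / (\<bar>M\<bar> + 1))"
    have d: "d > 0" using e \<rho> by (auto simp: d_def intro!: divide_pos_pos mult_pos_pos)
    show "\<exists>d>0. \<forall>y. norm (y - (0, 0)) < d \<longrightarrow>
       norm ((case y of (u, v) \<Rightarrow> H u v) - (case (0, 0) of (u, v) \<Rightarrow> H u v)
         - (case y - (0, 0) of (u, v) \<Rightarrow> c 1 0 * u + c 0 1 * v)) \<le> e * norm (y - (0, 0))"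
    proof (intro exI[of _ d] conjI allI impI d)
      fix y :: "real \<times> real" assume y: "norm (y - (0, 0)) < d"
      obtain u v where uv: "y = (u, v)" by force
      have n: "norm (u, v) < d" using y by (simp add: uv)
      have "M / \<rho>\<^sup>2 * (norm (u, v))\<^sup>2 \<le> (\<bar>M\<bar> + 1) / \<rho>\<^sup>2 * (norm (u, v))\<^sup>2"
        using \<rho> by (intro mult_right_mono divide_right_mono) auto
      also have "\<dots> = ((\<bar>M\<bar> + 1) / \<rho>\<^sup>2 * norm (u, v)) * norm (u, v)" by (simp add: power2_eq_square)
      also have "\<dots> \<le> ((\<bar>M\<bar> + 1) / \<rho>\<^sup>2 * (e * \<rho>\<^sup>2 / (\<bar>M\<bar> + 1))) * norm (u, v)"
        using n by (intro mult_right_mono mult_left_mono) (auto simp: d_def)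
      also have "(\<bar>M\<bar> + 1) / \<rho>\<^sup>2 * (e * \<rho>\<^sup>2 / (\<bar>M\<bar> + 1)) = e"
        using \<rho> by simp
      finally have "M / \<rho>\<^sup>2 * (norm (u, v))\<^sup>2 \<le> e * norm (u, v)" .
      with bound[of u v] n show "norm ((case y of (u, v) \<Rightarrow> H u v) - (case (0, 0) of (u, v) \<Rightarrow> H u v)
         - (case y - (0, 0) of (u, v) \<Rightarrow> c 1 0 * u + c 0 1 * v)) \<le> e * norm (y - (0, 0))"
        by (auto simp: uv H00 d_def algebra_simps)
    qed
  qed
qed

lemma real_analytic2_on_swap:
  assumes "real_analytic2_on h S"
  shows "real_analytic2_on (\<lambda>x y. h y x) (prod.swap ` S)"
  unfolding real_analytic2_on_iff
proof (intro allI impI)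
  fix y x assume "(y, x) \<in> prod.swap ` S"
  then have "(x, y) \<in> S" by auto
  with assms obtain c r where r: "r > 0" and S: "double_series c r (\<lambda>u v. h (x + u) (y + v))"
    unfolding real_analytic2_on_iff by blast
  have "double_series (\<lambda>i j. c j i) r (\<lambda>v u. h (x + u) (y + v))"
  proof (rule double_seriesI)
    fix v u assume "\<bar>v\<bar> < r" "\<bar>u\<bar> < r"
    then have "((\<lambda>(i, j). c i j * u ^ i * v ^ j) has_sum h (x + u) (y + v)) (range prod.swap)"
      using double_seriesD[OF S, of u v] by simp
    from iffD1[OF has_sum_reindex this]
    have "((\<lambda>(i, j). c i j * u ^ i * v ^ j) \<circ> prod.swap has_sum h (x + u) (y + v)) UNIV" by simp
    also have "(\<lambda>(i, j). c i j * u ^ i * v ^ j) \<circ> prod.swap = (\<lambda>(i, j). c j i * v ^ i * u ^ j)"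
      by (auto simp: fun_eq_iff)
    finally show "((\<lambda>(i, j). c j i * v ^ i * u ^ j) has_sum h (x + u) (y + v)) UNIV" .
  qed
  with r show "\<exists>c. \<exists>r>0. double_series c r (\<lambda>v u. h (x + u) (y + v))" by blast
qed

lemma deriv_shift: "deriv (\<lambda>u. h (x + u)) u = deriv h (x + u)" for x :: real
proof -
  have "((\<lambda>u. h (x + u)) has_field_derivative D) (at u) \<longleftrightarrow> (h has_field_derivative D) (at (x + u))" for D
    using DERIV_shift[of h D u x] by (simp add: add.commute)
  then show ?thesis unfolding deriv_def by simp
qed

lemma real_analytic2_on_partial1:
  assumes "real_analytic2_on h S"
  shows "real_analytic2_on (\<lambda>x y. deriv (\<lambda>x. h x y) x) S"
  unfolding real_analytic2_on_iff
proof (intro allI impI)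
  fix x y assume "(x, y) \<in> S"
  with assms obtain c r where r: "r > 0" and S: "double_series c r (\<lambda>u v. h (x + u) (y + v))"
    unfolding real_analytic2_on_iff by blast
  have "double_series (\<lambda>i j. real (Suc i) * c (Suc i) j) r
      (\<lambda>u v. deriv (\<lambda>x. h x (y + v)) (x + u))"
  proof (rule double_seriesI)
    fix u v assume "\<bar>u\<bar> < r" "\<bar>v\<bar> < r"
    from double_power_series_partial_derivative[OF S this]
    show "((\<lambda>(i, j). (real (Suc i) * c (Suc i) j) * u ^ i * v ^ j) has_sum
        deriv (\<lambda>x. h x (y + v)) (x + u)) UNIV"
      by (simp only: deriv_shift[of "\<lambda>x. h x (y + v)" x u])
  qed
  with r show "\<exists>c. \<exists>r>0. double_series c r (\<lambda>u v. deriv (\<lambda>x. h x (y + v)) (x + u))" by blast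
qed

lemma real_analytic2_on_partial2:
  assumes "real_analytic2_on h S"
  shows "real_analytic2_on (\<lambda>x y. deriv (h x) y) S"
proof -
  have "real_analytic2_on (\<lambda>y x. deriv (h x) y) (prod.swap ` S)"
    using real_analytic2_on_partial1[OF real_analytic2_on_swap[OF assms]] by simp
  from real_analytic2_on_swap[OF this] show ?thesis by (simp add: image_image)
qed

lemma real_analytic2_on_has_derivative:
  assumes "real_analytic2_on h S" "(x, y) \<in> S"
  shows "((\<lambda>(x, y). h x y) has_derivative
          (\<lambda>(u, v). deriv (\<lambda>x. h x y) x * u + deriv (h x) y * v)) (at (x, y))"
proof -
  from assms obtain c r where r: "r > 0" and S: "double_series c r (\<lambda>u v. h (x + u) (y + v))"
    unfolding real_analytic2_on_iff by blast
  have *: "((\<lambda>p. h (x + fst p) (y + snd p)) has_derivative (\<lambda>(u, v). c 1 0 * u + c 0 1 * v)) (at (0, 0))"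
    using double_power_series_has_derivative_0[OF S r] by (simp add: case_prod_unfold)
  have sh: "((\<lambda>p::real\<times>real. p - (x, y)) has_derivative (\<lambda>p. p)) (at (x, y))"
    by (auto intro!: derivative_eq_intros)
  have D: "((\<lambda>(x, y). h x y) has_derivative (\<lambda>(u, v). c 1 0 * u + c 0 1 * v)) (at (x, y))"
    using has_derivative_compose[OF sh, of "\<lambda>p. h (x + fst p) (y + snd p)"] *
    by (simp add: zero_prod_def case_prod_unfold)
  have p1: "((\<lambda>x. (x, y)) has_derivative (\<lambda>u. (u, 0))) (at x)"
    and p2: "((\<lambda>y. (x, y)) has_derivative (\<lambda>u. (0, u))) (at y)"
    by (auto intro!: derivative_eq_intros)
  have "((\<lambda>x. h x y) has_real_derivative c 1 0) (at x)"
    using has_derivative_compose[OF p1 D] by (simp add: has_field_derivative_def)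
  moreover have "(h x has_real_derivative c 0 1) (at y)"
    using has_derivative_compose[OF p2 D] by (simp add: has_field_derivative_def)
  ultimately show ?thesis using D by (simp add: DERIV_imp_deriv)
qed

text \<open>
  The partial derivatives of an analytic function are analytic again, so the differentiation can be
  repeated.
\<close>

lemma real_analytic2_on_imp_smooth_on:
  assumes "real_analytic2_on h S"
  shows "smooth_on (\<lambda>(x, y). h x y) S"
proof -
  have "real_analytic2_on h S \<Longrightarrow> Cdiff_on n (\<lambda>(x, y). h x y) S" for n h
  proof (induction n arbitrary: h)
    case 0
    then show ?case
      by (auto intro!: continuous_at_imp_continuous_on has_derivative_continuous
          dest: real_analytic2_on_has_derivative)
  next
    case (Suc n)
    let ?D = "\<lambda>z w. deriv (\<lambda>x. h x (snd z)) (fst z) * fst w + deriv (h (fst z)) (snd z) * snd w"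
    have "Cdiff_on n (\<lambda>z. deriv (\<lambda>x. h x (snd z)) (fst z)) S"
      using Suc.IH[OF real_analytic2_on_partial1[OF Suc.prems]] by (simp add: case_prod_unfold)
    moreover have "Cdiff_on n (\<lambda>z. deriv (h (fst z)) (snd z)) S"
      using Suc.IH[OF real_analytic2_on_partial2[OF Suc.prems]] by (simp add: case_prod_unfold)
    ultimately have "Cdiff_on n (\<lambda>z. ?D z w) S" for w
      by (intro Cdiff_on_add Cdiff_on_mult Cdiff_on_const)
    moreover have "((\<lambda>(x, y). h x y) has_derivative ?D z) (at z)" if "z \<in> S" for z
      using real_analytic2_on_has_derivative[OF Suc.prems, of "fst z" "snd z"] that
      by (simp add: case_prod_unfold)
    ultimately show ?case unfolding Cdiff_on.simps(2) by (intro exI[of _ ?D]) blast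
  qed
  with assms show ?thesis unfolding smooth_on_def by blast
qed

text \<open>
  A function of one variable is treated as a function of two variables that ignores the second.
\<close>

lemma real_analytic_on_imp_smooth_on:
  assumes "real_analytic_on h S"
  shows "smooth_on h S"
proof -
  have "real_analytic2_on (\<lambda>x y. h x) (S \<times> UNIV)"
    unfolding real_analytic2_on_iff
  proof (intro allI impI)
    fix x y :: real assume "(x, y) \<in> S \<times> UNIV"
    then have "x \<in> S" by simp
    then obtain c r where r: "r > 0" and c: "\<And>u. \<bar>u\<bar> < r \<Longrightarrow> (\<lambda>n. c n * u ^ n) sums h (x + u)"
      using bspec[OF assms[unfolded real_analytic_on_def]] by metis
    have "double_series (\<lambda>i j. if j = 0 then c i else 0) r (\<lambda>u v. h (x + u))"
    proof (rule double_seriesI)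
      fix u v :: real assume u: "\<bar>u\<bar> < r"
      have "\<bar>(\<bar>u\<bar> + r) / 2\<bar> < r" using u by (auto simp: abs_if)
      from c[OF this] have "summable (\<lambda>n. c n * ((\<bar>u\<bar> + r) / 2) ^ n)" by (simp add: sums_iff)
      from powser_insidea[OF this, of u] have "summable (\<lambda>n. norm (c n * u ^ n))" using u by simp
      from norm_summable_imp_has_sum[OF this c[OF u]]
      have "((\<lambda>n. c n * u ^ n) has_sum h (x + u)) UNIV" .
      then have "((\<lambda>(i, j). (if j = 0 then c i else 0) * u ^ i * v ^ j) has_sum h (x + u)) (range (\<lambda>n. (n, 0)))"
        by (subst has_sum_reindex) (auto simp: inj_on_def o_def)
      then show "((\<lambda>(i, j). (if j = 0 then c i else 0) * u ^ i * v ^ j) has_sum h (x + u)) UNIV"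
        by (rule iffD1[OF has_sum_cong_neutral, rotated -1]) (auto split: if_splits)
    qed
    with r show "\<exists>c. \<exists>r>0. double_series c r (\<lambda>u v. h (x + u))" by blast
  qed
  from real_analytic2_on_imp_smooth_on[OF this]
  have "smooth_on (\<lambda>x. (\<lambda>(x, y). h x) (x, 0::real)) S"
    by (rule smooth_on_compose2) (auto intro!: smooth_on_const smooth_on_linear bounded_linear_ident)
  then show ?thesis by simp
qed

section \<open>Differentiation of smooth functions\<close>

lemma has_derivative_integral_parameter:
  fixes h :: "real \<times> 'p::euclidean_space \<Rightarrow> real"
  assumes D: "\<And>x. (h has_derivative D x) (at x)" and cont: "\<And>v. continuous_on UNIV (\<lambda>x. D x v)"
  shows "((\<lambda>p. integral {a..b} (\<lambda>r. h (r, p))) has_derivative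
          (\<lambda>v. integral {a..b} (\<lambda>r. D (r, p) (0, v)))) (at p)"
proof -
  define B where "B p r = Blinfun (\<lambda>v. D (r, p) (0, v))" for p r
  have lin: "bounded_linear (\<lambda>v. D (r, p) (0, v))" for r p
    by (rule bounded_linear_compose[OF has_derivative_bounded_linear[OF D]]) (intro bounded_linear_intros)
  have B: "blinfun_apply (B p r) = (\<lambda>v. D (r, p) (0, v))" for p r
    unfolding B_def by (rule bounded_linear_Blinfun_apply[OF lin])
  have part: "((\<lambda>p. h (r, p)) has_derivative blinfun_apply (B p r)) (at p within UNIV)" for p r
    unfolding B by (rule has_derivative_compose[OF _ D]) (auto intro!: derivative_eq_intros)
  have hcont: "continuous_on UNIV h"
    using D by (intro continuous_at_imp_continuous_on ballI has_derivative_continuous) auto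
  have int: "(\<lambda>r. h (r, p)) integrable_on cbox a b" for p
    by (intro integrable_continuous continuous_on_compose2[OF hcont] continuous_intros) auto
  have contB: "continuous_on (UNIV \<times> cbox a b) (\<lambda>(p, r). B p r)"
    unfolding case_prod_unfold
  proof (rule continuous_on_blinfun_componentwise)
    fix i :: 'p
    show "continuous_on (UNIV \<times> cbox a b) (\<lambda>x. blinfun_apply (B (fst x) (snd x)) i)"
      unfolding B by (rule continuous_on_compose2[OF cont, where f = "\<lambda>x. (snd x, fst x)"])
        (auto intro!: continuous_intros)
  qed
  have 1: "((\<lambda>p. integral (cbox a b) (\<lambda>r. h (r, p))) has_derivative integral (cbox a b) (B p)) (at p within UNIV)"
    by (rule leibniz_rule[OF part int contB]) auto
  have 2: "blinfun_apply (integral (cbox a b) (B p)) v = integral (cbox a b) (\<lambda>r. D (r, p) (0, v))" for v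
  proof -
    have "continuous_on (cbox a b) ((\<lambda>(p, r). B p r) \<circ> (\<lambda>r. (p, r)))"
      by (intro continuous_on_compose continuous_intros continuous_on_subset[OF contB]) auto
    then have "continuous_on (cbox a b) (B p)" by (simp only: o_def prod.case)
    then have "B p integrable_on cbox a b" by (rule integrable_continuous)
    from blinfun_apply_integral[OF this, of v] show ?thesis by (simp add: B)
  qed
  show ?thesis using has_derivative_eq_rhs[OF 1 ext[OF 2]] by simp
qed

lemma smooth_on_integral:
  fixes h :: "real \<times> 'p::euclidean_space \<Rightarrow> real"
  assumes "smooth_on h UNIV"
  shows "smooth_on (\<lambda>p. integral {a..b} (\<lambda>r. h (r, p))) UNIV"
proof -
  have "Cdiff_on n h UNIV \<Longrightarrow> Cdiff_on n (\<lambda>p. integral {a..b} (\<lambda>r. h (r, p))) UNIV" for n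
    and h :: "real \<times> 'p \<Rightarrow> real"
  proof (induction n arbitrary: h)
    case 0
    then have "continuous_on UNIV h" by simp
    then have "continuous_on (UNIV \<times> cbox a b) (\<lambda>(p, r). h (r, p))"
      unfolding case_prod_unfold
      by (rule continuous_on_compose2) (auto intro!: continuous_intros)
    from integral_continuous_on_param[OF this] show ?case by (simp add: box_real)
  next
    case (Suc n)
    from Suc.prems obtain D where
      D: "\<And>x. (h has_derivative D x) (at x)" "\<And>v. Cdiff_on n (\<lambda>x. D x v) UNIV"
      by (elim Cdiff_on_SucE) blast
    show ?case unfolding Cdiff_on.simps(2)
    proof (intro exI[of _ "\<lambda>p v. integral {a..b} (\<lambda>r. D (r, p) (0, v))"] conjI ballI allI)
      show "((\<lambda>p. integral {a..b} (\<lambda>r. h (r, p))) has_derivative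
          (\<lambda>v. integral {a..b} (\<lambda>r. D (r, p) (0, v)))) (at p)" for p
        by (rule has_derivative_integral_parameter[OF D(1) Cdiff_on_imp_continuous_on[OF D(2)]])
      show "Cdiff_on n (\<lambda>p. integral {a..b} (\<lambda>r. D (r, p) (0, v))) UNIV" for v
        by (rule Suc.IH[OF D(2)])
    qed
  qed
  with assms show ?thesis unfolding smooth_on_def by blast
qed

text \<open>
  Two applications of the mean value theorem, first along \<open>v\<close> and then along \<open>w\<close>. The left-hand side is
  symmetric in \<open>v\<close> and \<open>w\<close>, which is what makes mixed derivatives commute.
\<close>

lemma second_difference_mean_value:
  fixes h :: "'a::euclidean_space \<Rightarrow> real"
  assumes D: "\<And>x. x \<in> ball p r \<Longrightarrow> (h has_derivative D x) (at x)"
    and D1: "\<And>x. x \<in> ball p r \<Longrightarrow> ((\<lambda>x. D x v) has_derivative D1 x) (at x)"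
    and e: "e > 0" "e * (norm v + norm w) < r"
  obtains \<xi> \<eta> where "0 < \<xi>" "\<xi> < e" "0 < \<eta>" "\<eta> < e"
    "h (p + e *\<^sub>R v + e *\<^sub>R w) - h (p + e *\<^sub>R v) - h (p + e *\<^sub>R w) + h p
       = e * e * D1 (p + \<xi> *\<^sub>R v + \<eta> *\<^sub>R w) w"
proof -
  have mem: "p + s *\<^sub>R v + t *\<^sub>R w \<in> ball p r" if "0 \<le> s" "s \<le> e" "0 \<le> t" "t \<le> e" for s t
  proof -
    have "norm (s *\<^sub>R v + t *\<^sub>R w) \<le> s * norm v + t * norm w"
      using norm_triangle_ineq[of "s *\<^sub>R v" "t *\<^sub>R w"] that by simp
    also have "\<dots> \<le> e * norm v + e * norm w" using that by (intro add_mono mult_right_mono) auto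
    also have "\<dots> < r" using e by (simp add: algebra_simps)
    finally have "dist (p + (s *\<^sub>R v + t *\<^sub>R w)) p < r" by (simp add: dist_norm)
    then show ?thesis by (simp add: dist_commute add.assoc)
  qed
  have line: "((\<lambda>s. p + s *\<^sub>R v + t *\<^sub>R w) has_derivative (\<lambda>d. d *\<^sub>R v)) (at s)" for s t
    by (auto intro!: derivative_eq_intros)
  have line': "((\<lambda>t. p + s *\<^sub>R v + t *\<^sub>R w) has_derivative (\<lambda>d. d *\<^sub>R w)) (at t)" for s t
    by (auto intro!: derivative_eq_intros)
  have deriv: "((\<lambda>s. h (p + s *\<^sub>R v + t *\<^sub>R w)) has_real_derivative D (p + s *\<^sub>R v + t *\<^sub>R w) v) (at s)"
    if "0 \<le> s" "s \<le> e" "0 \<le> t" "t \<le> e" for s t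
  proof -
    note hd = D[OF mem[OF that]]
    show ?thesis using has_derivative_compose[OF line hd] linear_scale[OF has_derivative_linear[OF hd]]
      by (simp add: has_field_derivative_def mult_commute_abs)
  qed
  have deriv': "((\<lambda>t. D (p + s *\<^sub>R v + t *\<^sub>R w) v) has_real_derivative D1 (p + s *\<^sub>R v + t *\<^sub>R w) w) (at t)"
    if "0 \<le> s" "s \<le> e" "0 \<le> t" "t \<le> e" for s t
  proof -
    note hd = D1[OF mem[OF that]]
    show ?thesis using has_derivative_compose[OF line' hd] linear_scale[OF has_derivative_linear[OF hd]]
      by (simp add: has_field_derivative_def mult_commute_abs)
  qed
  let ?g = "\<lambda>s. h (p + s *\<^sub>R v + e *\<^sub>R w) - h (p + s *\<^sub>R v + 0 *\<^sub>R w)"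
  have "\<exists>\<xi>>0. \<xi> < e \<and>
      ?g e - ?g 0 = (e - 0) * (D (p + \<xi> *\<^sub>R v + e *\<^sub>R w) v - D (p + \<xi> *\<^sub>R v + 0 *\<^sub>R w) v)"
    by (rule MVT2[OF e(1)], rule DERIV_diff; rule deriv) (use e in auto)
  then obtain \<xi> where \<xi>: "0 < \<xi>" "\<xi> < e"
    "?g e - ?g 0 = (e - 0) * (D (p + \<xi> *\<^sub>R v + e *\<^sub>R w) v - D (p + \<xi> *\<^sub>R v + 0 *\<^sub>R w) v)"
    by blast
  have "\<exists>\<eta>>0. \<eta> < e \<and>
    D (p + \<xi> *\<^sub>R v + e *\<^sub>R w) v - D (p + \<xi> *\<^sub>R v + 0 *\<^sub>R w) v = (e - 0) * D1 (p + \<xi> *\<^sub>R v + \<eta> *\<^sub>R w) w"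
    by (rule MVT2[OF e(1)], rule deriv') (use \<xi> in auto)
  then obtain \<eta> where \<eta>: "0 < \<eta>" "\<eta> < e"
    "D (p + \<xi> *\<^sub>R v + e *\<^sub>R w) v - D (p + \<xi> *\<^sub>R v + 0 *\<^sub>R w) v = (e - 0) * D1 (p + \<xi> *\<^sub>R v + \<eta> *\<^sub>R w) w"
    by blast
  show thesis
    by (rule that[OF \<xi>(1,2) \<eta>(1,2)]) (use \<xi>(3) \<eta>(3) in \<open>simp add: algebra_simps\<close>)
qed

lemma second_derivative_symmetric:
  fixes h :: "'a::euclidean_space \<Rightarrow> real"
  assumes U: "open U" "p \<in> U"
    and D: "\<And>x. x \<in> U \<Longrightarrow> (h has_derivative D x) (at x)"
    and D1: "\<And>x. x \<in> U \<Longrightarrow> ((\<lambda>x. D x v) has_derivative D1 x) (at x)" "continuous_on U (\<lambda>x. D1 x w)"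
    and D2: "\<And>x. x \<in> U \<Longrightarrow> ((\<lambda>x. D x w) has_derivative D2 x) (at x)" "continuous_on U (\<lambda>x. D2 x v)"
  shows "D1 p w = D2 p v"
proof (rule ccontr)
  assume ne: "D1 p w \<noteq> D2 p v"
  \<comment> \<open>Otherwise \<open>D1\<close> and \<open>D2\<close> would stay apart near \<open>p\<close>, while the second difference is \<open>e\<^sup>2\<close> times a value of each of them.\<close>
  define \<epsilon> where "\<epsilon> = \<bar>D1 p w - D2 p v\<bar> / 2"
  have \<epsilon>: "\<epsilon> > 0" using ne by (simp add: \<epsilon>_def)
  have "eventually (\<lambda>x. dist (D1 x w) (D1 p w) < \<epsilon>) (nhds p)"
    using D1(2) U \<epsilon> by (auto simp: continuous_on_eq_continuous_at isCont_def
      intro!: tendstoD[of _ _ "nhds p"] dest!: bspec tendsto_at_iff_tendsto_nhds[THEN iffD1])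
  moreover have "eventually (\<lambda>x. dist (D2 x v) (D2 p v) < \<epsilon>) (nhds p)"
    using D2(2) U \<epsilon> by (auto simp: continuous_on_eq_continuous_at isCont_def
      intro!: tendstoD[of _ _ "nhds p"] dest!: bspec tendsto_at_iff_tendsto_nhds[THEN iffD1])
  moreover have "eventually (\<lambda>x. x \<in> U) (nhds p)" using U by (rule eventually_nhds_in_open)
  ultimately have "eventually (\<lambda>x. x \<in> U \<and> dist (D1 x w) (D1 p w) < \<epsilon> \<and> dist (D2 x v) (D2 p v) < \<epsilon>) (nhds p)"
    by eventually_elim auto
  then obtain r where r: "r > 0" and near: "\<And>x. dist x p < r \<Longrightarrow>
      x \<in> U \<and> dist (D1 x w) (D1 p w) < \<epsilon> \<and> dist (D2 x v) (D2 p v) < \<epsilon>"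
    unfolding eventually_nhds_metric by blast
  have sub: "x \<in> U" if "x \<in> ball p r" for x using near[of x] that by (simp add: dist_commute)
  define e where "e = r / (2 * (norm v + norm w + 1))"
  have nn: "0 < norm v + norm w + 1" by (smt (verit) norm_ge_zero)
  have e: "e > 0" using r nn by (simp add: e_def)
  have "e * (norm v + norm w) \<le> e * (norm v + norm w + 1)" using e by simp
  also have "\<dots> = r / 2" using nn unfolding e_def by (simp add: field_simps)
  also have "\<dots> < r" using r by simp
  finally have er: "e * (norm v + norm w) < r" .
  then have er': "e * (norm w + norm v) < r" by (simp add: add.commute)
  obtain \<xi> \<eta> where 1: "0 < \<xi>" "\<xi> < e" "0 < \<eta>" "\<eta> < e"
    "h (p + e *\<^sub>R v + e *\<^sub>R w) - h (p + e *\<^sub>R v) - h (p + e *\<^sub>R w) + h p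
       = e * e * D1 (p + \<xi> *\<^sub>R v + \<eta> *\<^sub>R w) w"
    by (rule second_difference_mean_value[OF D[OF sub] D1(1)[OF sub] e er]) auto
  obtain \<xi>' \<eta>' where 2: "0 < \<xi>'" "\<xi>' < e" "0 < \<eta>'" "\<eta>' < e"
    "h (p + e *\<^sub>R w + e *\<^sub>R v) - h (p + e *\<^sub>R w) - h (p + e *\<^sub>R v) + h p
       = e * e * D2 (p + \<xi>' *\<^sub>R w + \<eta>' *\<^sub>R v) v"
    by (rule second_difference_mean_value[OF D[OF sub] D2(1)[OF sub] e er']) auto
  have "h (p + e *\<^sub>R v + e *\<^sub>R w) = h (p + e *\<^sub>R w + e *\<^sub>R v)" by (simp add: ac_simps)
  with 1(5) 2(5) have "e * e * D1 (p + \<xi> *\<^sub>R v + \<eta> *\<^sub>R w) w = e * e * D2 (p + \<xi>' *\<^sub>R w + \<eta>' *\<^sub>R v) v"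
    by linarith
  with e have eq: "D1 (p + \<xi> *\<^sub>R v + \<eta> *\<^sub>R w) w = D2 (p + \<xi>' *\<^sub>R w + \<eta>' *\<^sub>R v) v"
    by simp
  have close: "dist (p + s *\<^sub>R a + t *\<^sub>R b) p < r"
    if "0 < s" "s < e" "0 < t" "t < e" "e * (norm a + norm b) < r" for s t and a b :: 'a
  proof -
    have "norm (s *\<^sub>R a + t *\<^sub>R b) \<le> s * norm a + t * norm b"
      using norm_triangle_ineq[of "s *\<^sub>R a" "t *\<^sub>R b"] that by simp
    also have "\<dots> \<le> e * norm a + e * norm b" using that by (intro add_mono mult_right_mono) auto
    also have "\<dots> < r" using that by (simp add: algebra_simps)
    finally show ?thesis by (simp add: dist_norm add.assoc)
  qed
  have "dist (D1 (p + \<xi> *\<^sub>R v + \<eta> *\<^sub>R w) w) (D1 p w) < \<epsilon>"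
    "dist (D2 (p + \<xi>' *\<^sub>R w + \<eta>' *\<^sub>R v) v) (D2 p v) < \<epsilon>"
    using near[OF close[OF 1(1-4) er]] near[OF close[OF 2(1-4) er']] by auto
  with eq show False unfolding \<epsilon>_def dist_real_def by (auto simp: abs_if field_simps split: if_splits)
qed

lemma smooth_on_has_derivative_ex:
  assumes "smooth_on h U" "open U" "x \<in> U"
  shows "\<exists>D. (h has_derivative D) (at x)"
  using smooth_on_has_derivativeE[OF assms(1,2)] assms(3) by metis

lemma partial_derivatives:
  fixes h :: "real \<times> real \<Rightarrow> real"
  assumes "(h has_derivative D) (at (t, s))"
  shows "((\<lambda>t. h (t, s)) has_real_derivative D (1, 0)) (at t)"
    "((\<lambda>s. h (t, s)) has_real_derivative D (0, 1)) (at s)"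
proof -
  have lin: "linear D" by (rule has_derivative_linear[OF assms])
  have "((\<lambda>t. (t, s)) has_derivative (\<lambda>v. (v, 0))) (at t)" by (auto intro!: derivative_eq_intros)
  from has_derivative_compose[OF this assms] have 1: "((\<lambda>t. h (t, s)) has_derivative (\<lambda>v. D (v, 0))) (at t)" .
  have e1: "D (v, 0) = D (1, 0) * v" for v using linear_scale[OF lin, of v "(1, 0)"] by simp
  show "((\<lambda>t. h (t, s)) has_real_derivative D (1, 0)) (at t)"
    unfolding has_field_derivative_def by (rule has_derivative_eq_rhs[OF 1 ext[OF e1]])
  have "((\<lambda>s. (t, s)) has_derivative (\<lambda>v. (0, v))) (at s)" by (auto intro!: derivative_eq_intros)
  from has_derivative_compose[OF this assms] have 2: "((\<lambda>s. h (t, s)) has_derivative (\<lambda>v. D (0, v))) (at s)" .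
  have e2: "D (0, v) = D (0, 1) * v" for v using linear_scale[OF lin, of v "(0, 1)"] by simp
  show "((\<lambda>s. h (t, s)) has_real_derivative D (0, 1)) (at s)"
    unfolding has_field_derivative_def by (rule has_derivative_eq_rhs[OF 2 ext[OF e2]])
qed

lemma has_derivative_slice:
  assumes "(h has_derivative D) (at (e, p))"
  shows "((\<lambda>p. h (e, p)) has_derivative (\<lambda>v. D (0, v))) (at p)"
proof -
  have "((\<lambda>p. (e, p)) has_derivative (\<lambda>v. (0, v))) (at p)" by (auto intro!: derivative_eq_intros)
  from has_derivative_compose[OF this assms] show ?thesis .
qed

lemma smooth_on_slice:
  fixes h :: "real \<times> 'p::euclidean_space \<Rightarrow> real"
  assumes "smooth_on h U"
  shows "smooth_on (\<lambda>p. h (e, p)) {p. (e, p) \<in> U}"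
proof (rule smooth_on_compose[OF assms])
  fix b :: "real \<times> 'p"
  have "smooth_on (\<lambda>p. e * fst b + p \<bullet> snd b) {p. (e, p) \<in> U}"
    by (intro smooth_on_add smooth_on_const smooth_on_linear bounded_linear_inner_left)
  then show "smooth_on (\<lambda>p. (e, p) \<bullet> b) {p. (e, p) \<in> U}" by (simp add: inner_prod_def)
qed simp

lemma antiderivative_real:
  fixes g :: "real \<Rightarrow> real"
  assumes "continuous_on UNIV g"
  obtains G where "\<And>x. (G has_real_derivative g x) (at x)"
proof -
  have "\<exists>G. \<forall>x. -\<infinity> < ereal x \<longrightarrow> ereal x < \<infinity> \<longrightarrow> (G has_vector_derivative g x) (at x)"
    using assms by (intro einterval_antiderivative) (auto simp: continuous_on_eq_continuous_at)
  then show thesis using that by (auto simp: has_real_derivative_iff_has_vector_derivative)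
qed

section \<open>Expansion in powers of a parameter\<close>

text \<open>
  Taylor expansion in the first variable. The coefficients inherit smoothness in \<open>p\<close> from the derivatives
  of \<open>u\<close>; the constant in the remainder is uniform on compact sets of parameters because the next
  derivative is bounded on a compact tube around \<open>{0} \<times> K\<close> inside \<open>U\<close>.
\<close>

lemma smooth_on_taylor:
  fixes u :: "real \<times> 'p::euclidean_space \<Rightarrow> real"
  assumes u: "smooth_on u U" "open U" and U0: "\<And>p. (0, p) \<in> U"
  obtains a where "\<And>j. smooth_on (a j) UNIV"
    "\<And>m K. compact K \<Longrightarrow> \<exists>M \<delta>. \<delta> > 0 \<and> (\<forall>e p. \<bar>e\<bar> \<le> \<delta> \<longrightarrow> p \<in> K \<longrightarrow>
       (e, p) \<in> U \<and> \<bar>u (e, p) - (\<Sum>j\<le>m. a j p * e ^ j)\<bar> \<le> M * \<bar>e\<bar> ^ Suc m)"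
proof -
  have step: "\<exists>h'. smooth_on h' U \<and> (\<forall>e p. (e, p) \<in> U \<longrightarrow> ((\<lambda>e. h (e, p)) has_real_derivative h' (e, p)) (at e))"
    if h: "smooth_on h U" for h :: "real \<times> 'p \<Rightarrow> real"
  proof -
    from smooth_on_has_derivativeE[OF h u(2)]
    obtain D where D: "\<And>x. x \<in> U \<Longrightarrow> (h has_derivative D x) (at x)" "\<And>v. smooth_on (\<lambda>x. D x v) U"
      by blast
    have "((\<lambda>e. h (e, p)) has_real_derivative D (e, p) (1, 0)) (at e)" if "(e, p) \<in> U" for e p
    proof -
      have "((\<lambda>e. (e, p)) has_derivative (\<lambda>v. (v, 0))) (at e)"
        by (intro has_derivative_Pair has_derivative_ident has_derivative_const)
      from has_derivative_compose[OF this D(1)[OF that]]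
      have 1: "((\<lambda>e. h (e, p)) has_derivative (\<lambda>v. D (e, p) (v, 0))) (at e)" .
      have 2: "D (e, p) (v, 0) = D (e, p) (1, 0) * v" for v
        using linear_scale[OF has_derivative_linear[OF D(1)[OF that]], of v "(1, 0)"] by simp
      show ?thesis unfolding has_field_derivative_def
        by (rule has_derivative_eq_rhs[OF 1 ext[OF 2]])
    qed
    then show ?thesis
      by (intro exI[of _ "\<lambda>x. D x (1, 0)"] conjI allI impI D(2))
  qed
  define nx where "nx h = (SOME h'. smooth_on h' U \<and> (\<forall>e p. (e, p) \<in> U \<longrightarrow>
     ((\<lambda>e. h (e, p)) has_real_derivative h' (e, p)) (at e)))" for h :: "real \<times> 'p \<Rightarrow> real"
  have nx: "smooth_on (nx h) U \<and> (\<forall>e p. (e, p) \<in> U \<longrightarrow>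
     ((\<lambda>e. h (e, p)) has_real_derivative nx h (e, p)) (at e))" if "smooth_on h U" for h
    unfolding nx_def by (rule someI_ex[OF step[OF that]])
  define d where "d n = (nx ^^ n) u" for n
  have d_Suc: "d (Suc n) = nx (d n)" for n by (simp add: d_def)
  have d0: "d 0 = u" by (simp add: d_def)
  have d_smooth: "smooth_on (d n) U" for n
  proof (induction n)
    case (Suc n)
    then show ?case unfolding d_Suc by (rule conjunct1[OF nx])
  qed (simp add: d0 u)
  have d_deriv: "((\<lambda>e. d n (e, p)) has_real_derivative d (Suc n) (e, p)) (at e)" if "(e, p) \<in> U" for n e p
    unfolding d_Suc using conjunct2[OF nx[OF d_smooth]] that by simp
  note d = d_smooth d0 d_deriv
  define a where "a n p = d n (0, p) / fact n" for n p
  show thesis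
  proof
    show "smooth_on (a j) UNIV" for j unfolding a_def
      by (intro smooth_on_divide smooth_on_const
          smooth_on_compose_linear[OF d(1)] bounded_linear_intros) (auto simp: U0)
    fix m and K :: "'p set" assume K: "compact K"
    have "{0} \<times> K \<subseteq> U" using U0 by auto
    from Elementary_Topology.tube_lemma[OF K u(2) this] obtain X0 where X0: "0 \<in> X0" "open X0" "X0 \<times> K \<subseteq> U" by blast
    then obtain \<delta> where \<delta>: "\<delta> > 0" "cball 0 \<delta> \<subseteq> X0" by (auto simp: open_contains_cball)
    have sub: "cball 0 \<delta> \<times> K \<subseteq> U" using X0 \<delta> by blast
    have cpt: "compact (d (Suc m) ` (cball 0 \<delta> \<times> K))"
      by (intro compact_continuous_image compact_Times compact_cball K
          continuous_on_subset[OF smooth_on_imp_continuous_on[OF d(1)] sub])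
    then obtain M where M: "\<And>x. x \<in> cball 0 \<delta> \<times> K \<Longrightarrow> norm (d (Suc m) x) \<le> M"
      using compact_imp_bounded[OF cpt] unfolding bounded_iff by auto
    show "\<exists>M \<delta>. \<delta> > 0 \<and> (\<forall>e p. \<bar>e\<bar> \<le> \<delta> \<longrightarrow> p \<in> K \<longrightarrow>
       (e, p) \<in> U \<and> \<bar>u (e, p) - (\<Sum>j\<le>m. a j p * e ^ j)\<bar> \<le> M * \<bar>e\<bar> ^ Suc m)"
    proof (rule exI[of _ M], rule exI[of _ \<delta>], intro conjI allI impI \<delta>(1))
      fix e p assume e: "\<bar>e\<bar> \<le> \<delta>" and p: "p \<in> K"
      then have mem: "t \<in> cball 0 \<delta>" if "\<bar>t\<bar> \<le> \<bar>e\<bar>" for t using that by auto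
      show "(e, p) \<in> U" using sub e p by auto
      have "\<exists>t. \<bar>t\<bar> \<le> \<bar>e\<bar> \<and> u (e, p) = (\<Sum>j<Suc m. d j (0, p) / fact j * e ^ j) + d (Suc m) (t, p) / fact (Suc m) * e ^ Suc m"
      proof (rule Maclaurin_bi_le[where diff = "\<lambda>n e. d n (e, p)" and f = "\<lambda>e. u (e, p)"])
        show "(\<lambda>e. d 0 (e, p)) = (\<lambda>e. u (e, p))" by (simp add: d(2))
        show "\<forall>j t. j < Suc m \<and> \<bar>t\<bar> \<le> \<bar>e\<bar> \<longrightarrow>
            ((\<lambda>e. d j (e, p)) has_real_derivative d (Suc j) (t, p)) (at t)"
        proof (intro allI impI d(3))
          fix j t assume "j < Suc m \<and> \<bar>t\<bar> \<le> \<bar>e\<bar>"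
          then have "(t, p) \<in> cball 0 \<delta> \<times> K" using mem p by blast
          with sub show "(t, p) \<in> U" by (rule subsetD)
        qed
      qed
      then obtain t where t: "\<bar>t\<bar> \<le> \<bar>e\<bar>"
        "u (e, p) = (\<Sum>j<Suc m. d j (0, p) / fact j * e ^ j) + d (Suc m) (t, p) / fact (Suc m) * e ^ Suc m"
        by blast
      have "\<bar>u (e, p) - (\<Sum>j\<le>m. a j p * e ^ j)\<bar> = \<bar>d (Suc m) (t, p) / fact (Suc m)\<bar> * \<bar>e\<bar> ^ Suc m"
        using t(2) by (simp only: a_def lessThan_Suc_atMost abs_mult power_abs) (simp add: abs_mult power_abs)
      also have "\<bar>d (Suc m) (t, p) / fact (Suc m)\<bar> \<le> \<bar>d (Suc m) (t, p)\<bar> / 1"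
        unfolding abs_divide by (intro divide_left_mono) (auto simp del: fact_Suc simp: fact_ge_1)
      also have "\<dots> \<le> M" using M[of "(t, p)"] mem[OF t(1)] p by auto
      finally show "\<bar>u (e, p) - (\<Sum>j\<le>m. a j p * e ^ j)\<bar> \<le> M * \<bar>e\<bar> ^ Suc m"
        by (simp add: mult_right_mono)
    qed
  qed
qed

text \<open>
  By induction on \<open>k\<close>: multiplication by \<open>e\<close> shows that the polynomial without its top term is \<open>o(e^(k-1))\<close>.
  This identifies the coefficients of two expansions that agree to a given order.
\<close>

lemma polynomial_order_limit:
  fixes d :: "nat \<Rightarrow> real"
  assumes "((\<lambda>e. (\<Sum>j\<le>k. d j * e ^ j) / e ^ k) \<longlongrightarrow> L) (at 0)"
  shows "(\<forall>j<k. d j = 0) \<and> d k = L"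
  using assms
proof (induction k arbitrary: L)
  case 0
  then show ?case by (simp add: tendsto_const_iff)
next
  case (Suc k)
  have "((\<lambda>e. e * ((\<Sum>j\<le>Suc k. d j * e ^ j) / e ^ Suc k) - d (Suc k) * e) \<longlongrightarrow> 0 * L - d (Suc k) * 0) (at 0)"
    by (intro tendsto_intros Suc.prems)
  then have lim: "((\<lambda>e. e * ((\<Sum>j\<le>Suc k. d j * e ^ j) / e ^ Suc k) - d (Suc k) * e) \<longlongrightarrow> 0) (at 0)"
    by simp
  have "((\<lambda>e. (\<Sum>j\<le>k. d j * e ^ j) / e ^ k) \<longlongrightarrow> 0) (at 0)"
  proof (rule Lim_transform_eventually[OF lim])
    show "eventually (\<lambda>e. e * ((\<Sum>j\<le>Suc k. d j * e ^ j) / e ^ Suc k) - d (Suc k) * e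
        = (\<Sum>j\<le>k. d j * e ^ j) / e ^ k) (at 0)"
      by (auto simp: eventually_at_filter add_divide_distrib distrib_left)
  qed
  from Suc.IH[OF this] have z: "d j = 0" if "j < Suc k" for j using that by (auto simp: less_Suc_eq)
  then have "(\<Sum>j\<le>Suc k. d j * e ^ j) = d (Suc k) * e ^ Suc k" for e by (auto intro!: sum.neutral)
  with Suc.prems have "((\<lambda>e. d (Suc k) * e ^ Suc k / e ^ Suc k) \<longlongrightarrow> L) (at 0)" by (simp only:)
  then have "((\<lambda>e::real. d (Suc k)) \<longlongrightarrow> L) (at 0)"
    by (rule Lim_transform_eventually) (auto simp: eventually_at_filter)
  with z show ?case by (simp add: tendsto_const_iff)
qed

lemma bigo_power_imp_tendsto:
  assumes "f \<in> O[at 0](\<lambda>e::real. e ^ (n + 1))"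
  shows "((\<lambda>e. f e / e ^ n) \<longlongrightarrow> 0) (at (0::real))"
proof -
  have "(\<lambda>e::real. e ^ (n + 1)) \<in> o[at 0](\<lambda>e. e ^ n)"
  proof (rule smalloI_tendsto)
    have "((\<lambda>e::real. e) \<longlongrightarrow> 0) (at 0)" by (rule tendsto_ident_at)
    then show "((\<lambda>e::real. e ^ (n + 1) / e ^ n) \<longlongrightarrow> 0) (at 0)"
      by (rule Lim_transform_eventually) (auto simp: eventually_at_filter)
    show "eventually (\<lambda>e::real. e ^ n \<noteq> 0) (at 0)" unfolding eventually_at_filter by (intro always_eventually) auto
  qed
  with assms have "f \<in> o[at 0](\<lambda>e. e ^ n)" by (rule landau_o.big_small_trans)
  then show ?thesis by (rule smalloD_tendsto)
qed

lemma bound_imp_tendsto: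
  fixes f :: "real \<Rightarrow> real"
  assumes "\<delta> > 0" "\<And>e. \<bar>e\<bar> \<le> \<delta> \<Longrightarrow> \<bar>f e\<bar> \<le> M * \<bar>e\<bar> ^ Suc n"
  shows "((\<lambda>e. f e / e ^ n) \<longlongrightarrow> 0) (at 0)"
proof (rule bigo_power_imp_tendsto, rule bigoI)
  show "eventually (\<lambda>e. norm (f e) \<le> M * norm (e ^ (n + 1))) (at 0)"
    unfolding eventually_at using assms
    by (intro exI[of _ \<delta>]) (auto simp: dist_real_def power_abs abs_mult)
qed

lemma tendsto_polynomial_at_0: "((\<lambda>e::real. \<Sum>j<Suc k. a j * e ^ j) \<longlongrightarrow> a 0) (at 0)"
proof -
  have "((\<lambda>e::real. \<Sum>j<Suc k. a j * e ^ j) \<longlongrightarrow> (\<Sum>j<Suc k. a j * 0 ^ j)) (at 0)"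
    by (intro tendsto_intros)
  moreover have "(\<Sum>j<Suc k. a j * (0::real) ^ j) = a 0"
    by (simp add: sum.lessThan_Suc_shift del: sum.lessThan_Suc)
  ultimately show ?thesis by simp
qed

text \<open>
  A pointwise order estimate makes the Taylor coefficients vanish up to order \<open>n\<close>. What remains is the Taylor
  remainder, whose bound is uniform. This turns the residual conditions, which are stated for each
  time separately, into estimates that can be integrated.
\<close>

lemma smooth_on_bigo_uniform:
  fixes u :: "real \<times> 'p::euclidean_space \<Rightarrow> real"
  assumes u: "smooth_on u U" "open U" and U0: "\<And>p. (0, p) \<in> U"
    and O: "\<And>p. (\<lambda>e. u (e, p)) \<in> O[at 0](\<lambda>e. e ^ (n + 1))" and K: "compact K"
  shows "\<exists>M \<delta>. \<delta> > 0 \<and> (\<forall>e p. \<bar>e\<bar> \<le> \<delta> \<longrightarrow> p \<in> K \<longrightarrow> (e, p) \<in> U \<and> \<bar>u (e, p)\<bar> \<le> M * \<bar>e\<bar> ^ Suc n)"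
proof -
  from smooth_on_taylor[OF u U0] obtain a where "\<And>j. smooth_on (a j) UNIV" and a:
    "\<And>n K. compact K \<Longrightarrow> \<exists>M \<delta>. \<delta> > 0 \<and> (\<forall>e p. \<bar>e\<bar> \<le> \<delta> \<longrightarrow> p \<in> K \<longrightarrow>
       (e, p) \<in> U \<and> \<bar>u (e, p) - (\<Sum>j\<le>n. a j p * e ^ j)\<bar> \<le> M * \<bar>e\<bar> ^ Suc n)"
    by blast
  have zero: "a j p = 0" if "j \<le> n" for j p
  proof -
    obtain M \<delta> where M: "\<delta> > 0" "\<And>e. \<bar>e\<bar> \<le> \<delta> \<Longrightarrow>
        \<bar>u (e, p) - (\<Sum>j\<le>n. a j p * e ^ j)\<bar> \<le> M * \<bar>e\<bar> ^ Suc n"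
      using a[of "{p}" n] by auto
    have "((\<lambda>e. u (e, p) / e ^ n - (u (e, p) - (\<Sum>j\<le>n. a j p * e ^ j)) / e ^ n) \<longlongrightarrow> 0 - 0) (at 0)"
      by (intro tendsto_diff bigo_power_imp_tendsto[OF O] bound_imp_tendsto[OF M])
    then have "((\<lambda>e. (\<Sum>j\<le>n. a j p * e ^ j) / e ^ n) \<longlongrightarrow> 0) (at 0)"
      by (simp only: diff_divide_distrib[symmetric] diff_diff_eq2 diff_0_right add_diff_cancel_left')
    from polynomial_order_limit[OF this] show ?thesis using that by (cases "j = n") auto
  qed
  from a[OF K, of n] show ?thesis by (simp add: zero)
qed

lemma smooth_on_bigo_1:
  fixes h :: "real \<times> 'p::euclidean_space \<Rightarrow> real"
  assumes "smooth_on h U" "open U" "(0, p) \<in> U"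
  shows "(\<lambda>e. h (e, p)) \<in> O[at 0](\<lambda>e. 1)"
proof (rule bigoI_tendsto)
  have "isCont h (0, p)"
    using smooth_on_imp_continuous_on[OF assms(1)] assms(2,3) by (simp add: continuous_on_eq_continuous_at)
  moreover have "((\<lambda>e::real. (e, p)) \<longlongrightarrow> (0, p)) (at 0)" by (intro tendsto_intros)
  ultimately have "((\<lambda>e. h (e, p)) \<longlongrightarrow> h (0, p)) (at 0)" by (rule isCont_tendsto_compose)
  then show "((\<lambda>e. h (e, p) / 1) \<longlongrightarrow> h (0, p)) (at 0)" by simp
qed simp

lemma bigo_1_mult: "g \<in> O[F](\<lambda>e. 1) \<Longrightarrow> h \<in> O[F](w) \<Longrightarrow> (\<lambda>e. g e * h e :: real) \<in> O[F](w)"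
  using landau_o.big.mult[of g F "\<lambda>e. 1" h w] by simp

text \<open>
  Both points of the difference quotient move with \<open>e\<close>, so differentiability at \<open>z\<close> alone would not be
  enough; continuity of the derivative gives a Lipschitz bound for \<open>\<Phi> - D0\<close> near \<open>z\<close> with an arbitrarily
  small constant.
\<close>

lemma smooth_on_strictly_differentiable:
  fixes \<Phi> :: "'a::euclidean_space \<Rightarrow> real"
  assumes \<Phi>: "smooth_on \<Phi> V" "open V" "z \<in> V" and D0: "(\<Phi> has_derivative D0) (at z)"
    and z0: "(z0 \<longlongrightarrow> z) (at 0)" and k: "k > 0"
  shows "((\<lambda>e. (\<Phi> (z0 e + e ^ k *\<^sub>R w) - \<Phi> (z0 e)) / e ^ k) \<longlongrightarrow> D0 w) (at (0::real))"
proof (rule tendstoI)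
  obtain D where D: "\<And>x. x \<in> V \<Longrightarrow> (\<Phi> has_derivative D x) (at x)" "\<And>v. smooth_on (\<lambda>x. D x v) V"
    using smooth_on_has_derivativeE[OF \<Phi>(1,2)] by blast
  have D0': "D0 = D z" using has_derivative_unique[OF D0 D(1)[OF \<Phi>(3)]] .
  fix \<eta> :: real assume \<eta>: "\<eta> > 0"
  define \<kappa> where "\<kappa> = \<eta> / (norm w + 1)"
  have nw: "0 < norm w + 1" by (smt (verit) norm_ge_zero)
  have \<kappa>: "\<kappa> > 0" using \<eta> nw by (simp add: \<kappa>_def)
  have "((\<lambda>x. \<Sum>b\<in>Basis. \<bar>D x b - D z b\<bar>) \<longlongrightarrow> (\<Sum>b\<in>Basis. \<bar>D z b - D z b\<bar>)) (nhds z)"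
  proof (intro tendsto_intros)
    fix b :: 'a
    have "isCont (\<lambda>x. D x b) z"
      using smooth_on_imp_continuous_on[OF D(2)[of b]] \<Phi>(2,3) by (simp add: continuous_on_eq_continuous_at)
    then show "((\<lambda>x. D x b) \<longlongrightarrow> D z b) (nhds z)"
      unfolding isCont_def by (rule tendsto_at_iff_tendsto_nhds[of "\<lambda>x. D x b", THEN iffD1])
  qed
  then have "eventually (\<lambda>x. (\<Sum>b\<in>Basis. \<bar>D x b - D z b\<bar>) < \<kappa>) (nhds z)"
    using \<kappa> by (intro order_tendstoD) auto
  moreover have "eventually (\<lambda>x. x \<in> V) (nhds z)" using \<Phi>(2,3) by (rule eventually_nhds_in_open)
  ultimately have "eventually (\<lambda>x. x \<in> V \<and> (\<Sum>b\<in>Basis. \<bar>D x b - D z b\<bar>) < \<kappa>) (nhds z)"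
    by eventually_elim auto
  then obtain r where r: "r > 0" and near: "\<And>x. x \<in> ball z r \<Longrightarrow> x \<in> V \<and> (\<Sum>b\<in>Basis. \<bar>D x b - D z b\<bar>) < \<kappa>"
    unfolding eventually_nhds_metric by (auto simp: dist_commute)
  have bound: "\<bar>\<Phi> y - \<Phi> x - D z (y - x)\<bar> \<le> norm (y - x) * \<kappa>" if "x \<in> ball z r" "y \<in> ball z r" for x y
  proof -
    have "norm (\<Phi> y - \<Phi> x - D z (y - x)) \<le> norm (y - x) * \<kappa>"
    proof (rule differentiable_bound_linearization[where S = "ball z r" and f' = D])
      show "x + t *\<^sub>R (y - x) \<in> ball z r" if "t \<in> {0..1}" for t
        using convexD_alt[OF convex_ball \<open>x \<in> ball z r\<close> \<open>y \<in> ball z r\<close>, of t] that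
        by (auto simp: algebra_simps)
      show "(\<Phi> has_derivative D x) (at x within ball z r)" if "x \<in> ball z r" for x
        using D(1) near[OF that] has_derivative_at_withinI by blast
      show "onorm (D x - D z) \<le> \<kappa>" if x: "x \<in> ball z r" for x
      proof (rule onorm_le)
        fix v
        have lin: "linear (\<lambda>v. D x v - D z v)"
          using near[OF x] linear_compose_sub[OF has_derivative_linear[OF D(1)] has_derivative_linear[OF D(1)[OF \<Phi>(3)]]]
          by blast
        have "D x v - D z v = (\<Sum>b\<in>Basis. (v \<bullet> b) * (D x b - D z b))"
          using linear_sum[OF lin, of "\<lambda>b. (v \<bullet> b) *\<^sub>R b" Basis] linear_scale[OF lin]
          by (simp add: euclidean_representation)
        also have "\<bar>\<dots>\<bar> \<le> (\<Sum>b\<in>Basis. \<bar>(v \<bullet> b) * (D x b - D z b)\<bar>)" by (rule sum_abs)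
        also have "\<dots> \<le> (\<Sum>b\<in>Basis. norm v * \<bar>D x b - D z b\<bar>)"
          by (intro sum_mono) (auto simp: abs_mult Basis_le_norm intro!: mult_right_mono)
        also have "\<dots> = norm v * (\<Sum>b\<in>Basis. \<bar>D x b - D z b\<bar>)" by (simp add: sum_distrib_left)
        also have "\<dots> \<le> norm v * \<kappa>" using near[OF x] by (intro mult_left_mono) auto
        finally show "norm ((D x - D z) v) \<le> \<kappa> * norm v" by (simp add: mult.commute)
      qed
    qed (use r in auto)
    then show ?thesis by simp
  qed
  have lin: "linear (D z)" by (rule has_derivative_linear[OF D(1)[OF \<Phi>(3)]])
  have "((\<lambda>e. z0 e + e ^ k *\<^sub>R w) \<longlongrightarrow> z + 0 ^ k *\<^sub>R w) (at 0)"
    by (intro tendsto_intros z0)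
  then have "((\<lambda>e. z0 e + e ^ k *\<^sub>R w) \<longlongrightarrow> z) (at 0)" using k by (simp add: power_0_left)
  from tendstoD[OF this r] tendstoD[OF z0 r]
  have "eventually (\<lambda>e. z0 e + e ^ k *\<^sub>R w \<in> ball z r \<and> z0 e \<in> ball z r \<and> e \<noteq> 0) (at 0)"
    by (auto simp: dist_commute eventually_conj_iff eventually_at_filter)
  then show "eventually (\<lambda>e. dist ((\<Phi> (z0 e + e ^ k *\<^sub>R w) - \<Phi> (z0 e)) / e ^ k) (D0 w) < \<eta>) (at 0)"
  proof eventually_elim
    case (elim e)
    have "\<bar>\<Phi> (z0 e + e ^ k *\<^sub>R w) - \<Phi> (z0 e) - e ^ k * D z w\<bar> \<le> \<bar>e ^ k\<bar> * norm w * \<kappa>"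
      using bound[of "z0 e" "z0 e + e ^ k *\<^sub>R w"] elim linear_scale[OF lin] by simp
    then have "\<bar>\<Phi> (z0 e + e ^ k *\<^sub>R w) - \<Phi> (z0 e) - e ^ k * D z w\<bar> / \<bar>e ^ k\<bar> \<le> norm w * \<kappa>"
      using elim by (simp add: field_simps)
    moreover have "\<bar>\<Phi> (z0 e + e ^ k *\<^sub>R w) - \<Phi> (z0 e) - e ^ k * D z w\<bar> / \<bar>e ^ k\<bar>
        = dist ((\<Phi> (z0 e + e ^ k *\<^sub>R w) - \<Phi> (z0 e)) / e ^ k) (D0 w)"
      using elim unfolding abs_divide[symmetric] dist_real_def by (simp add: D0' diff_divide_distrib)
    moreover have "norm w * \<kappa> < \<eta>" using \<eta> nw by (simp add: \<kappa>_def field_simps)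
    ultimately show ?case by linarith
  qed
qed

section \<open>Coefficients of the formal solutions\<close>

text \<open>
  The coefficients of the series as functions of \<open>(t, t0)\<close>; periodicity refers to \<open>t0\<close>.
\<close>

definition smooth_periodic :: "(real \<times> real \<Rightarrow> real) \<Rightarrow> bool" where
  "smooth_periodic h \<longleftrightarrow> smooth_on h UNIV \<and> (\<forall>t s. h (t, s + 2 * pi) = h (t, s))"

lemma smooth_periodicD:
  "smooth_periodic h \<Longrightarrow> smooth_on h UNIV" "smooth_periodic h \<Longrightarrow> h (t, s + 2 * pi) = h (t, s)"
  unfolding smooth_periodic_def by blast+

lemma smooth_periodicI:
  "smooth_on h UNIV \<Longrightarrow> (\<And>t s. h (t, s + 2 * pi) = h (t, s)) \<Longrightarrow> smooth_periodic h"
  unfolding smooth_periodic_def by blast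

lemma smooth_periodic_const: "smooth_periodic (\<lambda>p. a)"
  by (intro smooth_periodicI smooth_on_const) simp

lemma smooth_periodic_fst: "smooth_periodic fst"
  by (intro smooth_periodicI smooth_on_linear bounded_linear_fst) simp

lemma smooth_periodic_add: "smooth_periodic f \<Longrightarrow> smooth_periodic g \<Longrightarrow> smooth_periodic (\<lambda>p. f p + g p)"
  unfolding smooth_periodic_def by (auto intro: smooth_on_add)

lemma smooth_periodic_diff: "smooth_periodic f \<Longrightarrow> smooth_periodic g \<Longrightarrow> smooth_periodic (\<lambda>p. f p - g p)"
  unfolding smooth_periodic_def by (auto intro: smooth_on_diff)

lemma smooth_periodic_mult: "smooth_periodic f \<Longrightarrow> smooth_periodic g \<Longrightarrow> smooth_periodic (\<lambda>p. f p * g p)"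
  unfolding smooth_periodic_def by (auto intro: smooth_on_mult)

lemma smooth_periodic_divide:
  "smooth_periodic f \<Longrightarrow> smooth_periodic g \<Longrightarrow> (\<And>p. g p \<noteq> 0) \<Longrightarrow> smooth_periodic (\<lambda>p. f p / g p)"
  unfolding smooth_periodic_def by (auto intro: smooth_on_divide)

lemma smooth_periodic_integral:
  assumes "smooth_periodic h"
  shows "smooth_periodic (\<lambda>p. integral {a..b} (\<lambda>r. h (r, snd p)))"
proof (rule smooth_periodicI)
  have "smooth_on (\<lambda>x. h (fst x, snd (snd x))) (UNIV :: (real \<times> real \<times> real) set)"
    by (rule smooth_on_compose2[OF smooth_periodicD(1)[OF assms]])
      (auto intro!: smooth_on_linear bounded_linear_intros)
  from smooth_on_integral[OF this, of a b]
  show "smooth_on (\<lambda>p. integral {a..b} (\<lambda>r. h (r, snd p))) (UNIV :: (real \<times> real) set)" by simp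
qed (simp add: smooth_periodicD[OF assms])

lemma smooth_periodic_integrable:
  assumes "smooth_periodic h"
  shows "(\<lambda>r. h (r, s)) integrable_on {a..b}"
proof -
  have "continuous_on {a..b} (\<lambda>r. h (r, s))"
    by (rule continuous_on_compose2[OF smooth_on_imp_continuous_on[OF smooth_periodicD(1)[OF assms]]])
      (auto intro!: continuous_intros)
  then show ?thesis by (rule integrable_continuous_real)
qed

text \<open>
  The primitive \<open>\<integral>\<^sub>0\<^sup>t h(r, s) dr\<close>, rescaled to the fixed interval \<open>[0, 1]\<close>: differentiation under the integral then
  applies, and \<open>t\<close> may have any sign.
\<close>

lemma smooth_periodic_primitive:
  assumes "smooth_periodic h"
  shows "smooth_periodic (\<lambda>p. integral {0..1} (\<lambda>r. fst p * h (r * fst p, snd p)))"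
proof (rule smooth_periodicI)
  have "smooth_on (\<lambda>x. fst (snd x) * h (fst x * fst (snd x), snd (snd x))) (UNIV :: (real \<times> real \<times> real) set)"
    by (intro smooth_on_mult smooth_on_compose2[OF smooth_periodicD(1)[OF assms]] smooth_on_linear
        bounded_linear_intros) auto
  from smooth_on_integral[OF this, of 0 1]
  show "smooth_on (\<lambda>p. integral {0..1} (\<lambda>r. fst p * h (r * fst p, snd p))) (UNIV :: (real \<times> real) set)"
    by simp
qed (simp add: smooth_periodicD[OF assms])

lemma primitive_as_integral:
  fixes f g :: "real \<Rightarrow> real"
  assumes "\<And>t. (f has_real_derivative g t) (at t)"
  shows "f t = f 0 + integral {0..1} (\<lambda>r. t * g (r * t))"
proof -
  have "((\<lambda>r. f (r * t)) has_real_derivative t * g (r * t)) (at r)" for r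
  proof -
    have "((\<lambda>r. r * t) has_real_derivative t) (at r)" by (auto intro!: derivative_eq_intros)
    from DERIV_chain2[OF assms this] show ?thesis by (simp add: mult.commute)
  qed
  then have "((\<lambda>r. t * g (r * t)) has_integral f (1 * t) - f (0 * t)) {0..1}"
    by (intro fundamental_theorem_of_calculus)
      (auto simp: has_real_derivative_iff_has_vector_derivative[symmetric] intro: has_field_derivative_at_within)
  from integral_unique[OF this] show ?thesis by simp
qed

lemma integral_derivative_period:
  fixes f g :: "real \<Rightarrow> real"
  assumes "\<And>t. (f has_real_derivative g t) (at t)" "f (0 + T) = f 0" "T > 0"
  shows "integral {0..T} g = 0"
proof -
  have "(g has_integral f T - f 0) {0..T}"
    using assms by (intro fundamental_theorem_of_calculus)
      (auto simp: has_real_derivative_iff_has_vector_derivative[symmetric] intro: has_field_derivative_at_within)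
  then show ?thesis using assms by (simp add: integral_unique)
qed

text \<open>
  The right-hand side \<open>\<Theta>0 + e (\<Theta>1 - C \<Theta>2)\<close> is evaluated along the truncated series, and its coefficient of
  order \<open>k = Suc m\<close> is compared with \<open>d k\<close>. The terms of order \<open>k\<close> in angle and action enter only through
  the linear part of \<open>\<Theta>0\<close>, because the other two functions carry a factor \<open>e\<close>; for the same reason the
  coefficient \<open>c m\<close> enters linearly and \<open>c (Suc m)\<close> not at all. Everything else is a function \<open>b\<close>
  of lower-order coefficients, namely a Taylor coefficient of the right-hand side along the series
  truncated one order earlier.
\<close>

lemma order_coefficient:
  fixes \<Theta>0 \<Theta>1 \<Theta>2 :: "real \<times> real \<times> real \<Rightarrow> real" and al Ac :: "nat \<Rightarrow> real \<Rightarrow> real \<Rightarrow> real"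
    and c :: "nat \<Rightarrow> real \<Rightarrow> real"
  assumes V: "open V" and smooth: "smooth_on \<Theta>0 V" "smooth_on \<Theta>1 V" "smooth_on \<Theta>2 V"
    and per: "\<And>a A \<tau>. \<Theta>0 (a, A, \<tau> + 2 * pi) = \<Theta>0 (a, A, \<tau>)" "\<And>a A \<tau>. \<Theta>1 (a, A, \<tau> + 2 * pi) = \<Theta>1 (a, A, \<tau>)"
      "\<And>a A \<tau>. \<Theta>2 (a, A, \<tau> + 2 * pi) = \<Theta>2 (a, A, \<tau>)"
    and V0: "\<And>t s. (al 0 s t, Ac 0 s t, t + s) \<in> V"
    and al: "\<And>j. j < Suc m \<Longrightarrow> smooth_periodic (\<lambda>p. al j (snd p) (fst p))"
    and Ac: "\<And>j. j < Suc m \<Longrightarrow> smooth_periodic (\<lambda>p. Ac j (snd p) (fst p))"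
    and c: "\<And>j. j < m \<Longrightarrow> smooth_periodic (\<lambda>p. c j (snd p))"
  obtains b where "smooth_periodic b"
    "\<And>t s D d. (\<Theta>0 has_derivative D) (at (al 0 s t, Ac 0 s t, t + s)) \<Longrightarrow>
       (\<lambda>e. (\<Sum>j\<le>Suc m. d j * e ^ j) -
          (\<Theta>0 (\<Sum>j\<le>Suc m. al j s t * e ^ j, \<Sum>j\<le>Suc m. Ac j s t * e ^ j, t + s)
           + e * (\<Theta>1 (\<Sum>j\<le>Suc m. al j s t * e ^ j, \<Sum>j\<le>Suc m. Ac j s t * e ^ j, t + s)
             - (\<Sum>j\<le>Suc m. c j s * e ^ j)
               * \<Theta>2 (\<Sum>j\<le>Suc m. al j s t * e ^ j, \<Sum>j\<le>Suc m. Ac j s t * e ^ j, t + s))))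
         \<in> O[at 0](\<lambda>e. e ^ (Suc m + 1)) \<Longrightarrow>
       d (Suc m) = b (t, s) + D (al (Suc m) s t, Ac (Suc m) s t, 0)
         - c m s * \<Theta>2 (al 0 s t, Ac 0 s t, t + s)"
proof -
  \<comment> \<open>The series truncated below order \<open>Suc m\<close>, as functions of \<open>(e, t, s)\<close>.\<close>
  define zl where "zl x = (\<Sum>j<Suc m. al j (snd (snd x)) (fst (snd x)) * fst x ^ j,
     \<Sum>j<Suc m. Ac j (snd (snd x)) (fst (snd x)) * fst x ^ j, fst (snd x) + snd (snd x))"
    for x :: "real \<times> real \<times> real"
  define Cl where "Cl x = (\<Sum>j<m. c j (snd (snd x)) * fst x ^ j)" for x :: "real \<times> real \<times> real"
  define u where "u x = \<Theta>0 (zl x) + fst x * (\<Theta>1 (zl x) - Cl x * \<Theta>2 (zl x))" for x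
  define U where "U = zl -` V"
  have lift: "smooth_on (\<lambda>x. h (snd x)) (UNIV :: (real \<times> real \<times> real) set)"
    if "smooth_periodic h" for h
    by (rule smooth_on_compose_linear[OF smooth_periodicD(1)[OF that] bounded_linear_snd]) simp
  have sm1: "smooth_on (\<lambda>x. \<Sum>j<Suc m. al j (snd (snd x)) (fst (snd x)) * fst x ^ j) S"
    and sm2: "smooth_on (\<lambda>x. \<Sum>j<Suc m. Ac j (snd (snd x)) (fst (snd x)) * fst x ^ j) S"
    and sm3: "smooth_on Cl S"
    and sm4: "smooth_on (\<lambda>x. fst (snd x) + snd (snd x)) S"
    and sm5: "smooth_on fst S"
    for S :: "(real \<times> real \<times> real) set"
  proof -
    have *: "smooth_on fst S" by (intro smooth_on_linear bounded_linear_fst)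
    show "smooth_on (\<lambda>x. \<Sum>j<Suc m. al j (snd (snd x)) (fst (snd x)) * fst x ^ j) S"
      by (intro smooth_on_sum smooth_on_mult smooth_on_power * smooth_on_subset[OF lift[OF al]]) auto
    show "smooth_on (\<lambda>x. \<Sum>j<Suc m. Ac j (snd (snd x)) (fst (snd x)) * fst x ^ j) S"
      by (intro smooth_on_sum smooth_on_mult smooth_on_power * smooth_on_subset[OF lift[OF Ac]]) auto
    show "smooth_on Cl S" unfolding Cl_def
      by (intro smooth_on_sum smooth_on_mult smooth_on_power * smooth_on_subset[OF lift[OF c]]) auto
    show "smooth_on (\<lambda>x. fst (snd x) + snd (snd x)) S"
      by (intro smooth_on_linear bounded_linear_intros)
    show "smooth_on fst S" by (rule *)
  qed
  have "continuous_on UNIV zl" unfolding zl_def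
    by (intro continuous_on_Pair smooth_on_imp_continuous_on[OF sm1] smooth_on_imp_continuous_on[OF sm2]
        smooth_on_imp_continuous_on[OF sm4])
  then have openU: "open U" unfolding U_def using V by (intro open_vimage)
  have zU: "zl x \<in> V" if "x \<in> U" for x using that by (simp add: U_def)
  have comp: "smooth_on (\<lambda>x. h (zl x)) U" if "smooth_on h V" for h
    unfolding zl_def by (rule smooth_on_compose3[OF that sm1 sm2 sm4]) (use zU in \<open>simp add: zl_def\<close>)
  have smu: "smooth_on u U" unfolding u_def
    by (intro smooth_on_add smooth_on_mult smooth_on_diff comp smooth sm3 sm5)
  have z0: "zl (0, (t, s)) = (al 0 s t, Ac 0 s t, t + s)" for t s
    by (simp add: zl_def sum.lessThan_Suc_shift del: sum.lessThan_Suc)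
  have U0: "(0, p) \<in> U" for p using V0 z0[of "fst p" "snd p"] by (simp add: U_def)
  from smooth_on_taylor[OF smu openU U0] obtain a where a: "\<And>j. smooth_on (a j) UNIV"
    "\<And>n K. compact K \<Longrightarrow> \<exists>M \<delta>. \<delta> > 0 \<and> (\<forall>e p. \<bar>e\<bar> \<le> \<delta> \<longrightarrow> p \<in> K \<longrightarrow>
       (e, p) \<in> U \<and> \<bar>u (e, p) - (\<Sum>j\<le>n. a j p * e ^ j)\<bar> \<le> M * \<bar>e\<bar> ^ Suc n)"
    by blast
  \<comment> \<open>\<open>a j\<close> are the Taylor coefficients of \<open>u\<close>, the right-hand side along the truncation.\<close>
  have a_lim: "((\<lambda>e. (u (e, p) - (\<Sum>j\<le>Suc m. a j p * e ^ j)) / e ^ Suc m) \<longlongrightarrow> 0) (at 0)" for p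
  proof -
    obtain M \<delta> where M: "\<delta> > 0" "\<And>e. \<bar>e\<bar> \<le> \<delta> \<Longrightarrow>
        \<bar>u (e, p) - (\<Sum>j\<le>Suc m. a j p * e ^ j)\<bar> \<le> M * \<bar>e\<bar> ^ Suc (Suc m)"
      using a(2)[of "{p}" "Suc m"] by auto
    show ?thesis by (rule bound_imp_tendsto[OF M])
  qed
  show thesis
  proof (rule that[of "a (Suc m)"])
    show "smooth_periodic (a (Suc m))"
    proof (rule smooth_periodicI[OF a(1)])
      fix t s
      have "u (e, (t, s + 2 * pi)) = u (e, (t, s))" for e
      proof -
        have 1: "al j (s + 2 * pi) t = al j s t" "Ac j (s + 2 * pi) t = Ac j s t" if "j < Suc m" for j
          using smooth_periodicD(2)[OF al[OF that], of t s] smooth_periodicD(2)[OF Ac[OF that], of t s] by simp_all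
        have 2: "c j (s + 2 * pi) = c j s" if "j < m" for j
          using smooth_periodicD(2)[OF c[OF that], of t s] by simp
        have "zl (e, (t, s + 2 * pi)) = (fst (zl (e, (t, s))), fst (snd (zl (e, (t, s)))), (t + s) + 2 * pi)"
          unfolding zl_def using 1 by (auto intro!: sum.cong simp del: sum.lessThan_Suc)
        moreover have "zl (e, (t, s)) = (fst (zl (e, (t, s))), fst (snd (zl (e, (t, s)))), t + s)"
          by (simp add: zl_def)
        moreover have "Cl (e, (t, s + 2 * pi)) = Cl (e, (t, s))"
          unfolding Cl_def using 2 by (auto intro!: sum.cong)
        ultimately show ?thesis unfolding u_def by (metis fst_conv per)
      qed
      with tendsto_diff[OF a_lim[of "(t, s)"] a_lim[of "(t, s + 2 * pi)"]]
      have lim: "((\<lambda>e. ((u (e, (t, s)) - (\<Sum>j\<le>Suc m. a j (t, s) * e ^ j)) / e ^ Suc m)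
          - ((u (e, (t, s)) - (\<Sum>j\<le>Suc m. a j (t, s + 2 * pi) * e ^ j)) / e ^ Suc m)) \<longlongrightarrow> 0) (at 0)"
        by (simp only: diff_zero)
      have "((\<lambda>e. (\<Sum>j\<le>Suc m. (a j (t, s + 2 * pi) - a j (t, s)) * e ^ j) / e ^ Suc m) \<longlongrightarrow> 0) (at 0)"
        by (rule Lim_transform_eventually[OF lim])
          (simp add: diff_divide_distrib[symmetric] sum_subtractf left_diff_distrib del: sum.atMost_Suc power_Suc)
      from polynomial_order_limit[OF this] show "a (Suc m) (t, s + 2 * pi) = a (Suc m) (t, s)" by simp
    qed
  next
    fix t s D d
    let ?z = "(al 0 s t, Ac 0 s t, t + s)"
    let ?w = "(al (Suc m) s t, Ac (Suc m) s t, 0::real)"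
    let ?zl = "\<lambda>e. zl (e, (t, s))"
    let ?zk = "\<lambda>e. (\<Sum>j\<le>Suc m. al j s t * e ^ j, \<Sum>j\<le>Suc m. Ac j s t * e ^ j, t + s)"
    let ?C = "\<lambda>e. \<Sum>j\<le>Suc m. c j s * e ^ j" and ?Cl = "\<lambda>e. Cl (e, (t, s))"
    assume D: "(\<Theta>0 has_derivative D) (at ?z)"
      and R: "(\<lambda>e. (\<Sum>j\<le>Suc m. d j * e ^ j) - (\<Theta>0 (?zk e) + e * (\<Theta>1 (?zk e) - ?C e * \<Theta>2 (?zk e))))
         \<in> O[at 0](\<lambda>e. e ^ (Suc m + 1))"
    have split: "(\<Sum>j\<le>Suc m. f j) = (\<Sum>j<Suc m. f j) + f (Suc m)"
      "(\<Sum>j\<le>Suc m. f j) = (\<Sum>j<m. f j) + f m + f (Suc m)" for f :: "nat \<Rightarrow> real"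
      by (simp_all add: lessThan_Suc_atMost[symmetric])
    have zk: "?zk e = ?zl e + e ^ Suc m *\<^sub>R ?w" for e
      by (simp add: zl_def split(1) mult.commute del: sum.atMost_Suc sum.lessThan_Suc power_Suc)
    have Ck: "?C e = ?Cl e + c m s * e ^ m + c (Suc m) s * e ^ Suc m" for e
      by (simp add: Cl_def split(2) del: sum.atMost_Suc sum.lessThan_Suc power_Suc)
    have zlim: "(?zl \<longlongrightarrow> ?z) (at 0)"
      unfolding zl_def fst_conv snd_conv by (intro tendsto_Pair tendsto_polynomial_at_0 tendsto_const)
    have zklim: "(?zk \<longlongrightarrow> ?z) (at 0)"
      unfolding lessThan_Suc_atMost[symmetric] by (intro tendsto_Pair tendsto_polynomial_at_0 tendsto_const)
    obtain D1 where D1: "(\<Theta>1 has_derivative D1) (at ?z)"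
      using smooth_on_has_derivative_ex[OF smooth(2) V V0] ..
    obtain D2 where D2: "(\<Theta>2 has_derivative D2) (at ?z)"
      using smooth_on_has_derivative_ex[OF smooth(3) V V0] ..
    have \<Theta>2lim: "((\<lambda>e. \<Theta>2 (?zk e)) \<longlongrightarrow> \<Theta>2 ?z) (at 0)"
      using has_derivative_continuous[OF D2] zklim by (rule isCont_tendsto_compose)
    have Cllim: "(?Cl \<longlongrightarrow> (\<Sum>j<m. c j s * 0 ^ j)) (at 0)"
      unfolding Cl_def fst_conv snd_conv by (intro tendsto_intros)
    \<comment> \<open>The full truncation \<open>?zk\<close> differs from \<open>?zl\<close> by the increment \<open>e ^ Suc m *\<^sub>R ?w\<close>.\<close>
    note strict = smooth_on_strictly_differentiable[OF _ V V0 _ zlim zero_less_Suc, where w = ?w]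
    note lims = strict[OF smooth(1) D] strict[OF smooth(2) D1] strict[OF smooth(3) D2]
    let ?q = "\<lambda>\<Theta> e. (\<Theta> (?zl e + e ^ Suc m *\<^sub>R ?w) - \<Theta> (?zl e)) / e ^ Suc m"
    let ?Q = "\<lambda>e. ((\<Sum>j\<le>Suc m. d j * e ^ j) - (\<Theta>0 (?zk e) + e * (\<Theta>1 (?zk e) - ?C e * \<Theta>2 (?zk e)))) / e ^ Suc m
         + (u (e, (t, s)) - (\<Sum>j\<le>Suc m. a j (t, s) * e ^ j)) / e ^ Suc m
         + ?q \<Theta>0 e + e * ?q \<Theta>1 e - e * ?Cl e * ?q \<Theta>2 e - (c m s + c (Suc m) s * e) * \<Theta>2 (?zk e)"
    have "((\<lambda>e. ?Q e)
       \<longlongrightarrow> 0 + 0 + D ?w + 0 * D1 ?w - 0 * (\<Sum>j<m. c j s * 0 ^ j) * D2 ?w - (c m s + c (Suc m) s * 0) * \<Theta>2 ?z) (at 0)"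
      by (intro tendsto_intros lims \<Theta>2lim Cllim bigo_power_imp_tendsto[OF R] a_lim)
    then have lim: "((\<lambda>e. ?Q e)
       \<longlongrightarrow> D ?w - c m s * \<Theta>2 ?z) (at 0)"
      by simp
    have "((\<lambda>e. (\<Sum>j\<le>Suc m. (d j - a j (t, s)) * e ^ j) / e ^ Suc m) \<longlongrightarrow> D ?w - c m s * \<Theta>2 ?z) (at 0)"
    proof (rule Lim_transform_eventually[OF lim])
      have alg: "((S1 - (T0 + e * (T1 - C * T2))) / e ^ Suc m + (T0' + e * (T1' - Cl * T2') - S2) / e ^ Suc m
         + (T0 - T0') / e ^ Suc m + e * ((T1 - T1') / e ^ Suc m) - e * Cl * ((T2 - T2') / e ^ Suc m)
         - (c m s + c (Suc m) s * e) * T2) = (S1 - S2) / e ^ Suc m"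
        if "e \<noteq> 0" "C = Cl + c m s * e ^ m + c (Suc m) s * e ^ Suc m" for e S1 S2 T0 T1 T2 T0' T1' T2' C Cl :: real
        unfolding that(2) using that(1) by (simp add: field_simps)
      show "eventually (\<lambda>e. ?Q e
         = (\<Sum>j\<le>Suc m. (d j - a j (t, s)) * e ^ j) / e ^ Suc m) (at 0)"
        unfolding eventually_at_filter u_def fst_conv left_diff_distrib sum_subtractf zk[symmetric]
        by (intro always_eventually allI impI) (rule alg[OF _ Ck])
    qed
    from polynomial_order_limit[OF this]
    show "d (Suc m) = a (Suc m) (t, s) + D ?w - c m s * \<Theta>2 ?z" by simp
  qed
qed

text \<open>
  Induction on the order. Averaging the equation of the action over a period gives \<open>c (k - 1)\<close> as a
  quotient of integrals. Integration then gives \<open>Ac k\<close> up to its value at time zero, which is fixed by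
  averaging the equation of the angle. Integration of the latter gives \<open>al k\<close> up to a constant, fixed
  by the zero-mean condition.
\<close>

lemma formal_series_smooth_periodic:
  fixes \<omega> :: "real \<Rightarrow> real" and F1 F2 G1 G2 :: "real \<times> real \<times> real \<Rightarrow> real"
    and al Ac dal dAc :: "nat \<Rightarrow> real \<Rightarrow> real \<Rightarrow> real" and c :: "nat \<Rightarrow> real \<Rightarrow> real"
  assumes W: "open W" "A0 \<in> W" and \<omega>: "smooth_on \<omega> W" "(\<omega> has_real_derivative \<omega>1) (at A0)" "\<omega>1 \<noteq> 0"
    and T: "T > 0"
    and smooth: "smooth_on F1 (UNIV \<times> W \<times> UNIV)" "smooth_on F2 (UNIV \<times> W \<times> UNIV)"
      "smooth_on G1 (UNIV \<times> W \<times> UNIV)" "smooth_on G2 (UNIV \<times> W \<times> UNIV)"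
    and per: "\<And>a A \<tau>. F1 (a, A, \<tau> + 2 * pi) = F1 (a, A, \<tau>)" "\<And>a A \<tau>. F2 (a, A, \<tau> + 2 * pi) = F2 (a, A, \<tau>)"
      "\<And>a A \<tau>. G1 (a, A, \<tau> + 2 * pi) = G1 (a, A, \<tau>)" "\<And>a A \<tau>. G2 (a, A, \<tau> + 2 * pi) = G2 (a, A, \<tau>)"
    and al0: "\<And>s t. al 0 s t = \<omega>0 * t" and Ac0: "\<And>s t. Ac 0 s t = A0"
    and dal: "\<And>k s t. (al k s has_real_derivative dal k s t) (at t)"
    and dAc: "\<And>k s t. (Ac k s has_real_derivative dAc k s t) (at t)"
    and alT: "\<And>k s. k > 0 \<Longrightarrow> al k s (0 + T) = al k s 0" and AcT: "\<And>k s. k > 0 \<Longrightarrow> Ac k s (0 + T) = Ac k s 0"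
    and mean: "\<And>k s. k > 0 \<Longrightarrow> integral {0..T} (al k s) = 0"
    and R\<alpha>: "\<And>n s t. (\<lambda>e. (\<Sum>j\<le>n. dal j s t * e ^ j) -
          (\<omega> (\<Sum>j\<le>n. Ac j s t * e ^ j)
           + e * (F1 (\<Sum>j\<le>n. al j s t * e ^ j, \<Sum>j\<le>n. Ac j s t * e ^ j, t + s)
             - (\<Sum>j\<le>n. c j s * e ^ j)
               * F2 (\<Sum>j\<le>n. al j s t * e ^ j, \<Sum>j\<le>n. Ac j s t * e ^ j, t + s))))
         \<in> O[at 0](\<lambda>e. e ^ (n + 1))"
    and RA: "\<And>n s t. (\<lambda>e. (\<Sum>j\<le>n. dAc j s t * e ^ j) -
          (e * (G1 (\<Sum>j\<le>n. al j s t * e ^ j, \<Sum>j\<le>n. Ac j s t * e ^ j, t + s)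
             - (\<Sum>j\<le>n. c j s * e ^ j)
               * G2 (\<Sum>j\<le>n. al j s t * e ^ j, \<Sum>j\<le>n. Ac j s t * e ^ j, t + s))))
         \<in> O[at 0](\<lambda>e. e ^ (n + 1))"
    and nondeg: "\<And>s. integral {0..T} (\<lambda>t. G2 (\<omega>0 * t, A0, t + s)) \<noteq> 0"
  shows "smooth_periodic (\<lambda>p. al k (snd p) (fst p)) \<and> smooth_periodic (\<lambda>p. Ac k (snd p) (fst p))
     \<and> smooth_periodic (\<lambda>p. c k (snd p))"
proof -
  let ?V = "UNIV \<times> W \<times> UNIV :: (real \<times> real \<times> real) set"
  have V: "open ?V" using W by (intro open_Times) auto
  have V0: "(al 0 s t, Ac 0 s t, t + s) \<in> ?V" for s t using W by (simp add: Ac0)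
  have base: "smooth_periodic (\<lambda>p. al 0 (snd p) (fst p))" "smooth_periodic (\<lambda>p. Ac 0 (snd p) (fst p))"
    unfolding al0 Ac0 by (intro smooth_periodic_mult smooth_periodic_const smooth_periodic_fst)+
  have star: "smooth_periodic (\<lambda>p. h (al 0 (snd p) (fst p), Ac 0 (snd p) (fst p), fst p + snd p))"
    if h: "smooth_on h ?V" "\<And>a A \<tau>. h (a, A, \<tau> + 2 * pi) = h (a, A, \<tau>)" for h
  proof (rule smooth_periodicI)
    show "smooth_on (\<lambda>p. h (al 0 (snd p) (fst p), Ac 0 (snd p) (fst p), fst p + snd p)) UNIV"
      by (rule smooth_on_compose3[OF h(1) smooth_periodicD(1)[OF base(1)] smooth_periodicD(1)[OF base(2)]])
        (use V0 in \<open>auto intro!: smooth_on_linear bounded_linear_intros\<close>)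
    show "h (al 0 (snd (t, s + 2 * pi)) (fst (t, s + 2 * pi)), Ac 0 (snd (t, s + 2 * pi)) (fst (t, s + 2 * pi)),
        fst (t, s + 2 * pi) + snd (t, s + 2 * pi)) =
      h (al 0 (snd (t, s)) (fst (t, s)), Ac 0 (snd (t, s)) (fst (t, s)), fst (t, s) + snd (t, s))" for t s
      using h(2)[of "\<omega>0 * t" A0 "t + s"] by (simp add: al0 Ac0 add.assoc)
  qed
  have main: "smooth_periodic (\<lambda>p. al k (snd p) (fst p)) \<and> smooth_periodic (\<lambda>p. Ac k (snd p) (fst p))
     \<and> (\<forall>j. Suc j \<le> k \<longrightarrow> smooth_periodic (\<lambda>p. c j (snd p)))" for k
  proof (induction k rule: less_induct)
    case (less k)
    show ?case
    proof (cases k)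
      case 0
      with base show ?thesis by simp
    next
      case (Suc m)
      have al: "smooth_periodic (\<lambda>p. al j (snd p) (fst p))" if "j < Suc m" for j
        using less.IH[of j] that Suc by simp
      have Ac: "smooth_periodic (\<lambda>p. Ac j (snd p) (fst p))" if "j < Suc m" for j
        using less.IH[of j] that Suc by simp
      have c: "smooth_periodic (\<lambda>p. c j (snd p))" if "j < m" for j
        using less.IH[of "Suc j"] that Suc by simp
      have sm\<omega>: "smooth_on (\<lambda>z. \<omega> (fst (snd z))) ?V"
        by (rule smooth_on_compose1[OF \<omega>(1)]) (auto intro!: smooth_on_linear bounded_linear_intros)
      let ?\<alpha> = "\<lambda>s t e. \<Sum>j\<le>Suc m. al j s t * e ^ j" and ?A = "\<lambda>s t e. \<Sum>j\<le>Suc m. Ac j s t * e ^ j"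
        and ?C = "\<lambda>s e. \<Sum>j\<le>Suc m. c j s * e ^ j"
      obtain bF where bF: "smooth_periodic bF"
        "\<And>t s D d. ((\<lambda>z. \<omega> (fst (snd z))) has_derivative D) (at (al 0 s t, Ac 0 s t, t + s)) \<Longrightarrow>
         (\<lambda>e. (\<Sum>j\<le>Suc m. d j * e ^ j) -
          (\<omega> (fst (snd (?\<alpha> s t e, ?A s t e, t + s)))
           + e * (F1 (?\<alpha> s t e, ?A s t e, t + s)
             - ?C s e
               * F2 (?\<alpha> s t e, ?A s t e, t + s))))
         \<in> O[at 0](\<lambda>e. e ^ (Suc m + 1)) \<Longrightarrow>
         d (Suc m) = bF (t, s) + D (al (Suc m) s t, Ac (Suc m) s t, 0)
           - c m s * F2 (al 0 s t, Ac 0 s t, t + s)"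
      proof (rule order_coefficient[where ?\<Theta>0.0 = "\<lambda>z. \<omega> (fst (snd z))" and ?\<Theta>1.0 = F1 and ?\<Theta>2.0 = F2
              and al = al and Ac = Ac and c = c and m = m, OF V sm\<omega> smooth(1,2) _ per(1,2) V0 al Ac c], goal_cases)
        case (5 b)
        show thesis by (rule 5(1)[of b, OF 5(2)], rule 5(3))
      qed simp_all
      obtain bG where bG: "smooth_periodic bG"
        "\<And>t s D d. ((\<lambda>z. 0) has_derivative D) (at (al 0 s t, Ac 0 s t, t + s)) \<Longrightarrow>
         (\<lambda>e. (\<Sum>j\<le>Suc m. d j * e ^ j) - (0
           + e * (G1 (?\<alpha> s t e, ?A s t e, t + s)
             - ?C s e
               * G2 (?\<alpha> s t e, ?A s t e, t + s))))
         \<in> O[at 0](\<lambda>e. e ^ (Suc m + 1)) \<Longrightarrow>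
         d (Suc m) = bG (t, s) + D (al (Suc m) s t, Ac (Suc m) s t, 0)
           - c m s * G2 (al 0 s t, Ac 0 s t, t + s)"
      proof (rule order_coefficient[where ?\<Theta>0.0 = "\<lambda>z. 0" and ?\<Theta>1.0 = G1 and ?\<Theta>2.0 = G2
              and al = al and Ac = Ac and c = c and m = m, OF V smooth_on_const smooth(3,4) _ per(3,4) V0 al Ac c], goal_cases)
        case (5 b)
        show thesis by (rule 5(1)[of b, OF 5(2)], rule 5(3))
      qed simp_all
      define F2s where "F2s p = F2 (al 0 (snd p) (fst p), Ac 0 (snd p) (fst p), fst p + snd p)" for p
      define G2s where "G2s p = G2 (al 0 (snd p) (fst p), Ac 0 (snd p) (fst p), fst p + snd p)" for p
      have F2s: "smooth_periodic F2s" unfolding F2s_def by (rule star[OF smooth(2) per(2)])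
      have G2s: "smooth_periodic G2s" unfolding G2s_def by (rule star[OF smooth(4) per(4)])
      have dAc': "dAc k s t = bG (t, s) - c m s * G2s (t, s)" for s t
      proof -
        have "((\<lambda>z::real \<times> real \<times> real. 0::real) has_derivative (\<lambda>w. 0)) (at (al 0 s t, Ac 0 s t, t + s))" by simp
        from bG(2)[OF this, of "\<lambda>j. dAc j s t", unfolded add_0, OF RA]
        show ?thesis by (simp add: Suc G2s_def)
      qed
      have dal': "dal k s t = bF (t, s) + \<omega>1 * Ac k s t - c m s * F2s (t, s)" for s t
      proof -
        have "((\<lambda>z. fst (snd z)) has_derivative (\<lambda>w. fst (snd w))) (at (al 0 s t, Ac 0 s t, t + s))"
          by (intro bounded_linear_imp_has_derivative bounded_linear_intros)
        moreover have "(\<omega> has_derivative (\<lambda>w. \<omega>1 * w)) (at (fst (snd (al 0 s t, Ac 0 s t, t + s))))"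
          using \<omega>(2) by (simp add: has_field_derivative_def Ac0)
        ultimately have "((\<lambda>z. \<omega> (fst (snd z))) has_derivative (\<lambda>w. \<omega>1 * fst (snd w))) (at (al 0 s t, Ac 0 s t, t + s))"
          by (rule has_derivative_compose)
        from bF(2)[OF this, of "\<lambda>j. dal j s t", unfolded fst_conv snd_conv, OF R\<alpha>]
        show ?thesis by (simp add: Suc F2s_def)
      qed
      have k: "k > 0" using Suc by simp
      note int = smooth_periodic_integrable
      have N: "integral {0..T} (\<lambda>t. G2s (t, s)) \<noteq> 0" for s
        using nondeg[of s] by (simp add: G2s_def al0 Ac0)
      \<comment> \<open>The average of the equation of the action determines \<open>c m\<close>.\<close>
      have "c m s = integral {0..T} (\<lambda>t. bG (t, s)) / integral {0..T} (\<lambda>t. G2s (t, s))" for s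
      proof -
        have "0 = integral {0..T} (dAc k s)"
          using integral_derivative_period[OF dAc AcT[OF k] T] by simp
        also have "\<dots> = integral {0..T} (\<lambda>t. bG (t, s) - c m s * G2s (t, s))"
          by (rule integral_cong) (rule dAc')
        also have "\<dots> = integral {0..T} (\<lambda>t. bG (t, s)) - c m s * integral {0..T} (\<lambda>t. G2s (t, s))"
          by (subst integral_diff) (auto intro!: int bG(1) G2s integrable_on_mult_right)
        finally show ?thesis using N[of s] by (simp add: field_simps)
      qed
      moreover have "smooth_periodic (\<lambda>p. integral {0..T} (\<lambda>t. bG (t, snd p)) / integral {0..T} (\<lambda>t. G2s (t, snd p)))"
        by (intro smooth_periodic_divide smooth_periodic_integral bG(1) G2s N)
      ultimately have cm: "smooth_periodic (\<lambda>p. c m (snd p))" by simp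
      define dG where "dG p = bG p - c m (snd p) * G2s p" for p
      have dG: "smooth_periodic dG" unfolding dG_def
        by (intro smooth_periodic_diff smooth_periodic_mult bG(1) G2s cm)
      define PG where "PG p = integral {0..1} (\<lambda>r. fst p * dG (r * fst p, snd p))" for p
      have PG: "smooth_periodic PG" unfolding PG_def by (rule smooth_periodic_primitive[OF dG])
      have Ack: "Ac k s t = Ac k s 0 + PG (t, s)" for s t
        using primitive_as_integral[OF dAc, of k s t] by (simp add: PG_def dG_def dAc')
      define dF where "dF p = bF p + \<omega>1 * PG p - c m (snd p) * F2s p" for p
      have dF: "smooth_periodic dF" unfolding dF_def
        by (intro smooth_periodic_diff smooth_periodic_add smooth_periodic_mult smooth_periodic_const bF(1) F2s cm PG)
      have dalk: "dal k s t = dF (t, s) + \<omega>1 * Ac k s 0" for s t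
        unfolding dal' Ack[of s t] dF_def by (simp add: algebra_simps)
      \<comment> \<open>The average of the equation of the angle determines the free constant of the action.\<close>
      have "Ac k s 0 = - integral {0..T} (\<lambda>t. dF (t, s)) / (T * \<omega>1)" for s
      proof -
        have "0 = integral {0..T} (dal k s)"
          using integral_derivative_period[OF dal alT[OF k] T] by simp
        also have "\<dots> = integral {0..T} (\<lambda>t. dF (t, s) + \<omega>1 * Ac k s 0)"
          by (rule integral_cong) (rule dalk)
        also have "\<dots> = integral {0..T} (\<lambda>t. dF (t, s)) + T * (\<omega>1 * Ac k s 0)"
          using T by (subst integral_add[OF int[OF dF] integrable_const_ivl]) simp
        finally show ?thesis using T \<omega>(3) by (simp add: field_simps)
      qed
      moreover have "smooth_periodic (\<lambda>p. (0 - integral {0..T} (\<lambda>t. dF (t, snd p))) / (T * \<omega>1))"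
        using T \<omega>(3) by (intro smooth_periodic_divide smooth_periodic_diff smooth_periodic_const smooth_periodic_integral dF) auto
      ultimately have Ack0: "smooth_periodic (\<lambda>p. Ac k (snd p) 0)" by simp
      have Acs: "smooth_periodic (\<lambda>p. Ac k (snd p) (fst p))"
        unfolding Ack[of "snd _" "fst _"] using smooth_periodic_add[OF Ack0 PG] by simp
      define d\<alpha> where "d\<alpha> p = dF p + \<omega>1 * Ac k (snd p) 0" for p
      have d\<alpha>: "smooth_periodic d\<alpha>" unfolding d\<alpha>_def
        by (intro smooth_periodic_add smooth_periodic_mult smooth_periodic_const dF Ack0)
      define P\<alpha> where "P\<alpha> p = integral {0..1} (\<lambda>r. fst p * d\<alpha> (r * fst p, snd p))" for p
      have P\<alpha>: "smooth_periodic P\<alpha>" unfolding P\<alpha>_def by (rule smooth_periodic_primitive[OF d\<alpha>])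
      have alk: "al k s t = al k s 0 + P\<alpha> (t, s)" for s t
        using primitive_as_integral[OF dal, of k s t] by (simp add: P\<alpha>_def d\<alpha>_def dalk)
      \<comment> \<open>The zero-mean condition determines the free constant of the angle.\<close>
      have "al k s 0 = - integral {0..T} (\<lambda>t. P\<alpha> (t, s)) / T" for s
      proof -
        have "0 = integral {0..T} (al k s)" using mean[OF k] by simp
        also have "\<dots> = integral {0..T} (\<lambda>t. al k s 0 + P\<alpha> (t, s))"
          by (rule integral_cong) (rule alk)
        also have "\<dots> = T * al k s 0 + integral {0..T} (\<lambda>t. P\<alpha> (t, s))"
          using T by (subst integral_add[OF integrable_const_ivl int[OF P\<alpha>]]) simp
        finally show ?thesis using T by (simp add: field_simps)
      qed
      moreover have "smooth_periodic (\<lambda>p. (0 - integral {0..T} (\<lambda>t. P\<alpha> (t, snd p))) / T)"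
        using T by (intro smooth_periodic_divide smooth_periodic_diff smooth_periodic_const smooth_periodic_integral P\<alpha>) auto
      ultimately have alk0: "smooth_periodic (\<lambda>p. al k (snd p) 0)" by simp
      have als: "smooth_periodic (\<lambda>p. al k (snd p) (fst p))"
        unfolding alk[of "snd _" "fst _"] using smooth_periodic_add[OF alk0 P\<alpha>] by simp
      have "smooth_periodic (\<lambda>p. c j (snd p))" if "Suc j \<le> k" for j
        using that Suc c cm by (cases "j = m") auto
      with als Acs show ?thesis by blast
    qed
  qed
  from main[of k] main[of "Suc k"] show ?thesis by blast
qed

section \<open>Action-angle coordinates\<close>

locale action_angle =
  fixes g \<omega> :: "real \<Rightarrow> real" and W :: "real set" and X Y :: "real \<Rightarrow> real \<Rightarrow> real"
  assumes coords: "action_angle_coords g W \<omega> X Y"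
begin

definition "X_ang a A = deriv (\<lambda>a. X a A) a"
definition "X_act a A = deriv (X a) A"
definition "Y_ang a A = deriv (\<lambda>a. Y a A) a"
definition "Y_act a A = deriv (Y a) A"
text \<open>
  The Jacobian determinant of \<open>(\<alpha>, A) \<mapsto> (x, y)\<close>.
\<close>

definition "jac a A = X_ang a A * Y_act a A - X_act a A * Y_ang a A"

lemma open_W: "open W" and \<omega>_smooth: "smooth_on \<omega> W"
  and X_analytic: "real_analytic2_on X (UNIV \<times> W)" and Y_analytic: "real_analytic2_on Y (UNIV \<times> W)"
  using coords real_analytic_on_imp_smooth_on unfolding action_angle_coords_def by blast+

lemma X_periodic: "A \<in> W \<Longrightarrow> X (a + 2 * pi) A = X a A"
  and Y_periodic: "A \<in> W \<Longrightarrow> Y (a + 2 * pi) A = Y a A"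
  using coords unfolding action_angle_coords_def by blast+

lemma periodic_multiple:
  assumes "A \<in> W"
  shows "X (a + 2 * pi * real n) A = X a A \<and> Y (a + 2 * pi * real n) A = Y a A"
proof (induction n)
  case (Suc n)
  have "a + 2 * pi * real (Suc n) = (a + 2 * pi * real n) + 2 * pi" by (simp add: algebra_simps)
  then show ?case using Suc X_periodic[OF assms] Y_periodic[OF assms] by metis
qed simp

lemma smooth_coords:
  "smooth_on (\<lambda>(a, A). X a A) (UNIV \<times> W)" "smooth_on (\<lambda>(a, A). Y a A) (UNIV \<times> W)"
  "smooth_on (\<lambda>(a, A). X_ang a A) (UNIV \<times> W)" "smooth_on (\<lambda>(a, A). X_act a A) (UNIV \<times> W)"
  "smooth_on (\<lambda>(a, A). Y_ang a A) (UNIV \<times> W)" "smooth_on (\<lambda>(a, A). Y_act a A) (UNIV \<times> W)"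
  unfolding X_ang_def X_act_def Y_ang_def Y_act_def
  by (intro real_analytic2_on_imp_smooth_on real_analytic2_on_partial1 real_analytic2_on_partial2
      X_analytic Y_analytic)+

lemma smooth_jac: "smooth_on (\<lambda>(a, A). jac a A) (UNIV \<times> W)"
  using smooth_coords(3-6) unfolding jac_def case_prod_unfold
  by (intro smooth_on_diff smooth_on_mult)

lemma has_derivative_X:
  "A \<in> W \<Longrightarrow> ((\<lambda>(a, A). X a A) has_derivative (\<lambda>(u, v). X_ang a A * u + X_act a A * v)) (at (a, A))"
  and has_derivative_Y:
  "A \<in> W \<Longrightarrow> ((\<lambda>(a, A). Y a A) has_derivative (\<lambda>(u, v). Y_ang a A * u + Y_act a A * v)) (at (a, A))"
  unfolding X_ang_def X_act_def Y_ang_def Y_act_def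
  by (rule real_analytic2_on_has_derivative[OF X_analytic] real_analytic2_on_has_derivative[OF Y_analytic], simp)+

text \<open>
  The coordinate map sends the linear flow \<open>\<alpha>' = \<omega> A\<close>, \<open>A' = 0\<close> to the unperturbed equation.
\<close>

lemma flow:
  assumes "A \<in> W"
  shows "X_ang a A * \<omega> A = Y a A" "Y_ang a A * \<omega> A = - g (X a A)"
proof -
  have line: "((\<lambda>s. (a + \<omega> A * s, A)) has_derivative (\<lambda>h. (\<omega> A * h, 0))) (at 0)"
    by (auto intro!: derivative_eq_intros)
  have "((\<lambda>s. X (a + \<omega> A * s) A) has_derivative (\<lambda>h. X_ang a A * (\<omega> A * h))) (at 0)"
    using has_derivative_compose[OF line, of "\<lambda>(a, A). X a A" "\<lambda>(u, v). X_ang a A * u + X_act a A * v"]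
      has_derivative_X[OF assms, of a] by simp
  then have "((\<lambda>s. X (a + \<omega> A * s) A) has_real_derivative X_ang a A * \<omega> A) (at 0)"
    unfolding has_field_derivative_def by (rule has_derivative_eq_rhs) (auto simp: fun_eq_iff)
  moreover have "((\<lambda>s. X (a + \<omega> A * s) A) has_real_derivative Y (a + \<omega> A * 0) A) (at 0)"
    using coords assms unfolding action_angle_coords_def by blast
  ultimately show "X_ang a A * \<omega> A = Y a A" using DERIV_unique by fastforce
  have "((\<lambda>s. Y (a + \<omega> A * s) A) has_derivative (\<lambda>h. Y_ang a A * (\<omega> A * h))) (at 0)"
    using has_derivative_compose[OF line, of "\<lambda>(a, A). Y a A" "\<lambda>(u, v). Y_ang a A * u + Y_act a A * v"]
      has_derivative_Y[OF assms, of a] by simp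
  then have "((\<lambda>s. Y (a + \<omega> A * s) A) has_real_derivative Y_ang a A * \<omega> A) (at 0)"
    unfolding has_field_derivative_def by (rule has_derivative_eq_rhs) (auto simp: fun_eq_iff)
  moreover have "((\<lambda>s. Y (a + \<omega> A * s) A) has_real_derivative - g (X (a + \<omega> A * 0) A)) (at 0)"
    using coords assms unfolding action_angle_coords_def by blast
  ultimately show "Y_ang a A * \<omega> A = - g (X a A)" using DERIV_unique by fastforce
qed

text \<open>
  The derivative of a branch of the inverse is the inverse of the Jacobian matrix; its second column gives
  \<open>\<partial>\<alpha>/\<partial>y\<close> and \<open>\<partial>A/\<partial>y\<close>, whatever the branch.
\<close>

lemma inverse_branch_partials:
  assumes "A \<in> W" and branch: "inverse_branch W X Y a A ang act"
  shows "jac a A \<noteq> 0" "deriv (ang (X a A)) (Y a A) = - X_act a A / jac a A"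
    "deriv (act (X a A)) (Y a A) = X_ang a A / jac a A"
proof -
  define x y where "x = X a A" and "y = Y a A"
  from branch obtain U where U: "open U" "(x, y) \<in> U" "real_analytic2_on ang U" "real_analytic2_on act U"
    and inv: "\<And>p. p \<in> U \<Longrightarrow> X (ang (fst p) (snd p)) (act (fst p) (snd p)) = fst p"
      "\<And>p. p \<in> U \<Longrightarrow> Y (ang (fst p) (snd p)) (act (fst p) (snd p)) = snd p"
    and val: "ang x y = a" "act x y = A"
    unfolding inverse_branch_def x_def y_def case_prod_unfold by blast
  define p1 p2 q1 q2 where "p1 = deriv (\<lambda>x. ang x y) x" and "p2 = deriv (ang x) y"
    and "q1 = deriv (\<lambda>x. act x y) x" and "q2 = deriv (act x) y"
  have "((\<lambda>p. (ang (fst p) (snd p), act (fst p) (snd p))) has_derivative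
      (\<lambda>h. (p1 * fst h + p2 * snd h, q1 * fst h + q2 * snd h))) (at (x, y))"
    using real_analytic2_on_has_derivative[OF U(3,2)] real_analytic2_on_has_derivative[OF U(4,2)]
    unfolding p1_def p2_def q1_def q2_def case_prod_unfold by (rule has_derivative_Pair)
  note comp = has_derivative_compose[OF this, unfolded fst_conv snd_conv val]
  have "((\<lambda>p. X (ang (fst p) (snd p)) (act (fst p) (snd p))) has_derivative
     (\<lambda>h. X_ang a A * (p1 * fst h + p2 * snd h) + X_act a A * (q1 * fst h + q2 * snd h))) (at (x, y))"
    using comp[OF has_derivative_X[OF assms(1)]] by simp
  from has_derivative_transform_within_open[OF this U(1,2) inv(1)]
  have "(fst has_derivative
     (\<lambda>h. X_ang a A * (p1 * fst h + p2 * snd h) + X_act a A * (q1 * fst h + q2 * snd h))) (at (x, y))" by simp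
  from has_derivative_unique[OF this bounded_linear_imp_has_derivative[OF bounded_linear_fst]]
  have eqX: "X_ang a A * (p1 * u + p2 * v) + X_act a A * (q1 * u + q2 * v) = u" for u v
    by (auto dest: fun_cong[of _ _ "(u, v)"])
  have "((\<lambda>p. Y (ang (fst p) (snd p)) (act (fst p) (snd p))) has_derivative
     (\<lambda>h. Y_ang a A * (p1 * fst h + p2 * snd h) + Y_act a A * (q1 * fst h + q2 * snd h))) (at (x, y))"
    using comp[OF has_derivative_Y[OF assms(1)]] by simp
  from has_derivative_transform_within_open[OF this U(1,2) inv(2)]
  have "(snd has_derivative
     (\<lambda>h. Y_ang a A * (p1 * fst h + p2 * snd h) + Y_act a A * (q1 * fst h + q2 * snd h))) (at (x, y))" by simp
  from has_derivative_unique[OF this bounded_linear_imp_has_derivative[OF bounded_linear_snd]]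
  have eqY: "Y_ang a A * (p1 * u + p2 * v) + Y_act a A * (q1 * u + q2 * v) = v" for u v
    by (auto dest: fun_cong[of _ _ "(u, v)"])
  have e: "X_ang a A * p1 + X_act a A * q1 = 1" "X_ang a A * p2 + X_act a A * q2 = 0"
    "Y_ang a A * p1 + Y_act a A * q1 = 0" "Y_ang a A * p2 + Y_act a A * q2 = 1"
    using eqX[of 1 0] eqX[of 0 1] eqY[of 1 0] eqY[of 0 1] by simp_all
  have "jac a A * (p1 * q2 - p2 * q1) = (X_ang a A * p1 + X_act a A * q1) * (Y_ang a A * p2 + Y_act a A * q2)
     - (X_ang a A * p2 + X_act a A * q2) * (Y_ang a A * p1 + Y_act a A * q1)"
    unfolding jac_def by algebra
  then show nz: "jac a A \<noteq> 0" unfolding e by auto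
  have "jac a A * p2 = Y_act a A * (X_ang a A * p2 + X_act a A * q2) - X_act a A * (Y_ang a A * p2 + Y_act a A * q2)"
    unfolding jac_def by algebra
  then show "deriv (ang (X a A)) (Y a A) = - X_act a A / jac a A"
    using nz unfolding e by (simp add: p2_def x_def y_def field_simps)
  have "jac a A * q2 = X_ang a A * (Y_ang a A * p2 + Y_act a A * q2) - Y_ang a A * (X_ang a A * p2 + X_act a A * q2)"
    unfolding jac_def by algebra
  then show "deriv (act (X a A)) (Y a A) = X_ang a A / jac a A"
    using nz unfolding e by (simp add: q2_def x_def y_def field_simps)
qed

lemma inverse_branch_exists: "A \<in> W \<Longrightarrow> \<exists>ang act. inverse_branch W X Y a A ang act"
  using coords unfolding action_angle_coords_def by blast

lemma jac_nonzero: "A \<in> W \<Longrightarrow> jac a A \<noteq> 0"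
  using inverse_branch_exists inverse_branch_partials(1) by blast

lemma dangle_dy_eq: "A \<in> W \<Longrightarrow> dangle_dy W X Y a A = - X_act a A / jac a A"
  unfolding dangle_dy_def using inverse_branch_exists[of A a] inverse_branch_partials(2)[of A a]
  by (intro the_equality) metis+

lemma daction_dy_eq: "A \<in> W \<Longrightarrow> daction_dy W X Y a A = X_ang a A / jac a A"
  unfolding daction_dy_def using inverse_branch_exists[of A a] inverse_branch_partials(3)[of A a]
  by (intro the_equality) metis+

text \<open>
  If the velocity vanished on an interval, so would its derivative, and \<open>flow\<close> would make the
  Jacobian singular.
\<close>

lemma velocity_not_identically_zero:
  assumes "A \<in> W" "\<omega> A > 0" "T > 0"
  shows "\<exists>t\<in>{0..T}. Y (\<omega> A * t) A \<noteq> 0"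
proof (rule ccontr)
  assume "\<not> ?thesis"
  then have zero: "Y (\<omega> A * t) A = 0" if "t \<in> {0<..<T}" for t using that by auto
  have mid: "T / 2 \<in> {0<..<T}" using assms by simp
  have "((\<lambda>s. Y (0 + \<omega> A * s) A) has_real_derivative - g (X (0 + \<omega> A * (T / 2)) A)) (at (T / 2))"
    using coords assms(1) unfolding action_angle_coords_def by blast
  then have "((\<lambda>s. 0) has_real_derivative - g (X (0 + \<omega> A * (T / 2)) A)) (at (T / 2))"
    by (rule has_field_derivative_transform_within_open[where S = "{0<..<T}"]) (use mid zero in auto)
  then have "g (X (\<omega> A * (T / 2)) A) = 0" using DERIV_unique[OF DERIV_const] by fastforce
  then have "Y_ang (\<omega> A * (T / 2)) A = 0" "X_ang (\<omega> A * (T / 2)) A = 0"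
    using flow[OF assms(1), of "\<omega> A * (T / 2)"] zero[OF mid] assms(2) by auto
  then show False using jac_nonzero[OF assms(1), of "\<omega> A * (T / 2)"] by (simp add: jac_def)
qed

lemma continuous_along_orbit:
  assumes "A \<in> W" "smooth_on (\<lambda>(a, A). h a A) (UNIV \<times> W)"
  shows "continuous_on S (\<lambda>t. h (\<omega> A * t) A)"
proof -
  have "continuous_on S (\<lambda>t. (\<lambda>(a, A). h a A) (\<omega> A * t, A))"
    by (rule continuous_on_compose2[OF smooth_on_imp_continuous_on[OF assms(2)]])
      (use assms(1) in \<open>auto intro!: continuous_intros\<close>)
  then show ?thesis by simp
qed

lemma integral_velocity_squared_pos:
  assumes "A \<in> W" "\<omega> A > 0" "T > 0"
  shows "integral {0..T} (\<lambda>t. (Y (\<omega> A * t) A)\<^sup>2) > 0"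
proof -
  let ?h = "\<lambda>t. (Y (\<omega> A * t) A)\<^sup>2"
  have cont: "continuous_on {0..T} ?h"
    by (intro continuous_intros continuous_along_orbit smooth_coords assms(1))
  have "integral {0..T} ?h \<noteq> 0"
    using integral_eq_0_iff[OF cont assms(3)] velocity_not_identically_zero[OF assms] by auto
  moreover have "integral {0..T} ?h \<ge> 0"
    by (intro integral_nonneg integrable_continuous_real cont) auto
  ultimately show ?thesis by linarith
qed

text \<open>
  Since \<open>\<omega> \<partial>X/\<partial>\<alpha> = Y\<close>, the integrand is \<open>Y\<^sup>2 / (\<omega> jac)\<close>, and the nonvanishing continuous function \<open>jac\<close>
  has a constant sign along the orbit.
\<close>

lemma integral_dissipation_nonzero:
  assumes "A \<in> W" "\<omega> A > 0" "T > 0"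
  shows "integral {0..T} (\<lambda>t. X_ang (\<omega> A * t) A / jac (\<omega> A * t) A * Y (\<omega> A * t) A) \<noteq> 0"
proof -
  let ?j = "\<lambda>t. jac (\<omega> A * t) A"
  have contj: "continuous_on S ?j" for S by (intro continuous_along_orbit smooth_jac assms(1))
  have nz: "?j t \<noteq> 0" for t by (rule jac_nonzero[OF assms(1)])
  have sign: "0 < ?j t * ?j 0" for t
  proof (rule ccontr)
    assume "\<not> ?thesis"
    moreover have "?j t * ?j 0 \<noteq> 0" using nz[of t] nz[of 0] by simp
    ultimately have neg: "?j t * ?j 0 < 0" by linarith
    have conn: "connected (range ?j)" by (intro connected_continuous_image contj connected_UNIV)
    have mem: "?j t \<in> range ?j" "?j 0 \<in> range ?j" by (rule rangeI)+
    from neg consider "0 < ?j t" "?j 0 < 0" | "?j t < 0" "0 < ?j 0" by (auto simp: mult_less_0_iff)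
    then have "0 \<in> range ?j"
    proof cases
      case 1
      then show ?thesis using connectedD_interval[OF conn mem(2,1), of 0] by simp
    next
      case 2
      then show ?thesis using connectedD_interval[OF conn mem, of 0] by simp
    qed
    then show False using nz by auto
  qed
  let ?h = "\<lambda>t. (Y (\<omega> A * t) A)\<^sup>2 / (\<omega> A * (?j t * ?j 0))"
  have cont: "continuous_on {0..T} ?h"
  proof (intro continuous_on_divide continuous_on_mult continuous_on_power continuous_on_const contj)
    show "continuous_on {0..T} (\<lambda>t. Y (\<omega> A * t) A)"
      by (rule continuous_along_orbit[OF assms(1) smooth_coords(2)])
    show "\<forall>t\<in>{0..T}. \<omega> A * (?j t * ?j 0) \<noteq> 0" using nz nz[of 0] assms(2) by simp
  qed
  have nonneg: "?h t \<ge> 0" for t 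
    by (rule divide_nonneg_pos[OF zero_le_power2 mult_pos_pos[OF assms(2) sign]])
  have int: "integral {0..T} ?h \<noteq> 0"
  proof
    assume "integral {0..T} ?h = 0"
    with integral_eq_0_iff[OF cont assms(3) nonneg] have z: "\<forall>t\<in>{0..T}. ?h t = 0" by (rule iffD1)
    obtain t where t: "t \<in> {0..T}" "Y (\<omega> A * t) A \<noteq> 0"
      using velocity_not_identically_zero[OF assms] by (rule bexE)
    have "\<omega> A * (?j t * ?j 0) \<noteq> 0" using nz[of t] nz[of 0] assms(2) by simp
    with bspec[OF z t(1)] t(2) show False by simp
  qed
  have eq: "X_ang (\<omega> A * t) A / ?j t * Y (\<omega> A * t) A = ?j 0 * ?h t" for t
  proof -
    have "X_ang (\<omega> A * t) A = Y (\<omega> A * t) A / \<omega> A"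
      using flow(1)[OF assms(1), of "\<omega> A * t"] assms(2) by (simp add: field_simps)
    then show ?thesis using nz[of t] nz[of 0] assms(2) by (simp add: power2_eq_square)
  qed
  show ?thesis unfolding eq integral_mult_right using int nz[of 0] by simp
qed

end

section \<open>Area of a doubly periodic family of curves\<close>

text \<open>
  The potential \<open>V x \<tau> = \<integral>\<^sub>0\<^sup>x f(\<xi>, \<tau>) d\<xi>\<close> of the force, with the integral rescaled to \<open>[0, 1]\<close>; it has
  every period in \<open>\<tau>\<close> that \<open>f\<close> has.
\<close>

lemma smooth_on_potential:
  fixes f :: "real \<Rightarrow> real \<Rightarrow> real"
  assumes f: "smooth_on (\<lambda>(x, \<tau>). f x \<tau>) UNIV"
  obtains V V\<tau> where "\<And>x \<tau>. ((\<lambda>(x, \<tau>). V x \<tau>) has_derivative (\<lambda>(u, v). f x \<tau> * u + V\<tau> x \<tau> * v)) (at (x, \<tau>))"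
    "continuous_on UNIV (\<lambda>(x, \<tau>). V\<tau> x \<tau>)" 
    "\<And>P x \<tau>. (\<And>x \<tau>. f x (\<tau> + P) = f x \<tau>) \<Longrightarrow> V x (\<tau> + P) = V x \<tau>"
proof -
  define V where "V x \<tau> = integral {0..1} (\<lambda>r. x * f (r * x) \<tau>)" for x \<tau>
  have "smooth_on (\<lambda>z. fst (snd z) * (\<lambda>(x, \<tau>). f x \<tau>) (fst z * fst (snd z), snd (snd z)))
      (UNIV :: (real \<times> real \<times> real) set)"
    by (intro smooth_on_mult smooth_on_compose2[OF f] smooth_on_linear bounded_linear_intros) auto
  from smooth_on_integral[OF this, of 0 1] have smV: "smooth_on (\<lambda>(x, \<tau>). V x \<tau>) UNIV"
    by (simp add: V_def case_prod_unfold)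
  from smooth_on_has_derivativeE[OF smV open_UNIV] obtain D where
    D: "\<And>p. ((\<lambda>(x, \<tau>). V x \<tau>) has_derivative D p) (at p)" "\<And>v. smooth_on (\<lambda>p. D p v) UNIV"
    by auto
  have Vx: "((\<lambda>x. V x \<tau>) has_real_derivative f x \<tau>) (at x)" for x \<tau>
  proof -
    have "continuous_on UNIV (\<lambda>x. (\<lambda>(x, \<tau>). f x \<tau>) (x, \<tau>))"
      by (rule continuous_on_compose2[OF smooth_on_imp_continuous_on[OF f]]) (auto intro!: continuous_intros)
    then have "continuous_on UNIV (\<lambda>x. f x \<tau>)" by simp
    from antiderivative_real[OF this] obtain F where F: "\<And>x. (F has_real_derivative f x \<tau>) (at x)" by blast
    have "V x \<tau> = F x - F 0" for x
      using primitive_as_integral[OF F, of x] by (simp add: V_def)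
    then show ?thesis using F by (auto intro!: derivative_eq_intros)
  qed
  have D1: "D (x, \<tau>) (1, 0) = f x \<tau>" for x \<tau>
  proof -
    have "((\<lambda>x. (x, \<tau>)) has_derivative (\<lambda>h. (h, 0))) (at x)" by (auto intro!: derivative_eq_intros)
    from has_derivative_compose[OF this D(1)]
    have "((\<lambda>x. V x \<tau>) has_derivative (\<lambda>h. D (x, \<tau>) (h, 0))) (at x)" by simp
    from has_derivative_unique[OF this Vx[unfolded has_field_derivative_def]]
    show ?thesis by (auto dest: fun_cong[of _ _ 1])
  qed
  show thesis
  proof (rule that[of V "\<lambda>x \<tau>. D (x, \<tau>) (0, 1)"])
    fix x \<tau>
    have lin: "linear (D (x, \<tau>))" by (rule has_derivative_linear[OF D(1)])
    have "D (x, \<tau>) (u, v) = f x \<tau> * u + D (x, \<tau>) (0, 1) * v" for u v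
    proof -
      have "(u, v) = u *\<^sub>R (1, 0) + v *\<^sub>R (0, 1)" by simp
      then have "D (x, \<tau>) (u, v) = u *\<^sub>R D (x, \<tau>) (1, 0) + v *\<^sub>R D (x, \<tau>) (0, 1)"
        by (simp only: linear_add[OF lin] linear_scale[OF lin])
      then show ?thesis by (simp add: D1 mult.commute)
    qed
    then have "D (x, \<tau>) = (\<lambda>(u, v). f x \<tau> * u + D (x, \<tau>) (0, 1) * v)" by (intro ext) (metis (no_types, lifting) case_prod_conv surj_pair)
    with D(1)[of "(x, \<tau>)"]
    show "((\<lambda>(x, \<tau>). V x \<tau>) has_derivative (\<lambda>(u, v). f x \<tau> * u + D (x, \<tau>) (0, 1) * v)) (at (x, \<tau>))"
      by (rule has_derivative_eq_rhs)
    show "continuous_on UNIV (\<lambda>(x, \<tau>). D (x, \<tau>) (0, 1))"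
      using smooth_on_imp_continuous_on[OF D(2)[of "(0, 1)"]] by (simp add: case_prod_unfold)
  next
    fix P x \<tau> assume "\<And>x \<tau>. f x (\<tau> + P) = f x \<tau>"
    then show "V x (\<tau> + P) = V x \<tau>" by (simp add: V_def)
  qed
qed

text \<open>
  Green's formula on a rectangle whose opposite sides contribute equally.
\<close>

lemma periodic_rectangle_integral:
  fixes L M Ls Mt :: "real \<Rightarrow> real \<Rightarrow> real"
  assumes "T > 0" "S > 0"
    and Ls: "\<And>t s. t \<in> {0..T} \<Longrightarrow> s \<in> {0..S} \<Longrightarrow> ((\<lambda>s. L t s) has_real_derivative Ls t s) (at s)"
    and Mt: "\<And>t s. t \<in> {0..T} \<Longrightarrow> s \<in> {0..S} \<Longrightarrow> ((\<lambda>t. M t s) has_real_derivative Mt t s) (at t)"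
    and L: "\<And>t. t \<in> {0..T} \<Longrightarrow> L t S = L t 0" and M: "\<And>s. s \<in> {0..S} \<Longrightarrow> M T s = M 0 s"
    and cont: "continuous_on ({0..T} \<times> {0..S}) (\<lambda>(t, s). Ls t s)" "continuous_on ({0..T} \<times> {0..S}) (\<lambda>(t, s). Mt t s)"
  shows "integral (cbox (0, 0) (T, S)) (\<lambda>(t, s). Ls t s - Mt t s) = 0"
proof -
  have "(Ls t has_integral L t S - L t 0) {0..S}" if "t \<in> {0..T}" for t
    using assms(2) Ls[OF that] by (intro fundamental_theorem_of_calculus)
      (auto simp: has_real_derivative_iff_has_vector_derivative[symmetric] intro: has_field_derivative_at_within)
  then have IL: "integral {0..S} (Ls t) = 0" if "t \<in> {0..T}" for t
    using that L by (simp add: integral_unique)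
  have "((\<lambda>t. Mt t s) has_integral M T s - M 0 s) {0..T}" if "s \<in> {0..S}" for s
    using assms(1) Mt[OF _ that] by (intro fundamental_theorem_of_calculus)
      (auto simp: has_real_derivative_iff_has_vector_derivative[symmetric] intro: has_field_derivative_at_within)
  then have IM: "((\<lambda>t. Mt t s) has_integral 0) {0..T}" if "s \<in> {0..S}" for s
    using that M[OF that] by fastforce
  have cbox: "cbox (0, 0) (T, S) = {0..T} \<times> {0..S}" by (simp add: cbox_Pair_eq)
  have "integral (cbox (0, 0) (T, S)) (\<lambda>(t, s). Ls t s) = integral {0..T} (\<lambda>t. integral {0..S} (Ls t))"
    using integral_prod_continuous[of 0 0 T S "\<lambda>(t, s). Ls t s"] cont(1) by (simp add: cbox)
  also have "\<dots> = integral {0..T} (\<lambda>t. 0)" by (intro integral_cong IL)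
  finally have 1: "integral (cbox (0, 0) (T, S)) (\<lambda>(t, s). Ls t s) = 0" by simp
  have "integral (cbox (0, 0) (T, S)) (\<lambda>(t, s). Mt t s) = integral {0..T} (\<lambda>t. integral {0..S} (Mt t))"
    using integral_prod_continuous[of 0 0 T S "\<lambda>(t, s). Mt t s"] cont(2) by (simp add: cbox)
  also have "\<dots> = integral {0..S} (\<lambda>s. integral {0..T} (\<lambda>t. Mt t s))"
    using integral_swap_continuous[of 0 0 T S Mt] cont(2) by (simp add: cbox)
  also have "\<dots> = integral {0..S} (\<lambda>s. 0)"
    using IM by (intro integral_cong) (simp add: integral_unique)
  finally have 2: "integral (cbox (0, 0) (T, S)) (\<lambda>(t, s). Mt t s) = 0" by simp
  have "integral (cbox (0, 0) (T, S)) (\<lambda>p. (case p of (t, s) \<Rightarrow> Ls t s) - (case p of (t, s) \<Rightarrow> Mt t s))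
      = integral (cbox (0, 0) (T, S)) (\<lambda>(t, s). Ls t s) - integral (cbox (0, 0) (T, S)) (\<lambda>(t, s). Mt t s)"
    using cont by (intro integral_diff integrable_continuous) (simp_all only: cbox)
  with 1 2 show ?thesis by (simp add: case_prod_unfold)
qed

text \<open>
  The integrand is \<open>\<partial>L/\<partial>s - \<partial>M/\<partial>t\<close> for the Lagrangian \<open>L = y x\<^sub>t - y\<^sup>2/2 - G(x) + e V(x, t + s)\<close> and
  \<open>M = y x\<^sub>s + e V(x, t + s) - (y\<^sup>2/2 + G(x))\<close>, both doubly periodic. Here \<open>G\<close> and \<open>V\<close> are the potentials
  of \<open>g\<close> and \<open>f\<close>. In the difference the mixed derivatives \<open>y x\<^sub>t\<^sub>s\<close> and the explicit time derivatives of
  \<open>V\<close> cancel, leaving the area density \<open>y\<^sub>s x\<^sub>t - y\<^sub>t x\<^sub>s\<close> and the contributions of energy and force. If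
  \<open>x\<^sub>t = y\<close> and \<open>y\<^sub>t = - g + e f - \<kappa> y\<close> hold, the integrand equals \<open>\<kappa> y (x\<^sub>s - y)\<close>.
\<close>

lemma torus_area_identity:
  fixes x y :: "real \<times> real \<Rightarrow> real" and g :: "real \<Rightarrow> real" and f :: "real \<Rightarrow> real \<Rightarrow> real"
  assumes TS: "T > 0" "S > 0" and U: "open U" "{0..T} \<times> {0..S} \<subseteq> U"
    and sm: "smooth_on x U" "smooth_on y U"
    and Dx: "\<And>p. p \<in> U \<Longrightarrow> (x has_derivative Dx p) (at p)" "\<And>v. smooth_on (\<lambda>p. Dx p v) U"
    and Dy: "\<And>p. p \<in> U \<Longrightarrow> (y has_derivative Dy p) (at p)" "\<And>v. smooth_on (\<lambda>p. Dy p v) U"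
    and perT: "\<And>t s. (t, s) \<in> U \<Longrightarrow> x (t + T, s) = x (t, s) \<and> y (t + T, s) = y (t, s)"
    and perS: "\<And>t s. (t, s) \<in> U \<Longrightarrow> x (t, s + S) = x (t, s) \<and> y (t, s + S) = y (t, s)"
    and g: "continuous_on UNIV g" and f: "smooth_on (\<lambda>(x, \<tau>). f x \<tau>) UNIV" "\<And>x \<tau>. f x (\<tau> + S) = f x \<tau>"
      "\<And>x \<tau>. f x (\<tau> + T) = f x \<tau>"
  shows "integral (cbox (0, 0) (T, S)) (\<lambda>(t, s).
      Dy (t, s) (0, 1) * Dx (t, s) (1, 0) - y (t, s) * Dy (t, s) (0, 1) - g (x (t, s)) * Dx (t, s) (0, 1)
      + e * f (x (t, s)) (t + s) * Dx (t, s) (0, 1) - Dy (t, s) (1, 0) * Dx (t, s) (0, 1)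
      - e * f (x (t, s)) (t + s) * Dx (t, s) (1, 0) + y (t, s) * Dy (t, s) (1, 0)
      + g (x (t, s)) * Dx (t, s) (1, 0)) = 0"
proof -
  from antiderivative_real[OF g] obtain Gp where Gp: "\<And>x. (Gp has_real_derivative g x) (at x)" by blast
  obtain V V\<tau> where V: "\<And>x \<tau>. ((\<lambda>(x, \<tau>). V x \<tau>) has_derivative (\<lambda>(u, v). f x \<tau> * u + V\<tau> x \<tau> * v)) (at (x, \<tau>))"
    "continuous_on UNIV (\<lambda>(x, \<tau>). V\<tau> x \<tau>)" "\<And>P x \<tau>. (\<And>x \<tau>. f x (\<tau> + P) = f x \<tau>) \<Longrightarrow> V x (\<tau> + P) = V x \<tau>"
    using smooth_on_potential[OF f(1)] by metis
  from smooth_on_has_derivativeE[OF Dx(2)[of "(1, 0)"] U(1)] obtain D1 where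
    D1: "\<And>p. p \<in> U \<Longrightarrow> ((\<lambda>p. Dx p (1, 0)) has_derivative D1 p) (at p)" "\<And>v. smooth_on (\<lambda>p. D1 p v) U"
    by blast
  from smooth_on_has_derivativeE[OF Dx(2)[of "(0, 1)"] U(1)] obtain D2 where
    D2: "\<And>p. p \<in> U \<Longrightarrow> ((\<lambda>p. Dx p (0, 1)) has_derivative D2 p) (at p)" "\<And>v. smooth_on (\<lambda>p. D2 p v) U"
    by blast
  have sym: "D1 p (0, 1) = D2 p (1, 0)" if "p \<in> U" for p
    by (rule second_derivative_symmetric[OF U(1) that Dx(1) D1(1) smooth_on_imp_continuous_on[OF D1(2)]
          D2(1) smooth_on_imp_continuous_on[OF D2(2)]])
  have mem: "(t, s) \<in> U" if "t \<in> {0..T}" "s \<in> {0..S}" for t s using U(2) that by blast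
  note px = partial_derivatives[OF Dx(1)] and py = partial_derivatives[OF Dy(1)]
    and p1 = partial_derivatives[OF D1(1)] and p2 = partial_derivatives[OF D2(1)]
  have Vt: "((\<lambda>t. V (x (t, s)) (t + s)) has_real_derivative
      f (x (t, s)) (t + s) * Dx (t, s) (1, 0) + V\<tau> (x (t, s)) (t + s)) (at t)"
    and Vs: "((\<lambda>s. V (x (t, s)) (t + s)) has_real_derivative
      f (x (t, s)) (t + s) * Dx (t, s) (0, 1) + V\<tau> (x (t, s)) (t + s)) (at s)" if "(t, s) \<in> U" for t s
  proof -
    have "((\<lambda>t. (x (t, s), t + s)) has_derivative (\<lambda>h. (Dx (t, s) (1, 0) * h, h))) (at t)"
      using px(1)[OF that] unfolding has_field_derivative_def
      by (intro has_derivative_Pair) (auto intro!: derivative_eq_intros)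
    from has_derivative_compose[OF this V(1)]
    have "((\<lambda>t. V (x (t, s)) (t + s)) has_derivative
        (\<lambda>h. f (x (t, s)) (t + s) * (Dx (t, s) (1, 0) * h) + V\<tau> (x (t, s)) (t + s) * h)) (at t)" by simp
    then show "((\<lambda>t. V (x (t, s)) (t + s)) has_real_derivative
      f (x (t, s)) (t + s) * Dx (t, s) (1, 0) + V\<tau> (x (t, s)) (t + s)) (at t)"
      unfolding has_field_derivative_def by (rule has_derivative_eq_rhs) (auto simp: fun_eq_iff algebra_simps)
    have "((\<lambda>s. (x (t, s), t + s)) has_derivative (\<lambda>h. (Dx (t, s) (0, 1) * h, h))) (at s)"
      using px(2)[OF that] unfolding has_field_derivative_def
      by (intro has_derivative_Pair) (auto intro!: derivative_eq_intros)
    from has_derivative_compose[OF this V(1)]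
    have "((\<lambda>s. V (x (t, s)) (t + s)) has_derivative
        (\<lambda>h. f (x (t, s)) (t + s) * (Dx (t, s) (0, 1) * h) + V\<tau> (x (t, s)) (t + s) * h)) (at s)" by simp
    then show "((\<lambda>s. V (x (t, s)) (t + s)) has_real_derivative
      f (x (t, s)) (t + s) * Dx (t, s) (0, 1) + V\<tau> (x (t, s)) (t + s)) (at s)"
      unfolding has_field_derivative_def by (rule has_derivative_eq_rhs) (auto simp: fun_eq_iff algebra_simps)
  qed
  define L where "L t s = y (t, s) * Dx (t, s) (1, 0) - (y (t, s))\<^sup>2 / 2 - Gp (x (t, s)) + e * V (x (t, s)) (t + s)" for t s
  define Ls where "Ls t s = (Dy (t, s) (0, 1) * Dx (t, s) (1, 0) + y (t, s) * D2 (t, s) (1, 0)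
      - y (t, s) * Dy (t, s) (0, 1) - g (x (t, s)) * Dx (t, s) (0, 1)
      + e * (f (x (t, s)) (t + s) * Dx (t, s) (0, 1) + V\<tau> (x (t, s)) (t + s)))" for t s
  define M where "M t s = y (t, s) * Dx (t, s) (0, 1) + e * V (x (t, s)) (t + s) - ((y (t, s))\<^sup>2 / 2 + Gp (x (t, s)))" for t s
  define Mt where "Mt t s = (Dy (t, s) (1, 0) * Dx (t, s) (0, 1) + y (t, s) * D2 (t, s) (1, 0)
      + e * (f (x (t, s)) (t + s) * Dx (t, s) (1, 0) + V\<tau> (x (t, s)) (t + s))
      - (y (t, s) * Dy (t, s) (1, 0) + g (x (t, s)) * Dx (t, s) (1, 0)))" for t s
  have dL: "((\<lambda>s. L t s) has_real_derivative Ls t s) (at s)" if p: "(t, s) \<in> U" for t s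
  proof -
    have sq: "((\<lambda>s. (y (t, s))\<^sup>2 / 2) has_real_derivative y (t, s) * Dy (t, s) (0, 1)) (at s)"
      by (rule derivative_eq_intros py(2)[OF p] refl | simp)+
    show ?thesis unfolding L_def Ls_def sym[OF p, symmetric]
      by (rule DERIV_cong[OF DERIV_add[OF DERIV_diff[OF DERIV_diff[OF
            DERIV_mult'[OF py(2)[OF p] p1(2)[OF p]] sq] DERIV_chain2[OF Gp px(2)[OF p]]] DERIV_cmult[OF Vs[OF p]]]])
        (simp add: algebra_simps)
  qed
  have dM: "((\<lambda>t. M t s) has_real_derivative Mt t s) (at t)" if p: "(t, s) \<in> U" for t s
  proof -
    have sq: "((\<lambda>t. (y (t, s))\<^sup>2 / 2) has_real_derivative y (t, s) * Dy (t, s) (1, 0)) (at t)"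
      by (rule derivative_eq_intros py(1)[OF p] refl | simp)+
    show ?thesis unfolding M_def Mt_def
      by (rule DERIV_cong[OF DERIV_diff[OF DERIV_add[OF
            DERIV_mult'[OF py(1)[OF p] p2(1)[OF p]] DERIV_cmult[OF Vt[OF p]]]
            DERIV_add[OF sq DERIV_chain2[OF Gp px(1)[OF p]]]]])
        (simp add: algebra_simps)
  qed
  have near_t: "eventually (\<lambda>t'. (t', s) \<in> U) (nhds t)" and near_s: "eventually (\<lambda>s'. (t, s') \<in> U) (nhds s)"
    if p: "(t, s) \<in> U" for t s
  proof -
    have "open ((\<lambda>t'. (t', s)) -` U)" "open ((\<lambda>s'. (t, s')) -` U)"
      by (intro open_vimage U(1) continuous_intros)+
    then show "eventually (\<lambda>t'. (t', s) \<in> U) (nhds t)" "eventually (\<lambda>s'. (t, s') \<in> U) (nhds s)"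
      using p by (auto simp: eventually_nhds)
  qed
  have Lper: "L t S = L t 0" if t: "t \<in> {0..T}" for t
  proof -
    have p: "(t, 0) \<in> U" "(t, S) \<in> U" using mem[OF t] TS by auto
    have ev: "eventually (\<lambda>t'. x (t', S) = x (t', 0)) (nhds t)"
      using near_t[OF p(1)] by eventually_elim (use perS[of _ 0] in auto)
    have "((\<lambda>t. x (t, 0)) has_real_derivative Dx (t, S) (1, 0)) (at t)"
      by (rule iffD1[OF DERIV_cong_ev[OF refl ev refl] px(1)[OF p(2)]])
    then have "Dx (t, S) (1, 0) = Dx (t, 0) (1, 0)" using px(1)[OF p(1)] by (rule DERIV_unique)
    then show ?thesis unfolding L_def using perS[OF p(1)] V(3)[OF f(2), of "x (t, 0)" t] by simp
  qed
  have Mper: "M T s = M 0 s" if s: "s \<in> {0..S}" for s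
  proof -
    have p: "(0, s) \<in> U" "(T, s) \<in> U" using mem[OF _ s] TS by auto
    have ev: "eventually (\<lambda>s'. x (T, s') = x (0, s')) (nhds s)"
      using near_s[OF p(1)] by eventually_elim (use perT[of 0] in auto)
    have "((\<lambda>s. x (0, s)) has_real_derivative Dx (T, s) (0, 1)) (at s)"
      by (rule iffD1[OF DERIV_cong_ev[OF refl ev refl] px(2)[OF p(2)]])
    then have "Dx (T, s) (0, 1) = Dx (0, s) (0, 1)" using px(2)[OF p(1)] by (rule DERIV_unique)
    moreover have "V (x (0, s)) (T + s) = V (x (0, s)) s"
      using V(3)[OF f(3), of "x (0, s)" s] by (simp add: add.commute)
    ultimately show ?thesis unfolding M_def using perT[OF p(1)] by simp
  qed
  have cx: "continuous_on ({0..T} \<times> {0..S}) x" and cy: "continuous_on ({0..T} \<times> {0..S}) y"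
    and cD: "\<And>v. continuous_on ({0..T} \<times> {0..S}) (\<lambda>p. Dx p v)" "\<And>v. continuous_on ({0..T} \<times> {0..S}) (\<lambda>p. Dy p v)"
      "\<And>v. continuous_on ({0..T} \<times> {0..S}) (\<lambda>p. D2 p v)"
    by (intro continuous_on_subset[OF smooth_on_imp_continuous_on U(2)] sm Dx(2) Dy(2) D2(2))+
  have cg: "continuous_on ({0..T} \<times> {0..S}) (\<lambda>p. g (x p))"
    by (rule continuous_on_compose2[OF g cx]) simp
  have cf: "continuous_on ({0..T} \<times> {0..S}) (\<lambda>p. f (x p) (fst p + snd p))"
    using continuous_on_compose2[OF smooth_on_imp_continuous_on[OF f(1)],
      of "{0..T} \<times> {0..S}" "\<lambda>p. (x p, fst p + snd p)"] cx
    by (simp add: continuous_on_Pair continuous_on_add continuous_on_fst continuous_on_snd continuous_on_id)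
  have cV: "continuous_on ({0..T} \<times> {0..S}) (\<lambda>p. V\<tau> (x p) (fst p + snd p))"
    using continuous_on_compose2[OF V(2), of "{0..T} \<times> {0..S}" "\<lambda>p. (x p, fst p + snd p)"] cx
    by (simp add: continuous_on_Pair continuous_on_add continuous_on_fst continuous_on_snd continuous_on_id)
  have cLs: "continuous_on ({0..T} \<times> {0..S}) (\<lambda>(t, s). Ls t s)"
    and cMt: "continuous_on ({0..T} \<times> {0..S}) (\<lambda>(t, s). Mt t s)"
    unfolding Ls_def Mt_def case_prod_unfold prod.collapse
    by (intro continuous_on_add continuous_on_diff continuous_on_mult continuous_on_const cx cy cD cg cf cV)+
  have "integral (cbox (0, 0) (T, S)) (\<lambda>(t, s). Ls t s - Mt t s) = 0"
    by (rule periodic_rectangle_integral[OF TS dL[OF mem] dM[OF mem] Lper Mper cLs cMt])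
  then show ?thesis by (simp add: Ls_def Mt_def algebra_simps)
qed

section \<open>The subharmonic series\<close>

locale subharmonic = action_angle +
  fixes f :: "real \<Rightarrow> real \<Rightarrow> real" and A0 :: real and p q :: nat
    and al Ac :: "nat \<Rightarrow> real \<Rightarrow> real \<Rightarrow> real" and c :: "nat \<Rightarrow> real \<Rightarrow> real"
  assumes g_analytic: "real_analytic_on g UNIV"
    and f_analytic: "real_analytic2_on f UNIV"
    and f_periodic: "\<And>x t. f x (t + 2 * pi) = f x t"
    and pq: "p > 0" "q > 0"
    and A0: "A0 \<in> W" "\<omega> A0 = real p / real q" "deriv \<omega> A0 \<noteq> 0"
    and series: "\<And>t0. subharmonic_series W \<omega> X Y f A0 (2 * pi * real q) t0
                   (\<lambda>k. al k t0) (\<lambda>k. Ac k t0) (\<lambda>k. c k t0)"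
begin

definition "T = 2 * pi * real q"

lemma T_pos: "T > 0" using pq by (simp add: T_def)

lemma \<omega>A0_pos: "\<omega> A0 > 0" using A0(2) pq by simp

lemma \<omega>T: "\<omega> A0 * T = 2 * pi * real p" using A0(2) pq by (simp add: T_def)

lemma f_smooth: "smooth_on (\<lambda>(x, \<tau>). f x \<tau>) UNIV"
  by (rule real_analytic2_on_imp_smooth_on[OF f_analytic])

lemma f_periodic_multiple: "f x (t + 2 * pi * real n) = f x t"
proof (induction n)
  case (Suc n)
  have "t + 2 * pi * real (Suc n) = (t + 2 * pi * real n) + 2 * pi" by (simp add: algebra_simps)
  then show ?case using Suc f_periodic by metis
qed simp

text \<open>
  The perturbation is affine in \<open>C\<close>. Its two parts, for each of the two equations, are written as functions
  of the triple \<open>(\<alpha>, A, \<tau>)\<close> with the explicit inverse of the Jacobian matrix.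
\<close>

definition "angle_forcing = (\<lambda>(a, A, \<tau>). - X_act a A / jac a A * f (X a A) \<tau>)"
definition "angle_damping = (\<lambda>(a, A, \<tau>::real). - X_act a A / jac a A * Y a A)"
definition "action_forcing = (\<lambda>(a, A, \<tau>). X_ang a A / jac a A * f (X a A) \<tau>)"
definition "action_damping = (\<lambda>(a, A, \<tau>::real). X_ang a A / jac a A * Y a A)"

lemma F_pert_eq: "A \<in> W \<Longrightarrow> F_pert W X Y f a A C \<tau> = angle_forcing (a, A, \<tau>) - C * angle_damping (a, A, \<tau>)"
  by (simp add: F_pert_def dangle_dy_eq angle_forcing_def angle_damping_def algebra_simps)

lemma G_pert_eq: "A \<in> W \<Longrightarrow> G_pert W X Y f a A C \<tau> = action_forcing (a, A, \<tau>) - C * action_damping (a, A, \<tau>)"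
  by (simp add: G_pert_def daction_dy_eq action_forcing_def action_damping_def algebra_simps)

lemma smooth_lift3:
  fixes h :: "real \<Rightarrow> real \<Rightarrow> real"
  assumes "smooth_on (\<lambda>(a, A). h a A) (UNIV \<times> W)"
  shows "smooth_on (\<lambda>z. h (fst z) (fst (snd z))) (UNIV \<times> W \<times> (UNIV :: real set))"
proof -
  have "smooth_on (\<lambda>z. (\<lambda>(a, A). h a A) (fst z, fst (snd z))) (UNIV \<times> W \<times> (UNIV :: real set))"
    by (rule smooth_on_compose2[OF assms]) (auto intro!: smooth_on_linear bounded_linear_intros)
  then show ?thesis by simp
qed

lemma smooth_forcing3: "smooth_on (\<lambda>z. f (X (fst z) (fst (snd z))) (snd (snd z))) (UNIV \<times> W \<times> UNIV)"
proof -
  have "smooth_on (\<lambda>z. (\<lambda>(x, \<tau>). f x \<tau>) (X (fst z) (fst (snd z)), snd (snd z))) (UNIV \<times> W \<times> UNIV)"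
    by (rule smooth_on_compose2[OF f_smooth smooth_lift3[OF smooth_coords(1)]])
      (auto intro!: smooth_on_linear bounded_linear_intros)
  then show ?thesis by simp
qed

lemma smooth_perturbation:
  "smooth_on angle_forcing (UNIV \<times> W \<times> UNIV)" "smooth_on angle_damping (UNIV \<times> W \<times> UNIV)"
  "smooth_on action_forcing (UNIV \<times> W \<times> UNIV)" "smooth_on action_damping (UNIV \<times> W \<times> UNIV)"
  unfolding angle_forcing_def angle_damping_def action_forcing_def action_damping_def case_prod_unfold
  by (intro smooth_on_mult smooth_on_divide smooth_on_minus smooth_forcing3
      smooth_lift3[OF smooth_coords(1)] smooth_lift3[OF smooth_coords(2)] smooth_lift3[OF smooth_coords(3)]
      smooth_lift3[OF smooth_coords(4)] smooth_lift3[OF smooth_jac]; auto simp: jac_nonzero)+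

lemma series_zero: "al 0 s t = \<omega> A0 * t" "Ac 0 s t = A0"
  and series_deriv: "(al k s has_real_derivative deriv (al k s) t) (at t)"
    "(Ac k s has_real_derivative deriv (Ac k s) t) (at t)"
  and series_period: "k > 0 \<Longrightarrow> al k s (t + T) = al k s t" "k > 0 \<Longrightarrow> Ac k s (t + T) = Ac k s t"
  and series_mean: "k > 0 \<Longrightarrow> integral {0..T} (al k s) = 0"
  using series[of s] T_pos unfolding subharmonic_series_def mean_def T_def[symmetric]
  by (auto simp: DERIV_deriv_iff_field_differentiable Suc_le_eq)

text \<open>
  The expressions for the perturbation hold only while the action stays in \<open>W\<close>; for order
  estimates at \<open>\<epsilon> = 0\<close> this is enough.
\<close>

lemma action_series_near_A0:
  "eventually (\<lambda>e. (\<Sum>j\<le>n. Ac j s t * e ^ j) \<in> W) (at 0)"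
proof -
  have "((\<lambda>e. \<Sum>j\<le>n. Ac j s t * e ^ j) \<longlongrightarrow> Ac 0 s t) (at 0)"
    unfolding lessThan_Suc_atMost[symmetric] by (rule tendsto_polynomial_at_0)
  then show ?thesis using open_W A0(1) by (auto simp: series_zero dest: topological_tendstoD)
qed

lemma deriv_polynomial:
  fixes h :: "nat \<Rightarrow> real \<Rightarrow> real"
  assumes "\<And>k. (h k has_real_derivative h' k) (at t)"
  shows "deriv (\<lambda>s. \<Sum>j\<le>n. h j s * e ^ j) t = (\<Sum>j\<le>n. h' j * e ^ j)"
  by (intro DERIV_imp_deriv DERIV_sum DERIV_cmult_right assms)

lemma residual_angle:
  "(\<lambda>e. (\<Sum>j\<le>n. deriv (al j s) t * e ^ j) -
      (\<omega> (\<Sum>j\<le>n. Ac j s t * e ^ j)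
       + e * (angle_forcing (\<Sum>j\<le>n. al j s t * e ^ j, \<Sum>j\<le>n. Ac j s t * e ^ j, t + s)
         - (\<Sum>j\<le>n. c j s * e ^ j)
           * angle_damping (\<Sum>j\<le>n. al j s t * e ^ j, \<Sum>j\<le>n. Ac j s t * e ^ j, t + s))))
     \<in> O[at 0](\<lambda>e. e ^ (n + 1))" (is "?r \<in> _")
proof (rule iffD1[OF landau_o.big.in_cong])
  let ?l = "(\<lambda>e. deriv (\<lambda>r. trunc n (\<lambda>k. al k s r) e) t
             - (\<omega> (trunc n (\<lambda>k. Ac k s t) e)
                + e * F_pert W X Y f (trunc n (\<lambda>k. al k s t) e) (trunc n (\<lambda>k. Ac k s t) e)
                      (trunc n (\<lambda>k. c k s) e) (t + s)))"
  show "?l \<in> O[at 0](\<lambda>e. e ^ (n + 1))"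
    using series[of s] unfolding subharmonic_series_def by blast
  show "eventually (\<lambda>e. ?l e = ?r e) (at 0)"
    using action_series_near_A0[where n = n and s = s and t = t]
    by eventually_elim (simp only: deriv_polynomial[OF series_deriv(1)] trunc_def F_pert_eq)
qed

lemma residual_action:
  "(\<lambda>e. (\<Sum>j\<le>n. deriv (Ac j s) t * e ^ j) -
      (e * (action_forcing (\<Sum>j\<le>n. al j s t * e ^ j, \<Sum>j\<le>n. Ac j s t * e ^ j, t + s)
         - (\<Sum>j\<le>n. c j s * e ^ j)
           * action_damping (\<Sum>j\<le>n. al j s t * e ^ j, \<Sum>j\<le>n. Ac j s t * e ^ j, t + s))))
     \<in> O[at 0](\<lambda>e. e ^ (n + 1))" (is "?r \<in> _")
proof (rule iffD1[OF landau_o.big.in_cong])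
  let ?l = "(\<lambda>e. deriv (\<lambda>r. trunc n (\<lambda>k. Ac k s r) e) t
             - e * G_pert W X Y f (trunc n (\<lambda>k. al k s t) e) (trunc n (\<lambda>k. Ac k s t) e)
                      (trunc n (\<lambda>k. c k s) e) (t + s))"
  show "?l \<in> O[at 0](\<lambda>e. e ^ (n + 1))"
    using series[of s] unfolding subharmonic_series_def by blast
  show "eventually (\<lambda>e. ?l e = ?r e) (at 0)"
    using action_series_near_A0[where n = n and s = s and t = t]
    by eventually_elim (simp only: deriv_polynomial[OF series_deriv(2)] trunc_def G_pert_eq)
qed

lemma coefficients_smooth_periodic:
  "smooth_periodic (\<lambda>p. al k (snd p) (fst p))" "smooth_periodic (\<lambda>p. Ac k (snd p) (fst p))"
  "smooth_periodic (\<lambda>p. c k (snd p))"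
proof -
  have "(\<omega> has_real_derivative deriv \<omega> A0) (at A0)"
  proof -
    from smooth_on_has_derivative_ex[OF \<omega>_smooth open_W A0(1)]
    obtain D where D: "(\<omega> has_derivative D) (at A0)" by blast
    have e: "D v = D 1 * v" for v using linear_scale[OF has_derivative_linear[OF D], of v 1] by simp
    have "(\<omega> has_real_derivative D 1) (at A0)"
      unfolding has_field_derivative_def by (rule has_derivative_eq_rhs[OF D ext[OF e]])
    then show ?thesis by (simp add: DERIV_imp_deriv)
  qed
  moreover have "integral {0..T} (\<lambda>t. action_damping (\<omega> A0 * t, A0, t + s)) \<noteq> 0" for s
    using integral_dissipation_nonzero[OF A0(1) \<omega>A0_pos T_pos] by (simp add: action_damping_def)
  ultimately have "smooth_periodic (\<lambda>p. al k (snd p) (fst p)) \<and> smooth_periodic (\<lambda>p. Ac k (snd p) (fst p))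
     \<and> smooth_periodic (\<lambda>p. c k (snd p))"
    by (intro formal_series_smooth_periodic[OF open_W A0(1) \<omega>_smooth _ A0(3) T_pos smooth_perturbation
        _ _ _ _ series_zero series_deriv series_period series_mean residual_angle residual_action])
      (simp_all add: angle_forcing_def angle_damping_def action_forcing_def action_damping_def f_periodic)
  then show "smooth_periodic (\<lambda>p. al k (snd p) (fst p))" "smooth_periodic (\<lambda>p. Ac k (snd p) (fst p))"
    "smooth_periodic (\<lambda>p. c k (snd p))" by blast+
qed

end

section \<open>The mean of the first nonzero coefficient\<close>

context subharmonic
begin

text \<open>
  The area identity is applied to the series truncated at order \<open>k + 1\<close>. On the rectangle, \<open>e C\<close> equals
  \<open>e^(k+1) (c k + e c (k + 1))\<close> and the residuals are \<open>O(e^(k+2))\<close>. Division by \<open>e^(k+1)\<close> and \<open>e \<rightarrow> 0\<close>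
  leave the integral of \<open>- Y\<^sup>2 c k\<close> along the unperturbed orbit.
\<close>

lemma integral_first_coefficient:
  assumes zero: "\<And>j s. j < k \<Longrightarrow> s \<in> {0..2 * pi} \<Longrightarrow> c j s = 0"
  shows "integral {0..2 * pi} (c k) = 0"
proof -
  define N where "N = Suc k"
  define \<alpha> where "\<alpha> z = (\<Sum>j\<le>N. al j (snd (snd z)) (fst (snd z)) * fst z ^ j)" for z :: "real \<times> real \<times> real"
  define A where "A z = (\<Sum>j\<le>N. Ac j (snd (snd z)) (fst (snd z)) * fst z ^ j)" for z :: "real \<times> real \<times> real"
  define C where "C z = (\<Sum>j\<le>N. c j (snd (snd z)) * fst z ^ j)" for z :: "real \<times> real \<times> real"
  define U where "U = A -` W"
  define et es :: "real \<times> real \<times> real" where "et = (0, 1, 0)" and "es = (0, 0, 1)"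
  have lift: "smooth_on (\<lambda>z. h (snd z)) (S :: (real \<times> real \<times> real) set)" if "smooth_periodic h" for h S
    by (rule smooth_on_compose_linear[OF smooth_periodicD(1)[OF that] bounded_linear_snd]) simp
  have sm_e: "smooth_on fst S" for S :: "(real \<times> real \<times> real) set"
    by (intro smooth_on_linear bounded_linear_fst)
  have sm_\<alpha>: "smooth_on \<alpha> S" for S unfolding \<alpha>_def
    by (intro smooth_on_sum smooth_on_mult smooth_on_power sm_e lift[OF coefficients_smooth_periodic(1)])
  have sm_A: "smooth_on A S" for S unfolding A_def
    by (intro smooth_on_sum smooth_on_mult smooth_on_power sm_e lift[OF coefficients_smooth_periodic(2)])
  have sm_C: "smooth_on C S" for S unfolding C_def
    by (intro smooth_on_sum smooth_on_mult smooth_on_power sm_e lift[OF coefficients_smooth_periodic(3)])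
  have U: "open U" unfolding U_def
    using smooth_on_imp_continuous_on[OF sm_A[of UNIV]] open_W by (intro open_vimage)
  have UW: "A z \<in> W" if "z \<in> U" for z using that by (simp add: U_def)
  have at0: "\<alpha> (0, t, s) = \<omega> A0 * t" "A (0, t, s) = A0" for t s
    by (simp_all add: \<alpha>_def A_def series_zero lessThan_Suc_atMost[symmetric] sum.lessThan_Suc_shift del: sum.lessThan_Suc)
  have U0: "(0, p) \<in> U" for p using at0(2)[of "fst p" "snd p"] A0(1) by (simp add: U_def)
  have pull2: "smooth_on (\<lambda>z. h (\<alpha> z) (A z)) U" if "smooth_on (\<lambda>(a, A). h a A) (UNIV \<times> W)" for h
    using smooth_on_compose2[OF that sm_\<alpha> sm_A, of U] UW by simp
  have sm_ts: "smooth_on (\<lambda>z. fst (snd z) + snd (snd z)) S" for S :: "(real \<times> real \<times> real) set"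
    by (intro smooth_on_linear bounded_linear_intros)
  have pull3: "smooth_on (\<lambda>z. h (\<alpha> z, A z, fst (snd z) + snd (snd z))) U" if "smooth_on h (UNIV \<times> W \<times> UNIV)" for h
    by (rule smooth_on_compose3[OF that sm_\<alpha> sm_A sm_ts]) (simp add: UW)
  from smooth_on_has_derivativeE[OF sm_\<alpha>[of UNIV] open_UNIV] obtain D\<alpha> where
    D\<alpha>: "\<And>z. (\<alpha> has_derivative D\<alpha> z) (at z)" "\<And>v. smooth_on (\<lambda>z. D\<alpha> z v) UNIV" by auto
  from smooth_on_has_derivativeE[OF sm_A[of UNIV] open_UNIV] obtain DA where
    DA: "\<And>z. (A has_derivative DA z) (at z)" "\<And>v. smooth_on (\<lambda>z. DA z v) UNIV" by auto
  have smD: "smooth_on (\<lambda>z. D\<alpha> z v) U" "smooth_on (\<lambda>z. DA z v) U" for v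
    by (rule smooth_on_subset[OF D\<alpha>(2)] smooth_on_subset[OF DA(2)], simp)+
  note p\<alpha> = partial_derivatives[OF has_derivative_slice[OF D\<alpha>(1)], folded et_def es_def]
    and pA = partial_derivatives[OF has_derivative_slice[OF DA(1)], folded et_def es_def]
  have D\<alpha>t: "D\<alpha> (e, t, s) et = (\<Sum>j\<le>N. deriv (al j s) t * e ^ j)" for e t s
  proof (rule DERIV_unique[OF p\<alpha>(1)])
    show "((\<lambda>t. \<alpha> (e, t, s)) has_real_derivative (\<Sum>j\<le>N. deriv (al j s) t * e ^ j)) (at t)"
      unfolding \<alpha>_def fst_conv snd_conv by (intro DERIV_sum DERIV_cmult_right series_deriv)
  qed
  have DAt: "DA (e, t, s) et = (\<Sum>j\<le>N. deriv (Ac j s) t * e ^ j)" for e t s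
  proof (rule DERIV_unique[OF pA(1)])
    show "((\<lambda>t. A (e, t, s)) has_real_derivative (\<Sum>j\<le>N. deriv (Ac j s) t * e ^ j)) (at t)"
      unfolding A_def fst_conv snd_conv by (intro DERIV_sum DERIV_cmult_right series_deriv)
  qed
  have Ds0: "D\<alpha> (0, t, s) es = 0" "DA (0, t, s) es = 0" for t s
    using DERIV_unique[OF p\<alpha>(2)[of 0 t s, unfolded at0] DERIV_const]
      DERIV_unique[OF pA(2)[of 0 t s, unfolded at0] DERIV_const] by simp_all
  define x where "x z = X (\<alpha> z) (A z)" for z
  define y where "y z = Y (\<alpha> z) (A z)" for z
  define Dx where "Dx z v = X_ang (\<alpha> z) (A z) * D\<alpha> z v + X_act (\<alpha> z) (A z) * DA z v" for z v
  define Dy where "Dy z v = Y_ang (\<alpha> z) (A z) * D\<alpha> z v + Y_act (\<alpha> z) (A z) * DA z v" for z v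
  have pair: "((\<lambda>z. (\<alpha> z, A z)) has_derivative (\<lambda>v. (D\<alpha> z v, DA z v))) (at z)" for z
    by (intro has_derivative_Pair D\<alpha>(1) DA(1))
  have dx: "(x has_derivative Dx z) (at z)" and dy: "(y has_derivative Dy z) (at z)" if "z \<in> U" for z
    using has_derivative_compose[OF pair has_derivative_X[OF UW[OF that]]]
      has_derivative_compose[OF pair has_derivative_Y[OF UW[OF that]]]
    unfolding x_def[abs_def] y_def[abs_def] Dx_def[abs_def] Dy_def[abs_def] by simp_all
  have sm_x: "smooth_on x U" and sm_y: "smooth_on y U"
    unfolding x_def y_def by (intro pull2 smooth_coords)+
  have sm_Dx: "smooth_on (\<lambda>z. Dx z v) U" and sm_Dy: "smooth_on (\<lambda>z. Dy z v) U" for v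
    unfolding Dx_def Dy_def by (intro smooth_on_add smooth_on_mult pull2 smooth_coords smD)+
  \<comment> \<open>Residuals of the truncated series in action-angle coordinates; \<open>r1\<close> and \<open>r2\<close> below are their images in the phase plane.\<close>
  define R1 where "R1 z = D\<alpha> z et - (\<omega> (A z) + fst z * (angle_forcing (\<alpha> z, A z, fst (snd z) + snd (snd z))
      - C z * angle_damping (\<alpha> z, A z, fst (snd z) + snd (snd z))))" for z
  define R2 where "R2 z = DA z et - (fst z * (action_forcing (\<alpha> z, A z, fst (snd z) + snd (snd z))
      - C z * action_damping (\<alpha> z, A z, fst (snd z) + snd (snd z))))" for z
  have sm_R1: "smooth_on R1 U" unfolding R1_def
    by (intro smooth_on_diff smooth_on_add smooth_on_mult smD sm_e sm_C pull3 smooth_perturbation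
        smooth_on_compose1[OF \<omega>_smooth sm_A] UW)
  have sm_R2: "smooth_on R2 U" unfolding R2_def
    by (intro smooth_on_diff smooth_on_mult smD sm_e sm_C pull3 smooth_perturbation)
  have R1_O: "(\<lambda>e. R1 (e, p)) \<in> O[at 0](\<lambda>e. e ^ (N + 1))" for p
    using residual_angle[of "snd p" "fst p" N]
    by (cases p) (simp only: R1_def D\<alpha>t \<alpha>_def A_def C_def fst_conv snd_conv)
  have R2_O: "(\<lambda>e. R2 (e, p)) \<in> O[at 0](\<lambda>e. e ^ (N + 1))" for p
    using residual_action[of "snd p" "fst p" N]
    by (cases p) (simp only: R2_def DAt \<alpha>_def A_def C_def fst_conv snd_conv)
  define r1 where "r1 z = X_ang (\<alpha> z) (A z) * R1 z + X_act (\<alpha> z) (A z) * R2 z" for z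
  define r2 where "r2 z = Y_ang (\<alpha> z) (A z) * R1 z + Y_act (\<alpha> z) (A z) * R2 z" for z
  have sm_r1: "smooth_on r1 U" and sm_r2: "smooth_on r2 U"
    unfolding r1_def r2_def by (intro smooth_on_add smooth_on_mult pull2 smooth_coords sm_R1 sm_R2)+
  have r1_O: "(\<lambda>e. r1 (e, p)) \<in> O[at 0](\<lambda>e. e ^ (N + 1))"
    and r2_O: "(\<lambda>e. r2 (e, p)) \<in> O[at 0](\<lambda>e. e ^ (N + 1))" for p
    unfolding r1_def r2_def
    by (intro sum_in_bigo bigo_1_mult R1_O R2_O smooth_on_bigo_1[OF pull2 U U0] smooth_coords)+
  have Dxt: "Dx z et = y z + r1 z"
    and Dyt: "Dy z et = - g (x z) + fst z * (f (x z) (fst (snd z) + snd (snd z)) - C z * y z) + r2 z"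
    if "z \<in> U" for z
  proof -
    let ?a = "\<alpha> z" and ?A = "A z" and ?f = "f (x z) (fst (snd z) + snd (snd z)) - C z * y z"
    have jac: "jac ?a ?A \<noteq> 0" by (rule jac_nonzero[OF UW[OF that]])
    \<comment> \<open>The forcing enters \<open>x\<^sub>t\<close> with the factor zero and \<open>y\<^sub>t\<close> with the factor one, because \<open>(\<partial>\<alpha>/\<partial>y, \<partial>A/\<partial>y)\<close> is a column of the inverse Jacobian matrix.\<close>
    have 1: "D\<alpha> z et = \<omega> ?A + fst z * (- X_act ?a ?A / jac ?a ?A * ?f) + R1 z"
      by (simp add: R1_def angle_forcing_def angle_damping_def x_def y_def algebra_simps)
    have 2: "DA z et = fst z * (X_ang ?a ?A / jac ?a ?A * ?f) + R2 z"
      by (simp add: R2_def action_forcing_def action_damping_def x_def y_def algebra_simps)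
    have "Dx z et = X_ang ?a ?A * \<omega> ?A + r1 z"
      unfolding Dx_def 1 2 r1_def by (simp add: algebra_simps)
    then show "Dx z et = y z + r1 z" by (simp add: flow(1)[OF UW[OF that]] y_def)
    have "Dy z et = Y_ang ?a ?A * \<omega> ?A + fst z * ?f * ((X_ang ?a ?A * Y_act ?a ?A - X_act ?a ?A * Y_ang ?a ?A) / jac ?a ?A) + r2 z"
      unfolding Dy_def 1 2 r2_def using jac by (simp add: field_simps)
    also have "(X_ang ?a ?A * Y_act ?a ?A - X_act ?a ?A * Y_ang ?a ?A) / jac ?a ?A = 1"
      using jac by (simp add: jac_def)
    finally show "Dy z et = - g (x z) + fst z * ?f + r2 z"
      by (simp add: flow(2)[OF UW[OF that]] x_def)
  qed
  have perT: "x (e, t + T, s) = x (e, t, s) \<and> y (e, t + T, s) = y (e, t, s)" if "(e, t, s) \<in> U" for e t s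
  proof -
    have "\<alpha> (e, t + T, s) - \<alpha> (e, t, s) = (\<Sum>j\<le>N. (al j s (t + T) - al j s t) * e ^ j)"
      by (simp add: \<alpha>_def left_diff_distrib sum_subtractf)
    \<comment> \<open>Only the term of order zero is not periodic: it advances by \<open>\<omega> A0 * T = 2\<pi>p\<close>.\<close>
    also have "\<dots> = (\<Sum>j\<le>N. if j = 0 then \<omega> A0 * T else 0)"
      by (intro sum.cong) (auto simp: series_zero series_period algebra_simps)
    finally have "\<alpha> (e, t + T, s) = \<alpha> (e, t, s) + 2 * pi * real p" by (simp add: \<omega>T)
    moreover have "A (e, t + T, s) = A (e, t, s)"
    proof -
      have "Ac j s (t + T) = Ac j s t" for j by (cases "j = 0") (simp_all add: series_zero series_period)
      then show ?thesis by (simp add: A_def)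
    qed
    ultimately show ?thesis using periodic_multiple[OF UW[OF that]] by (simp add: x_def y_def)
  qed
  have perS: "x (e, t, s + 2 * pi) = x (e, t, s) \<and> y (e, t, s + 2 * pi) = y (e, t, s)" for e t s
    using smooth_periodicD(2)[OF coefficients_smooth_periodic(1), where t = t and s = s]
      smooth_periodicD(2)[OF coefficients_smooth_periodic(2), where t = t and s = s]
    by (simp add: x_def y_def \<alpha>_def A_def)
  \<comment> \<open>The integrand of the area identity splits into the dissipation \<open>e ^ Suc k * H\<close> and the part \<open>Z\<close> that is linear in the residuals.\<close>
  define Z where "Z z = Dy z es * r1 z - Dx z es * r2 z + y z * r2 z + g (x z) * r1 z
    - fst z * f (x z) (fst (snd z) + snd (snd z)) * r1 z" for z
  define H where "H z = (c k (snd (snd z)) + fst z * c (Suc k) (snd (snd z))) * (y z * (Dx z es - y z))" for z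
  have sm_g: "smooth_on (\<lambda>z. g (x z)) U"
    by (rule smooth_on_compose1[OF real_analytic_on_imp_smooth_on[OF g_analytic] sm_x]) simp
  have sm_f: "smooth_on (\<lambda>z. f (x z) (fst (snd z) + snd (snd z))) U"
    using smooth_on_compose2[OF f_smooth sm_x sm_ts] by simp
  have sm_Z: "smooth_on Z U" unfolding Z_def
    by (intro smooth_on_add smooth_on_diff smooth_on_mult sm_Dx sm_Dy sm_r1 sm_r2 sm_x sm_y sm_g sm_f sm_e)
  have sm_H: "smooth_on H U" unfolding H_def
    by (intro smooth_on_add smooth_on_diff smooth_on_mult sm_Dx sm_y sm_e
        lift[OF coefficients_smooth_periodic(3)])
  have Z_O: "(\<lambda>e. Z (e, p)) \<in> O[at 0](\<lambda>e. e ^ (N + 1))" for p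
    unfolding Z_def
    by (intro sum_in_bigo bigo_1_mult r1_O r2_O smooth_on_bigo_1[OF _ U U0] smooth_on_mult
        sm_Dx sm_Dy sm_y sm_g sm_f sm_e)
  let ?K = "cbox (0, 0) (T, 2 * pi) :: (real \<times> real) set"
  have K: "?K = {0..T} \<times> {0..2 * pi}" by (simp add: cbox_Pair_eq)
  from smooth_on_bigo_uniform[OF sm_Z U U0 Z_O compact_cbox]
  obtain M \<delta> where \<delta>: "\<delta> > 0" and M: "\<And>e p. \<bar>e\<bar> \<le> \<delta> \<Longrightarrow> p \<in> ?K \<Longrightarrow> (e, p) \<in> U \<and> \<bar>Z (e, p)\<bar> \<le> M * \<bar>e\<bar> ^ Suc N"
    by blast
  have contH: "continuous_on ?K (\<lambda>p. H (e, p))" and contZ: "continuous_on ?K (\<lambda>p. Z (e, p))" if "\<bar>e\<bar> \<le> \<delta>" for e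
    by (rule continuous_on_subset[OF smooth_on_imp_continuous_on[OF smooth_on_slice[OF sm_H]]]
        continuous_on_subset[OF smooth_on_imp_continuous_on[OF smooth_on_slice[OF sm_Z]]],
        use M[OF that] in blast)+
  have area: "e ^ Suc k * integral ?K (\<lambda>p. H (e, p)) + integral ?K (\<lambda>p. Z (e, p)) = 0" if e: "\<bar>e\<bar> \<le> \<delta>" for e
  proof -
    let ?U = "{p. (e, p) \<in> U}"
    have openU: "open ?U" using open_vimage[OF U, of "\<lambda>p. (e, p)"] by (simp add: vimage_def continuous_intros)
    have subU: "{0..T} \<times> {0..2 * pi} \<subseteq> ?U" using M[OF e] K by auto
    have fT: "f x (\<tau> + T) = f x \<tau>" for x \<tau> using f_periodic_multiple[of x \<tau> q] by (simp add: T_def)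
    let ?I = "\<lambda>(t, s).
      Dy (e, t, s) (0, 0, 1) * Dx (e, t, s) (0, 1, 0) - y (e, t, s) * Dy (e, t, s) (0, 0, 1)
      - g (x (e, t, s)) * Dx (e, t, s) (0, 0, 1) + e * f (x (e, t, s)) (t + s) * Dx (e, t, s) (0, 0, 1)
      - Dy (e, t, s) (0, 1, 0) * Dx (e, t, s) (0, 0, 1) - e * f (x (e, t, s)) (t + s) * Dx (e, t, s) (0, 1, 0)
      + y (e, t, s) * Dy (e, t, s) (0, 1, 0) + g (x (e, t, s)) * Dx (e, t, s) (0, 1, 0)"
    have "integral ?K ?I = 0"
      by (rule torus_area_identity[OF T_pos _ openU subU smooth_on_slice[OF sm_x] smooth_on_slice[OF sm_y]
          has_derivative_slice[OF dx] smooth_on_slice[OF sm_Dx] has_derivative_slice[OF dy] smooth_on_slice[OF sm_Dy]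
          _ _ smooth_on_imp_continuous_on[OF real_analytic_on_imp_smooth_on[OF g_analytic]] f_smooth f_periodic fT])
        (use perT perS in auto)
    also have "integral ?K ?I = integral ?K (\<lambda>p. e ^ Suc k * H (e, p) + Z (e, p))"
    proof (rule integral_cong)
      fix p assume p: "p \<in> ?K"
      obtain t s where ts: "p = (t, s)" by force
      have u: "(e, t, s) \<in> U" using M[OF e p] ts by simp
      have s: "s \<in> {0..2 * pi}" using p K ts by auto
      have "C (e, t, s) = (\<Sum>j\<le>Suc k. if j < k then 0 else c j s * e ^ j)"
        unfolding C_def N_def using zero[OF _ s] by (intro sum.cong) auto
      also have "\<dots> = e ^ k * (c k s + e * c (Suc k) s)"
        by (simp add: lessThan_Suc_atMost[symmetric] algebra_simps)
      finally have eC: "e * C (e, t, s) = e ^ Suc k * (c k s + e * c (Suc k) s)" by simp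
      let ?xs = "Dx (e, t, s) es" and ?ys = "Dy (e, t, s) es" and ?y = "y (e, t, s)"
        and ?r1 = "r1 (e, t, s)" and ?r2 = "r2 (e, t, s)" and ?g = "g (x (e, t, s))"
        and ?f = "f (x (e, t, s)) (t + s)" and ?C = "C (e, t, s)"
      have "?ys * Dx (e, t, s) et - ?y * ?ys - ?g * ?xs + e * ?f * ?xs - Dy (e, t, s) et * ?xs
          - e * ?f * Dx (e, t, s) et + ?y * Dy (e, t, s) et + ?g * Dx (e, t, s) et
        = (e * ?C) * (?y * (?xs - ?y)) + (?ys * ?r1 - ?xs * ?r2 + ?y * ?r2 + ?g * ?r1 - e * ?f * ?r1)"
        unfolding Dxt[OF u] Dyt[OF u] fst_conv snd_conv by (simp add: algebra_simps)
      then show "?I p = e ^ Suc k * H (e, p) + Z (e, p)"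
        unfolding ts prod.case eC H_def Z_def fst_conv snd_conv et_def[symmetric] es_def[symmetric]
        by (simp only: mult.assoc)
    qed
    also have "\<dots> = integral ?K (\<lambda>p. e ^ Suc k * H (e, p)) + integral ?K (\<lambda>p. Z (e, p))"
      by (intro integral_add integrable_continuous continuous_on_mult continuous_on_const contH contZ e)
    finally show ?thesis by (simp only: integral_mult_right)
  qed
  have bound: "\<bar>integral ?K (\<lambda>p. H (e, p))\<bar> \<le> \<bar>M\<bar> * measure lborel ?K * \<bar>e\<bar>" if e: "\<bar>e\<bar> \<le> \<delta>" "e \<noteq> 0" for e
  proof -
    have "norm (integral ?K (\<lambda>p. Z (e, p))) \<le> (\<bar>M\<bar> * \<bar>e\<bar> ^ Suc N) * measure lborel ?K"
    proof (rule has_integral_bound)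
      show "((\<lambda>p. Z (e, p)) has_integral integral ?K (\<lambda>p. Z (e, p))) ?K"
        by (intro integrable_integral integrable_continuous contZ e)
      fix p assume "p \<in> ?K"
      then have "\<bar>Z (e, p)\<bar> \<le> M * \<bar>e\<bar> ^ Suc N" using M e by blast
      also have "\<dots> \<le> \<bar>M\<bar> * \<bar>e\<bar> ^ Suc N" by (intro mult_right_mono) auto
      finally show "norm (Z (e, p)) \<le> \<bar>M\<bar> * \<bar>e\<bar> ^ Suc N" by simp
    qed simp
    moreover have "\<bar>e\<bar> ^ Suc k * \<bar>integral ?K (\<lambda>p. H (e, p))\<bar> = \<bar>integral ?K (\<lambda>p. Z (e, p))\<bar>"
    proof -
      have "integral ?K (\<lambda>p. Z (e, p)) = - (e ^ Suc k * integral ?K (\<lambda>p. H (e, p)))"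
        using area[OF e(1)] by linarith
      then show ?thesis by (simp only: abs_minus_cancel abs_mult power_abs)
    qed
    ultimately have "\<bar>e\<bar> ^ Suc k * \<bar>integral ?K (\<lambda>p. H (e, p))\<bar> \<le> \<bar>e\<bar> ^ Suc k * (\<bar>M\<bar> * measure lborel ?K * \<bar>e\<bar>)"
      by (simp add: N_def mult_ac)
    then show ?thesis using e(2) by (simp del: power_Suc)
  qed
  have lim1: "((\<lambda>e. integral ?K (\<lambda>p. H (e, p))) \<longlongrightarrow> 0) (at 0)"
  proof (rule Lim_null_comparison)
    show "eventually (\<lambda>e. norm (integral ?K (\<lambda>p. H (e, p))) \<le> \<bar>M\<bar> * measure lborel ?K * \<bar>e\<bar>) (at 0)"
      unfolding eventually_at using \<delta> bound by (intro exI[of _ \<delta>]) auto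
    have "((\<lambda>e. \<bar>M\<bar> * measure lborel ?K * \<bar>e\<bar>) \<longlongrightarrow> \<bar>M\<bar> * measure lborel ?K * \<bar>0\<bar>) (at (0::real))" by (intro tendsto_intros)
    then show "((\<lambda>e. \<bar>M\<bar> * measure lborel ?K * \<bar>e\<bar>) \<longlongrightarrow> 0) (at (0::real))" by simp
  qed
  have "continuous_on {-\<delta><..<\<delta>} (\<lambda>e. integral ?K (\<lambda>p. H (e, p)))"
  proof (rule integral_continuous_on_param)
    have "continuous_on ({-\<delta><..<\<delta>} \<times> ?K) H"
      using M by (intro continuous_on_subset[OF smooth_on_imp_continuous_on[OF sm_H]]) auto
    then show "continuous_on ({-\<delta><..<\<delta>} \<times> ?K) (\<lambda>(e, p). H (e, p))" by simp
  qed
  then have "isCont (\<lambda>e. integral ?K (\<lambda>p. H (e, p))) 0"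
    using \<delta> by (simp add: continuous_on_eq_continuous_at)
  then have lim2: "((\<lambda>e. integral ?K (\<lambda>p. H (e, p))) \<longlongrightarrow> integral ?K (\<lambda>p. H (0, p))) (at 0)"
    by (simp add: isCont_def)
  have "integral ?K (\<lambda>p. H (0, p)) = 0" by (rule tendsto_unique[OF _ lim2 lim1]) simp
  moreover have "integral ?K (\<lambda>p. H (0, p)) = integral {0..T} (\<lambda>t. integral {0..2 * pi} (\<lambda>s. H (0, t, s)))"
    using integral_prod_continuous[of 0 0 T "2 * pi" "\<lambda>p. H (0, p)"] contH[of 0] \<delta> by simp
  moreover have "H (0, t, s) = - ((Y (\<omega> A0 * t) A0)\<^sup>2 * c k s)" for t s
    by (simp add: H_def Dx_def Ds0 y_def at0 power2_eq_square)
  ultimately have "integral {0..T} (\<lambda>t. (Y (\<omega> A0 * t) A0)\<^sup>2) * integral {0..2 * pi} (c k) = 0"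
    by simp
  then show ?thesis using integral_velocity_squared_pos[OF A0(1) \<omega>A0_pos T_pos] by simp
qed

end

section \<open>Signs of the bifurcation curves\<close>

text \<open>
  Near zero the series has the sign of its leading term. Multiplication by \<open>e ^ k * d k\<close> avoids
  a distinction according to the parity of \<open>k\<close> and the sign of \<open>e\<close>.
\<close>

lemma power_series_leading_sign:
  fixes d :: "nat \<Rightarrow> real"
  assumes r: "r > 0" "\<And>e. \<bar>e\<bar> < r \<Longrightarrow> summable (\<lambda>j. d j * e ^ j)"
    and d: "\<And>j. j < k \<Longrightarrow> d j = 0" "d k \<noteq> 0"
  shows "\<exists>\<delta>>0. \<forall>e. e \<noteq> 0 \<and> \<bar>e\<bar> < \<delta> \<longrightarrow> 0 < (\<Sum>j. d j * e ^ j) * e ^ k * d k"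
proof -
  define h where "h e = (\<Sum>j. d (j + k) * e ^ j)" for e
  have shift: "(\<Sum>j. d j * e ^ j) = e ^ k * h e" if e: "\<bar>e\<bar> < r" "e \<noteq> 0" for e
  proof -
    have "summable (\<lambda>j. d (j + k) * e ^ (j + k))"
      by (rule summable_ignore_initial_segment[OF r(2)[OF e(1)]])
    then have "summable (\<lambda>j. (d (j + k) * e ^ (j + k)) / e ^ k)" by (rule summable_divide)
    then have sm: "summable (\<lambda>j. d (j + k) * e ^ j)" using e(2) by (simp add: power_add)
    have "(\<Sum>j. d j * e ^ j) = (\<Sum>j. d (j + k) * e ^ (j + k)) + (\<Sum>j<k. d j * e ^ j)"
      by (rule suminf_split_initial_segment[OF r(2)[OF e(1)]])
    also have "\<dots> = (\<Sum>j. e ^ k * (d (j + k) * e ^ j))" using d(1) by (simp add: power_add mult_ac)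
    also have "\<dots> = e ^ k * h e" unfolding h_def by (rule suminf_mult[OF sm])
    finally show ?thesis .
  qed
  have "isCont h 0"
  proof -
    have "summable (\<lambda>j. d (j + k) * (r / 2) ^ (j + k))"
      by (rule summable_ignore_initial_segment[OF r(2)]) (use r in simp)
    then have "summable (\<lambda>j. (d (j + k) * (r / 2) ^ (j + k)) / (r / 2) ^ k)" by (rule summable_divide)
    then have "summable (\<lambda>j. d (j + k) * (r / 2) ^ j)" using r(1) by (simp add: power_add)
    from isCont_powser[OF this, of 0] show ?thesis using r(1) by (simp add: h_def[abs_def])
  qed
  moreover have "h 0 = d k" using powser_zero[of "\<lambda>j. d (j + k)"] by (simp add: h_def)
  ultimately have "((\<lambda>e. h e * d k) \<longlongrightarrow> d k * d k) (at 0)"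
    by (auto simp: isCont_def intro!: tendsto_mult)
  moreover have "0 < d k * d k" using d(2) by (auto simp: zero_less_mult_iff)
  ultimately have "eventually (\<lambda>e. 0 < h e * d k) (at 0)" by (rule order_tendstoD)
  then obtain \<delta> where \<delta>: "\<delta> > 0" "\<And>e. e \<noteq> 0 \<Longrightarrow> \<bar>e\<bar> < \<delta> \<Longrightarrow> 0 < h e * d k"
    unfolding eventually_at by (auto simp: dist_real_def)
  show ?thesis
  proof (intro exI[of _ "min \<delta> r"] conjI allI impI)
    fix e :: real assume e: "e \<noteq> 0 \<and> \<bar>e\<bar> < min \<delta> r"
    then have "0 < (e ^ k)\<^sup>2" "0 < h e * d k" using \<delta>(2)[of e] by simp_all
    then have "0 < (e ^ k)\<^sup>2 * (h e * d k)" by (rule mult_pos_pos)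
    then show "0 < (\<Sum>j. d j * e ^ j) * e ^ k * d k"
      using shift[of e] e by (simp add: power2_eq_square mult_ac)
  qed (use \<delta> r in auto)
qed

lemma uniform_limit_power_series:
  assumes "uniformly_convergent_on UNIV (\<lambda>n t0. \<Sum>k<n. c k t0 * \<epsilon> ^ k)"
  shows "uniform_limit UNIV (\<lambda>n t0. \<Sum>k<n. c k t0 * \<epsilon> ^ k) (C_sum c \<epsilon>) sequentially"
    and "summable (\<lambda>k. c k t0 * \<epsilon> ^ k)"
proof -
  from assms have u: "uniform_limit UNIV (\<lambda>n t0. \<Sum>k<n. c k t0 * \<epsilon> ^ k)
      (\<lambda>t0. lim (\<lambda>n. \<Sum>k<n. c k t0 * \<epsilon> ^ k)) sequentially"
    by (simp add: uniformly_convergent_uniform_limit_iff)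
  then show "uniform_limit UNIV (\<lambda>n t0. \<Sum>k<n. c k t0 * \<epsilon> ^ k) (C_sum c \<epsilon>) sequentially"
    by (simp add: C_sum_def[abs_def] suminf_eq_lim)
  from tendsto_uniform_limitI[OF u UNIV_I, of t0] show "summable (\<lambda>k. c k t0 * \<epsilon> ^ k)"
    unfolding summable_def sums_def by blast
qed

text \<open>
  Suprema and infima of real sets carry information only when the sets are bounded. The sum is a uniform
  limit of continuous functions, hence bounded on the compact closure of the interval.
\<close>

lemma C_sum_bounded:
  assumes "uniformly_convergent_on UNIV (\<lambda>n t0. \<Sum>k<n. c k t0 * \<epsilon> ^ k)"
    and "\<And>k. continuous_on UNIV (c k)"
  shows "bdd_above (C_sum c \<epsilon> ` {0..<2 * pi})" "bdd_below (C_sum c \<epsilon> ` {0..<2 * pi})"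
proof -
  have "continuous_on UNIV (C_sum c \<epsilon>)"
    by (rule uniform_limit_theorem[OF _ uniform_limit_power_series(1)[OF assms(1)]])
      (intro always_eventually allI continuous_intros assms(2), simp)
  then have "bounded (C_sum c \<epsilon> ` {0..2 * pi})"
    by (intro compact_imp_bounded compact_continuous_image) (auto intro: continuous_on_subset)
  then have "bounded (C_sum c \<epsilon> ` {0..<2 * pi})" by (rule bounded_subset) auto
  then show "bdd_above (C_sum c \<epsilon> ` {0..<2 * pi})" "bdd_below (C_sum c \<epsilon> ` {0..<2 * pi})"
    by (rule bounded_imp_bdd_above bounded_imp_bdd_below)+
qed

context subharmonic
begin

lemma c_continuous: "continuous_on S (c k)"
proof -
  have "continuous_on S (\<lambda>s. (\<lambda>p. c k (snd p)) (0::real, s))"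
    by (rule continuous_on_compose2[OF smooth_on_imp_continuous_on[OF smooth_periodicD(1)[OF coefficients_smooth_periodic(3)]]])
      (auto intro!: continuous_intros)
  then show ?thesis by simp
qed

lemma c_endpoint: "c k (2 * pi) = c k 0"
  using smooth_periodicD(2)[OF coefficients_smooth_periodic(3), where t = 0 and s = 0] by simp

text \<open>
  A continuous function of constant sign and mean zero vanishes identically. Periodicity extends
  information from \<open>[0, 2\<pi>)\<close> to the closed interval of integration.
\<close>

lemma first_coefficient_changes_sign:
  assumes zero: "\<And>j s. j < k \<Longrightarrow> s \<in> {0..<2 * pi} \<Longrightarrow> c j s = 0"
    and nz: "s0 \<in> {0..<2 * pi}" "c k s0 \<noteq> 0"
  shows "\<exists>s\<in>{0..<2 * pi}. 0 < c k s" "\<exists>s\<in>{0..<2 * pi}. c k s < 0"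
proof -
  have closed: "P (c j s)" if "\<And>s. s \<in> {0..<2 * pi} \<Longrightarrow> P (c j s)" "s \<in> {0..2 * pi}" for P j s
  proof (cases "s = 2 * pi")
    case True
    with that(1)[of 0] show ?thesis by (simp add: c_endpoint)
  next
    case False
    with that show ?thesis by auto
  qed
  have int: "integral {0..2 * pi} (c k) = 0"
  proof (rule integral_first_coefficient)
    fix j s assume "j < k" "s \<in> {0..2 * pi}"
    then show "c j s = 0" using closed[of "\<lambda>v. v = 0" j s] zero[of j] by blast
  qed
  have s0: "s0 \<in> {0..2 * pi}" using nz by simp
  show "\<exists>s\<in>{0..<2 * pi}. 0 < c k s"
  proof (rule ccontr)
    assume "\<not> ?thesis"
    then have "c k s \<le> 0" if "s \<in> {0..<2 * pi}" for s using that by (meson not_less)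
    then have le: "- c k s \<ge> 0" if "s \<in> {0..2 * pi}" for s
      using closed[of "\<lambda>v. v \<le> 0" k s] that by simp
    have cont: "continuous_on {0..2 * pi} (\<lambda>s. - c k s)" by (intro continuous_on_minus c_continuous)
    have "integral {0..2 * pi} (\<lambda>s. - c k s) = 0" using int by simp
    from iffD1[OF integral_eq_0_iff[OF cont _ le] this] s0 nz(2) show False by auto
  qed
  show "\<exists>s\<in>{0..<2 * pi}. c k s < 0"
  proof (rule ccontr)
    assume "\<not> ?thesis"
    then have "c k s \<ge> 0" if "s \<in> {0..<2 * pi}" for s using that by (meson not_less)
    then have ge: "c k s \<ge> 0" if "s \<in> {0..2 * pi}" for s
      using closed[of "\<lambda>v. v \<ge> 0" k s] that by simp
    from iffD1[OF integral_eq_0_iff[OF c_continuous _ ge] int] s0 nz(2) show False by auto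
  qed
qed

end

theorem theorem6:
  fixes g \<omega> :: "real \<Rightarrow> real" and f X Y :: "real \<Rightarrow> real \<Rightarrow> real"
    and W :: "real set" and A0 :: real and p q :: nat
    and al Ac :: "nat \<Rightarrow> real \<Rightarrow> real \<Rightarrow> real" and c :: "nat \<Rightarrow> real \<Rightarrow> real"
  assumes g_analytic: "real_analytic_on g UNIV"
    and f_analytic: "real_analytic2_on f UNIV"
    and f_periodic: "\<And>x t. f x (t + 2 * pi) = f x t"
    and coords: "action_angle_coords g W \<omega> X Y"
    and pq: "p > 0" "q > 0" "coprime p q"
    and A0: "A0 \<in> W" "\<omega> A0 = real p / real q" "deriv \<omega> A0 \<noteq> 0"
    and series: "\<And>t0. subharmonic_series W \<omega> X Y f A0 (2 * pi * real q) t0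
                   (\<lambda>k. al k t0) (\<lambda>k. Ac k t0) (\<lambda>k. c k t0)"
    and convergence: "\<exists>r>0. \<forall>\<epsilon>. \<bar>\<epsilon>\<bar> < r \<longrightarrow>
                   uniformly_convergent_on UNIV (\<lambda>n t0. \<Sum>k<n. c k t0 * \<epsilon> ^ k)"
  shows "\<exists>\<epsilon>0>0.
           (\<forall>\<epsilon>. 0 < \<epsilon> \<and> \<epsilon> < \<epsilon>0 \<longrightarrow> gamma1 c \<epsilon> \<ge> 0 \<and> 0 \<ge> gamma2 c \<epsilon>) \<and>
           (\<forall>\<epsilon>. - \<epsilon>0 < \<epsilon> \<and> \<epsilon> < 0 \<longrightarrow> gamma1 c \<epsilon> \<le> 0 \<and> 0 \<le> gamma2 c \<epsilon>)"
proof -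
  interpret subharmonic g \<omega> W X Y f A0 p q al Ac c
    by unfold_locales (fact coords g_analytic f_analytic f_periodic pq A0 series)+
  have ne: "{0..<2 * pi} \<noteq> {}" using pi_gt_zero by auto
  have "\<exists>\<epsilon>0>0. \<forall>\<epsilon>. \<epsilon> \<noteq> 0 \<and> \<bar>\<epsilon>\<bar> < \<epsilon>0 \<longrightarrow>
      0 \<le> (SUP t0\<in>{0..<2 * pi}. C_sum c \<epsilon> t0) \<and> (INF t0\<in>{0..<2 * pi}. C_sum c \<epsilon> t0) \<le> 0"
  proof (cases "\<forall>k. \<forall>s\<in>{0..<2 * pi}. c k s = 0")
    case True
    then have "C_sum c \<epsilon> t0 = 0" if "t0 \<in> {0..<2 * pi}" for \<epsilon> t0
      using that by (simp add: C_sum_def)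
    then have "C_sum c \<epsilon> ` {0..<2 * pi} = (\<lambda>t0. 0) ` {0..<2 * pi}" for \<epsilon> by (rule image_cong[OF refl])
    then have "C_sum c \<epsilon> ` {0..<2 * pi} = {0}" for \<epsilon> using ne by (simp add: image_constant_conv)
    then show ?thesis by (intro exI[of _ 1]) simp
  next
    case False
    define k where "k = (LEAST k. \<exists>s\<in>{0..<2 * pi}. c k s \<noteq> 0)"
    have "\<exists>s\<in>{0..<2 * pi}. c k s \<noteq> 0" unfolding k_def by (rule LeastI_ex) (use False in blast)
    then obtain s0 where s0: "s0 \<in> {0..<2 * pi}" "c k s0 \<noteq> 0" by blast
    have zero: "c j s = 0" if "j < k" "s \<in> {0..<2 * pi}" for j s
      using not_less_Least[OF that(1)[unfolded k_def]] that(2) by blast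
    obtain t1 t2 where t: "t1 \<in> {0..<2 * pi}" "0 < c k t1" "t2 \<in> {0..<2 * pi}" "c k t2 < 0"
      using first_coefficient_changes_sign[OF zero s0] by blast
    obtain r where r: "r > 0" "\<And>\<epsilon>. \<bar>\<epsilon>\<bar> < r \<Longrightarrow>
        uniformly_convergent_on UNIV (\<lambda>n t0. \<Sum>k<n. c k t0 * \<epsilon> ^ k)"
      using convergence by blast
    note summable = uniform_limit_power_series(2)[OF r(2)]
    obtain \<delta>1 where \<delta>1: "\<delta>1 > 0" "\<And>e. e \<noteq> 0 \<Longrightarrow> \<bar>e\<bar> < \<delta>1 \<Longrightarrow> 0 < C_sum c e t1 * e ^ k * c k t1"
      using power_series_leading_sign[of r "\<lambda>j. c j t1" k, OF r(1) summable zero[OF _ t(1)]] t(2)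
      unfolding C_sum_def by auto
    obtain \<delta>2 where \<delta>2: "\<delta>2 > 0" "\<And>e. e \<noteq> 0 \<Longrightarrow> \<bar>e\<bar> < \<delta>2 \<Longrightarrow> 0 < C_sum c e t2 * e ^ k * c k t2"
      using power_series_leading_sign[of r "\<lambda>j. c j t2" k, OF r(1) summable zero[OF _ t(3)]] t(4)
      unfolding C_sum_def by auto
    show ?thesis
    proof (intro exI[of _ "min r (min \<delta>1 \<delta>2)"] conjI allI impI)
      fix \<epsilon> :: real assume \<epsilon>: "\<epsilon> \<noteq> 0 \<and> \<bar>\<epsilon>\<bar> < min r (min \<delta>1 \<delta>2)"
      have "0 < C_sum c \<epsilon> t1 * \<epsilon> ^ k" "C_sum c \<epsilon> t2 * \<epsilon> ^ k < 0"
        using \<delta>1(2)[of \<epsilon>] \<delta>2(2)[of \<epsilon>] \<epsilon> t(2,4) by (auto simp: zero_less_mult_iff)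
      then have "(0 \<le> C_sum c \<epsilon> t1 \<and> C_sum c \<epsilon> t2 \<le> 0) \<or> (0 \<le> C_sum c \<epsilon> t2 \<and> C_sum c \<epsilon> t1 \<le> 0)"
        unfolding zero_less_mult_iff mult_less_0_iff by linarith
      then obtain u v where uv: "u \<in> {0..<2 * pi}" "0 \<le> C_sum c \<epsilon> u" "v \<in> {0..<2 * pi}" "C_sum c \<epsilon> v \<le> 0"
        using t(1,3) by blast
      have bdd: "bdd_above (C_sum c \<epsilon> ` {0..<2 * pi})" "bdd_below (C_sum c \<epsilon> ` {0..<2 * pi})"
        by (rule C_sum_bounded[OF r(2) c_continuous], use \<epsilon> in simp)+
      show "0 \<le> (SUP t0\<in>{0..<2 * pi}. C_sum c \<epsilon> t0)"
        by (rule order_trans[OF uv(2) cSUP_upper[OF uv(1) bdd(1)]])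
      show "(INF t0\<in>{0..<2 * pi}. C_sum c \<epsilon> t0) \<le> 0"
        by (rule order_trans[OF cINF_lower[OF bdd(2) uv(3)] uv(4)])
    qed (use r \<delta>1 \<delta>2 in auto)
  qed
  then obtain \<epsilon>0 where "\<epsilon>0 > 0" and sup_inf: "\<And>\<epsilon>. \<epsilon> \<noteq> 0 \<Longrightarrow> \<bar>\<epsilon>\<bar> < \<epsilon>0 \<Longrightarrow>
      0 \<le> (SUP t0\<in>{0..<2 * pi}. C_sum c \<epsilon> t0) \<and> (INF t0\<in>{0..<2 * pi}. C_sum c \<epsilon> t0) \<le> 0"
    by blast
  show ?thesis
  proof (intro exI[of _ \<epsilon>0] conjI allI impI \<open>\<epsilon>0 > 0\<close>)
    fix \<epsilon> assume \<epsilon>: "0 < \<epsilon> \<and> \<epsilon> < \<epsilon>0"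
    then show "gamma1 c \<epsilon> \<ge> 0" "0 \<ge> gamma2 c \<epsilon>"
      using sup_inf[of \<epsilon>] unfolding gamma1_def gamma2_def
      by (auto intro: mult_nonneg_nonneg mult_nonneg_nonpos)
  next
    fix \<epsilon> assume \<epsilon>: "- \<epsilon>0 < \<epsilon> \<and> \<epsilon> < 0"
    then show "gamma1 c \<epsilon> \<le> 0" "0 \<le> gamma2 c \<epsilon>"
      using sup_inf[of \<epsilon>] unfolding gamma1_def gamma2_def
      by (auto intro: mult_nonpos_nonneg mult_nonpos_nonpos)
  qed
qed

end
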